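(* Let $q$ be a non-real complex number with $|q|\neq 1$, let $\theta=\frac{1}{\pi}\arg(q)$, and assume that $\theta$ is irrational. Let $q'\in\mathbb{R}$ be a non-zero real number. Then the $C^*$-algebras $C(U_q(2))$ and $C(U_{q'}(2))$ are not isomorphic.
   Context: For a non-zero complex number $q$, $C(U_q(2))$ denotes the universal unital $C^*$-algebra generated by elements $a,b,D$ satisfying the relations $$ba=q\,ab,\quad a^*b=q\,ba^*,\quad bb^*=b^*b,\quad aa^*+bb^*=1,$$ $$aD=Da,\quad bD=q^2|q|^{-2}Db,\quad DD^*=D^*D=1,\quad a^*a+|q|^2b^*b=1.$$ Isomorphism means isomorphism of $C^*$-algebras ($*$-isomorphism). *)

theory Defs
  imports "HOL-Analysis.Analysis" "HOL-Library.Poly_Mapping" "HOL-Algebra.Module"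
begin

section \<open>Unital C*-algebras\<close>

record 'a cstar_alg = "(complex, 'a) module" +
  star :: "'a \<Rightarrow> 'a"
  cnorm :: "'a \<Rightarrow> real"

definition complex_ring :: "complex ring" where
  "complex_ring = \<lparr>carrier = UNIV, mult = (*), one = 1, zero = 0, add = (+)\<rparr>"

locale unital_cstar_algebra = ring A + scalars: module complex_ring A
  for A :: "('a, 'm) cstar_alg_scheme" (structure) +
  assumes smult_mult_left:
      "\<lbrakk>x \<in> carrier A; y \<in> carrier A\<rbrakk> \<Longrightarrow> (c \<odot> x) \<otimes> y = c \<odot> (x \<otimes> y)"
    and smult_mult_right:
      "\<lbrakk>x \<in> carrier A; y \<in> carrier A\<rbrakk> \<Longrightarrow> x \<otimes> (c \<odot> y) = c \<odot> (x \<otimes> y)"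
    and star_closed: "x \<in> carrier A \<Longrightarrow> star A x \<in> carrier A"
    and star_star: "x \<in> carrier A \<Longrightarrow> star A (star A x) = x"
    and star_add:
      "\<lbrakk>x \<in> carrier A; y \<in> carrier A\<rbrakk> \<Longrightarrow> star A (x \<oplus> y) = star A x \<oplus> star A y"
    and star_mult:
      "\<lbrakk>x \<in> carrier A; y \<in> carrier A\<rbrakk> \<Longrightarrow> star A (x \<otimes> y) = star A y \<otimes> star A x"
    and star_smult: "x \<in> carrier A \<Longrightarrow> star A (c \<odot> x) = cnj c \<odot> star A x"
    and cnorm_nonneg: "x \<in> carrier A \<Longrightarrow> 0 \<le> cnorm A x"
    and cnorm_eq_0: "x \<in> carrier A \<Longrightarrow> cnorm A x = 0 \<longleftrightarrow> x = \<zero>"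
    and cnorm_add:
      "\<lbrakk>x \<in> carrier A; y \<in> carrier A\<rbrakk> \<Longrightarrow> cnorm A (x \<oplus> y) \<le> cnorm A x + cnorm A y"
    and cnorm_smult: "x \<in> carrier A \<Longrightarrow> cnorm A (c \<odot> x) = cmod c * cnorm A x"
    and cnorm_mult:
      "\<lbrakk>x \<in> carrier A; y \<in> carrier A\<rbrakk> \<Longrightarrow> cnorm A (x \<otimes> y) \<le> cnorm A x * cnorm A y"
    and cstar_identity: "x \<in> carrier A \<Longrightarrow> cnorm A (star A x \<otimes> x) = (cnorm A x)\<^sup>2"
    and complete:
      "\<lbrakk>\<And>n. s n \<in> carrier A;
        \<And>e. 0 < e \<Longrightarrow> \<exists>N. \<forall>m\<ge>N. \<forall>n\<ge>N. cnorm A (s m \<ominus> s n) < e\<rbrakk> \<Longrightarrow>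
       \<exists>l\<in>carrier A. (\<lambda>n. cnorm A (s n \<ominus> l)) \<longlonglongrightarrow> 0"

definition star_hom ::
  "('a, 'm) cstar_alg_scheme \<Rightarrow> ('b, 'n) cstar_alg_scheme \<Rightarrow> ('a \<Rightarrow> 'b) set" where
  "star_hom A B = {h \<in> ring_hom A B.
     (\<forall>c. \<forall>x\<in>carrier A. h (c \<odot>\<^bsub>A\<^esub> x) = c \<odot>\<^bsub>B\<^esub> h x) \<and>
     (\<forall>x\<in>carrier A. h (star A x) = star B (h x))}"

text \<open>Preservation of the unit, which is part of \<^const>\<open>ring_hom\<close>, is automatic for a
  multiplicative bijection.\<close>

definition star_isomorphic ::
  "('a, 'm) cstar_alg_scheme \<Rightarrow> ('b, 'n) cstar_alg_scheme \<Rightarrow> bool" where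
  "star_isomorphic A B \<longleftrightarrow> (\<exists>h \<in> star_hom A B. bij_betw h (carrier A) (carrier B))"


section \<open>The free unital *-algebra on a set of generators\<close>

datatype 'g letter = Gen 'g | Adj 'g

datatype 'g word = Word "'g letter list"

instantiation word :: (type) monoid_add
begin

definition zero_word :: "'a word" where "zero_word = Word []"

fun plus_word :: "'a word \<Rightarrow> 'a word \<Rightarrow> 'a word" where
  "plus_word (Word u) (Word v) = Word (u @ v)"

instance
proof
  fix u v w :: "'a word"
  show "u + v + w = u + (v + w)" by (cases u; cases v; cases w) simp
  show "0 + u = u" by (cases u) (simp add: zero_word_def)
  show "u + 0 = u" by (cases u) (simp add: zero_word_def)
qed

end

text \<open>The product of \<^theory>\<open>HOL-Library.Poly_Mapping\<close> is convolution along
  \<^const>\<open>plus\<close> on words, that is, the complex monoid algebra of the free monoid.\<close>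

type_synonym 'g free_alg = "'g word \<Rightarrow>\<^sub>0 complex"

fun adj_letter :: "'g letter \<Rightarrow> 'g letter" where
  "adj_letter (Gen g) = Adj g"
| "adj_letter (Adj g) = Gen g"

fun adj_word :: "'g word \<Rightarrow> 'g word" where
  "adj_word (Word u) = Word (rev (map adj_letter u))"

lemma adj_letter_adj_letter [simp]: "adj_letter (adj_letter l) = l"
  by (cases l) auto

lemma adj_word_adj_word [simp]: "adj_word (adj_word w) = w"
  by (cases w) (simp add: rev_map comp_def)

lift_definition fstar :: "'g free_alg \<Rightarrow> 'g free_alg" is "\<lambda>f w. cnj (f (adj_word w))"
proof -
  fix f :: "'g word \<Rightarrow> complex"
  assume "finite {w. f w \<noteq> 0}"
  moreover have "{w. cnj (f (adj_word w)) \<noteq> 0} \<subseteq> adj_word ` {w. f w \<noteq> 0}"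
    by (auto intro!: image_eqI[of _ _ "adj_word _"])
  ultimately show "finite {w. cnj (f (adj_word w)) \<noteq> 0}"
    using finite_surj by blast
qed

abbreviation fgen :: "'g \<Rightarrow> 'g free_alg" where
  "fgen g \<equiv> Poly_Mapping.single (Word [Gen g]) 1"

text \<open>Scalars, embedded as multiples of the empty word; \<open>fconst c * x\<close> is scalar
  multiplication.\<close>

abbreviation fconst :: "complex \<Rightarrow> 'g free_alg" where
  "fconst c \<equiv> Poly_Mapping.single 0 c"


section \<open>Universal C*-algebras\<close>

locale cstar_seminorm =
  fixes p :: "'g free_alg \<Rightarrow> real"
  assumes nonneg: "0 \<le> p x"
    and add: "p (x + y) \<le> p x + p y"
    and scale: "p (fconst c * x) = cmod c * p x"
    and mult: "p (x * y) \<le> p x * p y"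
    and cstar: "p (fstar x * x) = (p x)\<^sup>2"

text \<open>The unital C*-algebra presented by relators \<open>R\<close> is the separated completion of the free
  *-algebra in the largest C*-seminorm that vanishes on \<open>R\<close>. It exists only if these
  seminorms are pointwise bounded.\<close>

definition relator_seminorms :: "'g free_alg set \<Rightarrow> ('g free_alg \<Rightarrow> real) set" where
  "relator_seminorms R = {p. cstar_seminorm p \<and> (\<forall>r\<in>R. p r = 0)}"

definition universal_seminorm :: "'g free_alg set \<Rightarrow> 'g free_alg \<Rightarrow> real" where
  "universal_seminorm R x = (SUP p \<in> relator_seminorms R. p x)"

definition cauchy_seqs :: "('g free_alg \<Rightarrow> real) \<Rightarrow> (nat \<Rightarrow> 'g free_alg) set" where
  "cauchy_seqs p = {x. \<forall>e>0. \<exists>N. \<forall>m\<ge>N. \<forall>n\<ge>N. p (x m - x n) < e}"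

definition null_rel ::
  "('g free_alg \<Rightarrow> real) \<Rightarrow> ((nat \<Rightarrow> 'g free_alg) \<times> (nat \<Rightarrow> 'g free_alg)) set" where
  "null_rel p = {(x, y). x \<in> cauchy_seqs p \<and> y \<in> cauchy_seqs p \<and>
     (\<lambda>n. p (x n - y n)) \<longlonglongrightarrow> 0}"

definition cauchy_class ::
  "('g free_alg \<Rightarrow> real) \<Rightarrow> (nat \<Rightarrow> 'g free_alg) \<Rightarrow> (nat \<Rightarrow> 'g free_alg) set" where
  "cauchy_class p x = null_rel p `` {x}"

definition rep :: "'a set \<Rightarrow> 'a" where
  "rep X = (SOME x. x \<in> X)"

definition cstar_completion ::
  "('g free_alg \<Rightarrow> real) \<Rightarrow> (nat \<Rightarrow> 'g free_alg) set cstar_alg" where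
  "cstar_completion p =
    \<lparr>carrier = cauchy_seqs p // null_rel p,
     mult = (\<lambda>X Y. cauchy_class p (\<lambda>n. rep X n * rep Y n)),
     one = cauchy_class p (\<lambda>n. 1),
     zero = cauchy_class p (\<lambda>n. 0),
     add = (\<lambda>X Y. cauchy_class p (\<lambda>n. rep X n + rep Y n)),
     smult = (\<lambda>c X. cauchy_class p (\<lambda>n. fconst c * rep X n)),
     star = (\<lambda>X. cauchy_class p (\<lambda>n. fstar (rep X n))),
     cnorm = (\<lambda>X. lim (\<lambda>n. p (rep X n)))\<rparr>"

definition universal_cstar :: "'g free_alg set \<Rightarrow> (nat \<Rightarrow> 'g free_alg) set cstar_alg" where
  "universal_cstar R = cstar_completion (universal_seminorm R)"

definition universal_gen :: "'g free_alg set \<Rightarrow> 'g \<Rightarrow> (nat \<Rightarrow> 'g free_alg) set" where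
  "universal_gen R g = cauchy_class (universal_seminorm R) (\<lambda>n. fgen g)"


section \<open>The C*-algebra of the quantum group \<open>U\<^sub>q(2)\<close>\<close>

datatype Uq2_gen = gen_a | gen_b | gen_D

definition Uq2_relators :: "complex \<Rightarrow> Uq2_gen free_alg set" where
  "Uq2_relators q =
    (let a = fgen gen_a; b = fgen gen_b; D = fgen gen_D; t = fconst (of_real ((cmod q)\<^sup>2)) in
     {b * a - fconst q * a * b,
      fstar a * b - fconst q * b * fstar a,
      b * fstar b - fstar b * b,
      a * fstar a + b * fstar b - 1,
      a * D - D * a,
      b * D - fconst (q\<^sup>2 / of_real ((cmod q)\<^sup>2)) * D * b,
      D * fstar D - 1,
      fstar D * D - 1,
      fstar a * a + t * fstar b * b - 1})"

definition C_Uq2 :: "complex \<Rightarrow> (nat \<Rightarrow> Uq2_gen free_alg) set cstar_alg" where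
  "C_Uq2 q = universal_cstar (Uq2_relators q)"


section \<open>The universal property\<close>

text \<open>The rest of this theory shows that, for \<open>q \<noteq> 0\<close>, \<^const>\<open>C_Uq2\<close> is a unital
  C*-algebra generated by a triple satisfying the defining relations, and that every
  triple satisfying them in a unital C*-algebra is the image of this one under a unital
  *-homomorphism: \<open>C_Uq2_cstar_algebra\<close>, \<open>C_Uq2_triple\<close>, \<open>C_Uq2_dense\<close>,
  \<open>C_Uq2_universal\<close> at the end. The target algebra there may have any carrier type.\<close>

subsection \<open>The free algebra and its C*-seminorms\<close>

lemma free_alg_induct [case_names zero single plus]:
  fixes x :: "'g free_alg"
  assumes "P 0" "\<And>w c. P (Poly_Mapping.single w c)" "\<And>x y. P x \<Longrightarrow> P y \<Longrightarrow> P (x + y)"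
  shows "P x"
proof (induction x rule: update_induct)
  case const
  show ?case by (rule assms(1))
next
  case (update f w c)
  have "Poly_Mapping.update w c f = f + Poly_Mapping.single w c"
    using update.hyps
    by (intro poly_mapping_eqI) (auto simp: lookup_update lookup_add lookup_single in_keys_iff when_def)
  then show ?case
    using assms(2,3) update by metis
qed

lemma fconst_mult [simp]: "fconst c * fconst d = fconst (c * d)"
  by (simp add: mult_single)

lemma fconst_add [simp]: "fconst c + fconst d = fconst (c + d)"
  by (simp add: single_add)

lemma fconst_minus [simp]: "- fconst c = fconst (- c)"
  by (simp add: single_uminus)

lemma fconst_one: "fconst 1 = 1"
  by simp

lemma fconst_commute: "x * fconst c = fconst c * (x :: 'g free_alg)"
  by (induction x rule: free_alg_induct) (auto simp: mult_single algebra_simps)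

lemma fconst_left_commute: "x * (fconst c * y) = fconst c * (x * (y :: 'g free_alg))"
  by (metis fconst_commute mult.assoc)

lemma adj_word_plus: "adj_word (u + v) = adj_word v + adj_word u"
  by (cases u; cases v) auto

lemma adj_word_zero [simp]: "adj_word 0 = 0"
  by (simp add: zero_word_def)

lemma fstar_fstar [simp]: "fstar (fstar x) = x"
  by (rule poly_mapping_eqI) (simp add: fstar.rep_eq)

lemma fstar_add [simp]: "fstar (x + y) = fstar x + fstar y"
  by (rule poly_mapping_eqI) (simp add: fstar.rep_eq lookup_add)

lemma fstar_zero [simp]: "fstar 0 = 0"
  by (rule poly_mapping_eqI) (simp add: fstar.rep_eq)

lemma fstar_uminus [simp]: "fstar (- x) = - fstar x"
  by (rule poly_mapping_eqI) (simp add: fstar.rep_eq)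

lemma fstar_diff [simp]: "fstar (x - y) = fstar x - fstar y"
  using fstar_add[of x "- y"] by (simp del: fstar_add add: fstar_add)

lemma fstar_single [simp]:
  "fstar (Poly_Mapping.single w c) = Poly_Mapping.single (adj_word w) (cnj c)"
  by (rule poly_mapping_eqI) (auto simp: fstar.rep_eq lookup_single when_def)

lemma fstar_one [simp]: "fstar 1 = 1"
  using fstar_single[of 0 1] by simp

lemma fstar_mult [simp]: "fstar (x * y) = fstar y * fstar x"
proof (induction x rule: free_alg_induct)
  case (single w c)
  show ?case
    by (induction y rule: free_alg_induct)
      (auto simp: mult_single adj_word_plus algebra_simps)
qed (auto simp: algebra_simps)

context cstar_seminorm
begin

lemma zero [simp]: "p 0 = 0"
  using scale[of 0 0] by simp

lemma uminus [simp]: "p (- x) = p x"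
proof -
  have "- x = fconst (- 1) * x"
    by (metis fconst_minus fconst_one mult_minus1)
  then show ?thesis using scale[of "- 1" x] by simp
qed

lemma minus_commute: "p (x - y) = p (y - x)"
  using uminus[of "x - y"] by simp

lemma diff: "p (x - y) \<le> p x + p y"
  using add[of x "- y"] by simp

lemma triangle: "p (x - z) \<le> p (x - y) + p (y - z)"
  using add[of "x - y" "y - z"] by simp

lemma diff_abs: "\<bar>p x - p y\<bar> \<le> p (x - y)"
  using add[of "x - y" y] add[of "y - x" x] minus_commute[of x y] by simp

lemma fstar_le: "p x \<le> p (fstar x)"
proof (cases "p x = 0")
  case False
  then have "0 < p x" using nonneg[of x] by simp
  moreover have "p x * p x \<le> p (fstar x) * p x"
    using cstar[of x] mult[of "fstar x" x] by (simp add: power2_eq_square)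
  ultimately show ?thesis by simp
qed (use nonneg in simp)

lemma fstar [simp]: "p (fstar x) = p x"
  using fstar_le[of x] fstar_le[of "fstar x"] by simp

lemma cstar': "p (x * fstar x) = (p x)\<^sup>2"
  using cstar[of "fstar x"] by simp

lemma one_le: "p 1 \<le> 1"
proof -
  have "p 1 = (p 1)\<^sup>2" using cstar[of 1] by simp
  then have "p 1 = 0 \<or> p 1 = 1" by (auto simp: power2_eq_square)
  then show ?thesis by auto
qed

lemma fconst_le: "p (fconst c) \<le> cmod c"
  using scale[of c 1] one_le by (simp add: mult_left_le)

lemma diff_zero_cong: "p (x - y) = 0 \<Longrightarrow> p x = p y"
  using diff_abs[of x y] by simp

lemma mult_diff: "p (x * y - x' * y') \<le> p x * p (y - y') + p (x - x') * p y'"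
proof -
  have "x * y - x' * y' = x * (y - y') + (x - x') * y'" by (simp add: algebra_simps)
  then show ?thesis
    using add[of "x * (y - y')" "(x - x') * y'"] mult[of x "y - y'"] mult[of "x - x'" y']
    by simp
qed

end

lemma zero_cstar_seminorm: "cstar_seminorm (\<lambda>_. 0)"
  by unfold_locales auto

lemma universal_seminorm_upper:
  assumes "\<And>x. bdd_above ((\<lambda>p. p x) ` relator_seminorms R)" "p \<in> relator_seminorms R"
  shows "p x \<le> universal_seminorm R x"
  unfolding universal_seminorm_def using assms by (intro cSUP_upper) auto

lemma relator_seminorms_nonempty: "relator_seminorms R \<noteq> {}"
  using zero_cstar_seminorm by (force simp: relator_seminorms_def)

lemma universal_seminorm_least:
  assumes "\<And>p. p \<in> relator_seminorms R \<Longrightarrow> p x \<le> c"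
  shows "universal_seminorm R x \<le> c"
  unfolding universal_seminorm_def
  using assms relator_seminorms_nonempty by (intro cSUP_least) auto

lemma universal_seminorm_in:
  assumes bdd: "\<And>x. bdd_above ((\<lambda>p. p x) ` relator_seminorms R)"
  shows "universal_seminorm R \<in> relator_seminorms R"
proof -
  let ?u = "universal_seminorm R"
  note upper = universal_seminorm_upper[OF bdd]
  have sn: "cstar_seminorm p" if "p \<in> relator_seminorms R" for p
    using that by (simp add: relator_seminorms_def)
  have z: "(\<lambda>_. 0) \<in> relator_seminorms R"
    using zero_cstar_seminorm by (simp add: relator_seminorms_def)
  have nonneg: "0 \<le> ?u x" for x
    using upper[OF z] .
  have scale_le: "?u (fconst c * x) \<le> cmod c * ?u x" for c x
    by (intro universal_seminorm_least)
      (simp add: cstar_seminorm.scale[OF sn] mult_left_mono upper)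
  have "cstar_seminorm ?u"
  proof
    show "0 \<le> ?u x" for x by (rule nonneg)
    show "?u (x + y) \<le> ?u x + ?u y" for x y
    proof (rule universal_seminorm_least)
      fix p assume p: "p \<in> relator_seminorms R"
      show "p (x + y) \<le> ?u x + ?u y"
        using cstar_seminorm.add[OF sn[OF p], of x y] upper[OF p, of x] upper[OF p, of y] by simp
    qed
    show "?u (x * y) \<le> ?u x * ?u y" for x y
    proof (rule universal_seminorm_least)
      fix p assume p: "p \<in> relator_seminorms R"
      have "p x * p y \<le> ?u x * ?u y"
        using upper[OF p] cstar_seminorm.nonneg[OF sn[OF p]] nonneg by (intro mult_mono) auto
      then show "p (x * y) \<le> ?u x * ?u y"
        using cstar_seminorm.mult[OF sn[OF p], of x y] by simp
    qed
    show "?u (fconst c * x) = cmod c * ?u x" for c x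
    proof (cases "c = 0")
      case True
      then show ?thesis using scale_le[of 0 x] nonneg[of 0] by simp
    next
      case False
      have "?u (fconst (inverse c) * (fconst c * x)) \<le> cmod (inverse c) * ?u (fconst c * x)"
        by (rule scale_le)
      also have "fconst (inverse c) * (fconst c * x) = x"
        using False by (simp add: mult.assoc[symmetric])
      finally show ?thesis
        using False scale_le[of c x] by (simp add: norm_inverse norm_divide field_simps)
    qed
    show "?u (fstar x * x) = (?u x)\<^sup>2" for x
    proof (rule antisym)
      show "?u (fstar x * x) \<le> (?u x)\<^sup>2"
      proof (rule universal_seminorm_least)
        fix p assume p: "p \<in> relator_seminorms R"
        show "p (fstar x * x) \<le> (?u x)\<^sup>2"
          unfolding cstar_seminorm.cstar[OF sn[OF p]]
          using upper[OF p, of x] cstar_seminorm.nonneg[OF sn[OF p], of x] by (intro power_mono)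
      qed
      have "?u x \<le> sqrt (?u (fstar x * x))"
      proof (rule universal_seminorm_least)
        fix p assume p: "p \<in> relator_seminorms R"
        show "p x \<le> sqrt (?u (fstar x * x))"
          using upper[OF p, of "fstar x * x"] cstar_seminorm.cstar[OF sn[OF p], of x]
          by (simp add: real_le_rsqrt)
      qed
      then show "(?u x)\<^sup>2 \<le> ?u (fstar x * x)"
        using nonneg by (metis abs_of_nonneg power_mono real_sqrt_pow2)
    qed
  qed
  moreover have "?u r = 0" if "r \<in> R" for r
  proof -
    have "?u r \<le> 0"
      using that by (intro universal_seminorm_least) (simp add: relator_seminorms_def)
    then show ?thesis using nonneg[of r] by simp
  qed
  ultimately show ?thesis by (simp add: relator_seminorms_def)
qed


subsection \<open>The completion is a C*-algebra\<close>

lemma cring_complex_ring: "cring complex_ring"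
proof (rule cringI)
  show "abelian_group complex_ring"
    by (rule abelian_groupI)
      (auto simp: complex_ring_def algebra_simps intro: exI[of _ "- _"] add.right_inverse)
  show "Group.comm_monoid complex_ring"
    by unfold_locales (auto simp: complex_ring_def algebra_simps)
qed (auto simp: complex_ring_def algebra_simps)

lemma complex_ring_simps [simp]:
  "carrier complex_ring = UNIV" "\<one>\<^bsub>complex_ring\<^esub> = 1" "\<zero>\<^bsub>complex_ring\<^esub> = 0"
  "c \<oplus>\<^bsub>complex_ring\<^esub> d = c + d" "c \<otimes>\<^bsub>complex_ring\<^esub> d = c * d"
  by (simp_all add: complex_ring_def)

lemma abelian_group_minusI:
  assumes "abelian_group G" "x \<in> carrier G" "y \<in> carrier G" "z \<in> carrier G" "z \<oplus>\<^bsub>G\<^esub> y = x"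
  shows "x \<ominus>\<^bsub>G\<^esub> y = z"
proof -
  interpret abelian_group G by fact
  show ?thesis using assms(2-5) by (auto simp: a_minus_def a_assoc r_neg)
qed

lemma abelian_group_minus_minus:
  assumes "abelian_group G" "x \<in> carrier G" "y \<in> carrier G" "z \<in> carrier G"
  shows "x \<ominus>\<^bsub>G\<^esub> z = (x \<ominus>\<^bsub>G\<^esub> y) \<oplus>\<^bsub>G\<^esub> (y \<ominus>\<^bsub>G\<^esub> z)"
proof -
  interpret abelian_group G by fact
  show ?thesis using assms(2-4) by (simp add: a_minus_def a_assoc r_neg1)
qed

context cstar_seminorm
begin

abbreviation "\<C> \<equiv> cstar_completion p"
abbreviation "cls \<equiv> cauchy_class p"

lemma cauchyD: "x \<in> cauchy_seqs p \<Longrightarrow> 0 < e \<Longrightarrow> \<exists>N. \<forall>m\<ge>N. \<forall>n\<ge>N. p (x m - x n) < e"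
  by (simp add: cauchy_seqs_def)

lemma cauchy_lipschitz:
  assumes x: "x \<in> cauchy_seqs p" and y: "y \<in> cauchy_seqs p"
    and le: "\<And>m n. p (z m - z n) \<le> c * p (x m - x n) + d * p (y m - y n)"
  shows "z \<in> cauchy_seqs p"
  unfolding cauchy_seqs_def
proof (clarify)
  fix e :: real assume "0 < e"
  define k where "k = 1 + \<bar>c\<bar> + \<bar>d\<bar>"
  have k: "0 < k" by (simp add: k_def)
  then have "0 < e / k" using \<open>0 < e\<close> by simp
  from cauchyD[OF x this] obtain N1 where N1: "\<And>m n. m \<ge> N1 \<Longrightarrow> n \<ge> N1 \<Longrightarrow> p (x m - x n) < e / k"
    by blast
  from cauchyD[OF y \<open>0 < e / k\<close>] obtain N2 where
    N2: "\<And>m n. m \<ge> N2 \<Longrightarrow> n \<ge> N2 \<Longrightarrow> p (y m - y n) < e / k" by blast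
  have "p (z m - z n) < e" if "m \<ge> max N1 N2" "n \<ge> max N1 N2" for m n
  proof -
    have "c * p (x m - x n) \<le> \<bar>c\<bar> * (e / k)"
      using N1[of m n] that nonneg[of "x m - x n"] by (intro mult_mono) auto
    moreover have "d * p (y m - y n) \<le> \<bar>d\<bar> * (e / k)"
      using N2[of m n] that nonneg[of "y m - y n"] by (intro mult_mono) auto
    moreover have "\<bar>c\<bar> * (e / k) + \<bar>d\<bar> * (e / k) + e / k = e"
    proof -
      have "\<bar>c\<bar> * (e / k) + \<bar>d\<bar> * (e / k) + e / k = k * (e / k)"
        by (simp only: k_def distrib_right mult_1 add_ac)
      then show ?thesis using k by simp
    qed
    ultimately show ?thesis
      using le[of m n] \<open>0 < e / k\<close> by linarith
  qed
  then show "\<exists>N. \<forall>m\<ge>N. \<forall>n\<ge>N. p (z m - z n) < e" by blast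
qed

lemma cauchy_const [simp, intro]: "(\<lambda>n. x) \<in> cauchy_seqs p"
  by (simp add: cauchy_seqs_def)

lemma cauchy_add [intro]:
  assumes "x \<in> cauchy_seqs p" "y \<in> cauchy_seqs p"
  shows "(\<lambda>n. x n + y n) \<in> cauchy_seqs p"
proof (rule cauchy_lipschitz[OF assms, of _ 1 1])
  fix m n
  have "x m + y m - (x n + y n) = (x m - x n) + (y m - y n)" by simp
  then show "p (x m + y m - (x n + y n)) \<le> 1 * p (x m - x n) + 1 * p (y m - y n)"
    using add[of "x m - x n" "y m - y n"] by (metis mult_1)
qed

lemma cauchy_fconst [intro]:
  assumes "x \<in> cauchy_seqs p"
  shows "(\<lambda>n. fconst c * x n) \<in> cauchy_seqs p"
  by (rule cauchy_lipschitz[OF assms assms, of _ "cmod c" 0])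
    (simp add: right_diff_distrib[symmetric] scale)

lemma cauchy_fstar [intro]:
  assumes "x \<in> cauchy_seqs p"
  shows "(\<lambda>n. fstar (x n)) \<in> cauchy_seqs p"
  by (rule cauchy_lipschitz[OF assms assms, of _ 1 0])
    (simp add: fstar_diff[symmetric] del: fstar_diff)

lemma cauchy_uminus [intro]:
  assumes "x \<in> cauchy_seqs p"
  shows "(\<lambda>n. - x n) \<in> cauchy_seqs p"
  by (rule cauchy_lipschitz[OF assms assms, of _ 1 0]) (simp add: minus_commute)

lemma cauchy_norm_convergent:
  assumes "x \<in> cauchy_seqs p"
  shows "convergent (\<lambda>n. p (x n))"
proof (rule Cauchy_convergent, rule CauchyI)
  fix e :: real assume "0 < e"
  from cauchyD[OF assms this] obtain N where N: "\<forall>m\<ge>N. \<forall>n\<ge>N. p (x m - x n) < e" by blast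
  have "norm (p (x m) - p (x n)) < e" if "m \<ge> N" "n \<ge> N" for m n
    using N that diff_abs[of "x m" "x n"] by (auto intro: le_less_trans)
  then show "\<exists>M. \<forall>m\<ge>M. \<forall>n\<ge>M. norm (p (x m) - p (x n)) < e" by blast
qed

lemma cauchy_bounded:
  assumes "x \<in> cauchy_seqs p"
  obtains B where "\<And>n. p (x n) \<le> B"
proof -
  have "Bseq (\<lambda>n. p (x n))"
    using cauchy_norm_convergent[OF assms] by (simp add: convergent_imp_Bseq)
  then obtain B where "\<And>n. norm (p (x n)) \<le> B" by (auto simp: Bseq_def)
  then have "p (x n) \<le> B" for n using abs_le_D1 by (metis real_norm_def)
  then show ?thesis by (rule that)
qed

lemma cauchy_mult [intro]:
  assumes x: "x \<in> cauchy_seqs p" and y: "y \<in> cauchy_seqs p"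
  shows "(\<lambda>n. x n * y n) \<in> cauchy_seqs p"
proof -
  obtain B where B: "\<And>n. p (x n) \<le> B" using cauchy_bounded[OF x] by blast
  obtain D where D: "\<And>n. p (y n) \<le> D" using cauchy_bounded[OF y] by blast
  show ?thesis
  proof (rule cauchy_lipschitz[OF x y, of _ D B])
    fix m n
    have "p (x m) * p (y m - y n) + p (x m - x n) * p (y n) \<le> B * p (y m - y n) + D * p (x m - x n)"
      using B[of m] D[of n] nonneg[of "y m - y n"] nonneg[of "x m - x n"]
      by (metis add_mono mult.commute mult_right_mono)
    then show "p (x m * y m - x n * y n) \<le> D * p (x m - x n) + B * p (y m - y n)"
      using mult_diff[of "x m" "y m" "x n" "y n"] by linarith
  qed
qed

lemma tendsto_zero_bound:
  fixes f g :: "nat \<Rightarrow> real"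
  assumes "g \<longlonglongrightarrow> 0" "\<And>n. 0 \<le> f n" "\<And>n. f n \<le> g n"
  shows "f \<longlonglongrightarrow> 0"
  by (rule real_tendsto_sandwich[OF _ _ tendsto_const assms(1)]) (simp_all add: assms)

lemma equiv_null_rel: "equiv (cauchy_seqs p) (null_rel p)"
proof (rule equivI)
  show "null_rel p \<subseteq> cauchy_seqs p \<times> cauchy_seqs p"
    by (auto simp: null_rel_def)
  show "refl_on (cauchy_seqs p) (null_rel p)"
    by (auto simp: refl_on_def null_rel_def)
  show "sym (null_rel p)"
    by (auto simp: sym_def null_rel_def minus_commute)
  show "trans (null_rel p)"
  proof (rule transI)
    fix x y z assume "(x, y) \<in> null_rel p" "(y, z) \<in> null_rel p"
    then have *: "x \<in> cauchy_seqs p" "z \<in> cauchy_seqs p"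
      "(\<lambda>n. p (x n - y n) + p (y n - z n)) \<longlonglongrightarrow> 0 + 0"
      unfolding null_rel_def by (auto intro!: tendsto_add simp del: add_0_left add_0_right)
    have "(\<lambda>n. p (x n - z n)) \<longlonglongrightarrow> 0"
      using *(3) by - (rule tendsto_zero_bound[of "\<lambda>n. p (x n - y n) + p (y n - z n)"], simp_all add: nonneg triangle)
    with * show "(x, z) \<in> null_rel p" by (simp add: null_rel_def)
  qed
qed

lemma cls_eq_iff:
  assumes "x \<in> cauchy_seqs p" "y \<in> cauchy_seqs p"
  shows "cls x = cls y \<longleftrightarrow> (\<lambda>n. p (x n - y n)) \<longlonglongrightarrow> 0"
  unfolding cauchy_class_def
  using eq_equiv_class_iff[OF equiv_null_rel assms] assms by (simp add: null_rel_def)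

lemma carrier_eq: "carrier \<C> = cauchy_seqs p // null_rel p"
  by (simp add: cstar_completion_def)

lemma cls_closed [intro, simp]: "x \<in> cauchy_seqs p \<Longrightarrow> cls x \<in> carrier \<C>"
  by (simp add: carrier_eq cauchy_class_def quotientI)

lemma carrierE:
  assumes "X \<in> carrier \<C>"
  obtains x where "x \<in> cauchy_seqs p" "X = cls x"
  using assms by (auto simp: carrier_eq cauchy_class_def elim!: quotientE)

lemma rep_cls:
  assumes "x \<in> cauchy_seqs p"
  shows "rep (cls x) \<in> cauchy_seqs p" "(\<lambda>n. p (rep (cls x) n - x n)) \<longlonglongrightarrow> 0"
proof -
  have "x \<in> cls x"
    using assms by (simp add: cauchy_class_def null_rel_def)
  then have "rep (cls x) \<in> cls x" unfolding rep_def by (rule someI[of "\<lambda>y. y \<in> cls x"])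
  then show "rep (cls x) \<in> cauchy_seqs p" "(\<lambda>n. p (rep (cls x) n - x n)) \<longlonglongrightarrow> 0"
    by (auto simp: cauchy_class_def null_rel_def minus_commute)
qed

lemma cls_rep:
  assumes "X \<in> carrier \<C>"
  shows "rep X \<in> cauchy_seqs p" "cls (rep X) = X"
  using assms rep_cls cls_eq_iff by (metis carrierE)+

lemma cls_add:
  assumes "x \<in> cauchy_seqs p" "y \<in> cauchy_seqs p"
  shows "cls x \<oplus>\<^bsub>\<C>\<^esub> cls y = cls (\<lambda>n. x n + y n)"
proof -
  let ?x = "rep (cls x)" and ?y = "rep (cls y)"
  note x = rep_cls[OF assms(1)] and y = rep_cls[OF assms(2)]
  have "p (?x n + ?y n - (x n + y n)) \<le> p (?x n - x n) + p (?y n - y n)" for n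
    using add[of "?x n - x n" "?y n - y n"] by (simp add: algebra_simps)
  then have "(\<lambda>n. p (?x n + ?y n - (x n + y n))) \<longlonglongrightarrow> 0"
    using tendsto_add[OF x(2) y(2)]
    by - (rule tendsto_zero_bound[of "\<lambda>n. p (?x n - x n) + p (?y n - y n)"], simp_all add: nonneg)
  then show ?thesis
    using assms x(1) y(1) by (simp add: cstar_completion_def cls_eq_iff cauchy_add)
qed

lemma cls_mult:
  assumes "x \<in> cauchy_seqs p" "y \<in> cauchy_seqs p"
  shows "cls x \<otimes>\<^bsub>\<C>\<^esub> cls y = cls (\<lambda>n. x n * y n)"
proof -
  let ?x = "rep (cls x)" and ?y = "rep (cls y)"
  note x = rep_cls[OF assms(1)] and y = rep_cls[OF assms(2)]
  obtain B where B: "\<And>n. p (?x n) \<le> B" using cauchy_bounded[OF x(1)] by blast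
  obtain D where D: "\<And>n. p (y n) \<le> D" using cauchy_bounded[OF assms(2)] by blast
  have "p (?x n * ?y n - x n * y n) \<le> B * p (?y n - y n) + p (?x n - x n) * D" for n
    using mult_diff[of "?x n" "?y n" "x n" "y n"] B[of n] D[of n]
      nonneg[of "?y n - y n"] nonneg[of "?x n - x n"]
    by (meson add_mono mult_left_mono mult_right_mono order.trans)
  moreover have "(\<lambda>n. B * p (?y n - y n) + p (?x n - x n) * D) \<longlonglongrightarrow> B * 0 + 0 * D"
    by (intro tendsto_intros x(2) y(2))
  ultimately have "(\<lambda>n. p (?x n * ?y n - x n * y n)) \<longlonglongrightarrow> 0"
    by - (rule tendsto_zero_bound[of "\<lambda>n. B * p (?y n - y n) + p (?x n - x n) * D"], simp_all add: nonneg)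
  then show ?thesis
    using assms x(1) y(1) by (simp add: cstar_completion_def cls_eq_iff cauchy_mult)
qed

lemma cls_smult:
  assumes "x \<in> cauchy_seqs p"
  shows "c \<odot>\<^bsub>\<C>\<^esub> cls x = cls (\<lambda>n. fconst c * x n)"
proof -
  note x = rep_cls[OF assms]
  have "(\<lambda>n. p (fconst c * rep (cls x) n - fconst c * x n)) \<longlonglongrightarrow> cmod c * 0"
    unfolding right_diff_distrib[symmetric] scale by (intro tendsto_intros x(2))
  then show ?thesis
    using assms x(1) by (simp add: cstar_completion_def cls_eq_iff cauchy_fconst)
qed

lemma cls_star:
  assumes "x \<in> cauchy_seqs p"
  shows "star \<C> (cls x) = cls (\<lambda>n. fstar (x n))"
  using assms rep_cls[OF assms]
  by (simp add: cstar_completion_def cls_eq_iff cauchy_fstar fstar_diff[symmetric] del: fstar_diff)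

lemma cls_norm_tendsto:
  assumes "x \<in> cauchy_seqs p"
  shows "(\<lambda>n. p (x n)) \<longlonglongrightarrow> cnorm \<C> (cls x)"
proof -
  note x = rep_cls[OF assms]
  let ?L = "lim (\<lambda>n. p (rep (cls x) n))"
  have 1: "(\<lambda>n. p (rep (cls x) n)) \<longlonglongrightarrow> ?L"
    using cauchy_norm_convergent[OF x(1)] by (simp add: convergent_LIMSEQ_iff)
  have 2: "(\<lambda>n. p (x n) - p (rep (cls x) n)) \<longlonglongrightarrow> 0"
    by (rule tendsto_rabs_zero_cancel, rule tendsto_zero_bound[OF x(2)])
      (use diff_abs minus_commute in \<open>auto simp: abs_minus_commute\<close>)
  show ?thesis
    using tendsto_add[OF 2 1] by (simp add: cstar_completion_def)
qed

lemma cls_norm_eqI: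
  assumes "x \<in> cauchy_seqs p" "(\<lambda>n. p (x n)) \<longlonglongrightarrow> r"
  shows "cnorm \<C> (cls x) = r"
  using LIMSEQ_unique[OF cls_norm_tendsto[OF assms(1)] assms(2)] .

lemma cls_norm_const [simp]: "cnorm \<C> (cls (\<lambda>n. x)) = p x"
  by (rule cls_norm_eqI) auto

lemma cls_one: "\<one>\<^bsub>\<C>\<^esub> = cls (\<lambda>n. 1)" and cls_zero: "\<zero>\<^bsub>\<C>\<^esub> = cls (\<lambda>n. 0)"
  by (simp_all add: cstar_completion_def)

lemmas cls_ops = cls_add cls_mult cls_smult cls_star cls_one cls_zero
  cauchy_add cauchy_mult cauchy_fconst cauchy_fstar cauchy_uminus

lemma completion_abelian_group: "abelian_group \<C>"
proof (rule abelian_groupI)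
  fix X assume "X \<in> carrier \<C>"
  then obtain x where x: "x \<in> cauchy_seqs p" "X = cls x" by (rule carrierE)
  then have "cls (\<lambda>n. - x n) \<oplus>\<^bsub>\<C>\<^esub> X = \<zero>\<^bsub>\<C>\<^esub>"
    by (simp add: cls_ops)
  then show "\<exists>Y\<in>carrier \<C>. Y \<oplus>\<^bsub>\<C>\<^esub> X = \<zero>\<^bsub>\<C>\<^esub>"
    using x by (blast intro: cauchy_uminus)
qed (auto elim!: carrierE simp: cls_ops add_ac)

lemma completion_ring: "ring \<C>"
proof (rule ringI[OF completion_abelian_group])
  show "Group.monoid \<C>"
    by (rule Group.monoidI) (auto elim!: carrierE simp: cls_ops mult.assoc)
qed (auto elim!: carrierE simp: cls_ops algebra_simps)

lemma completion_module: "module complex_ring \<C>"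
  by (rule moduleI[OF cring_complex_ring completion_abelian_group])
    (auto elim!: carrierE simp: cls_ops algebra_simps mult.assoc[symmetric]
      fconst_add[symmetric] simp del: fconst_add)

lemma cls_minus:
  assumes "x \<in> cauchy_seqs p" "y \<in> cauchy_seqs p"
  shows "(\<lambda>n. x n - y n) \<in> cauchy_seqs p" "cls x \<ominus>\<^bsub>\<C>\<^esub> cls y = cls (\<lambda>n. x n - y n)"
proof -
  show c: "(\<lambda>n. x n - y n) \<in> cauchy_seqs p"
    using cauchy_add[OF assms(1) cauchy_uminus[OF assms(2)]] by simp
  show "cls x \<ominus>\<^bsub>\<C>\<^esub> cls y = cls (\<lambda>n. x n - y n)"
    by (rule abelian_group_minusI[OF completion_abelian_group]) (use assms c in \<open>simp_all add: cls_ops\<close>)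
qed

lemma dist_tendsto:
  assumes "x \<in> cauchy_seqs p" "y \<in> cauchy_seqs p"
  shows "(\<lambda>n. p (x n - y n)) \<longlonglongrightarrow> cnorm \<C> (cls x \<ominus>\<^bsub>\<C>\<^esub> cls y)"
  using cls_norm_tendsto[OF cls_minus(1)[OF assms]] by (simp add: cls_minus(2) assms)

lemma completion_nonneg: "X \<in> carrier \<C> \<Longrightarrow> 0 \<le> cnorm \<C> X"
  by (elim carrierE) (use nonneg in \<open>auto intro!: LIMSEQ_le_const cls_norm_tendsto\<close>)

lemma completion_eq_0:
  assumes "X \<in> carrier \<C>"
  shows "cnorm \<C> X = 0 \<longleftrightarrow> X = \<zero>\<^bsub>\<C>\<^esub>"
proof -
  obtain x where x: "x \<in> cauchy_seqs p" "X = cls x" using assms by (rule carrierE)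
  have "X = \<zero>\<^bsub>\<C>\<^esub> \<longleftrightarrow> (\<lambda>n. p (x n)) \<longlonglongrightarrow> 0"
    using x by (simp add: cls_zero cls_eq_iff)
  then show ?thesis
    using x cls_norm_tendsto[OF x(1)] cls_norm_eqI[OF x(1)] by metis
qed

lemma completion_add:
  assumes "X \<in> carrier \<C>" "Y \<in> carrier \<C>"
  shows "cnorm \<C> (X \<oplus>\<^bsub>\<C>\<^esub> Y) \<le> cnorm \<C> X + cnorm \<C> Y"
proof -
  obtain x y where x: "x \<in> cauchy_seqs p" "X = cls x" and y: "y \<in> cauchy_seqs p" "Y = cls y"
    using assms by (metis carrierE)
  show ?thesis
    unfolding x(2) y(2) cls_add[OF x(1) y(1)]
    by (rule LIMSEQ_le[OF cls_norm_tendsto[OF cauchy_add[OF x(1) y(1)]]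
          tendsto_add[OF cls_norm_tendsto[OF x(1)] cls_norm_tendsto[OF y(1)]]])
      (auto intro: add)
qed

lemma completion_mult:
  assumes "X \<in> carrier \<C>" "Y \<in> carrier \<C>"
  shows "cnorm \<C> (X \<otimes>\<^bsub>\<C>\<^esub> Y) \<le> cnorm \<C> X * cnorm \<C> Y"
proof -
  obtain x y where x: "x \<in> cauchy_seqs p" "X = cls x" and y: "y \<in> cauchy_seqs p" "Y = cls y"
    using assms by (metis carrierE)
  show ?thesis
    unfolding x(2) y(2) cls_mult[OF x(1) y(1)]
    by (rule LIMSEQ_le[OF cls_norm_tendsto[OF cauchy_mult[OF x(1) y(1)]]
          tendsto_mult[OF cls_norm_tendsto[OF x(1)] cls_norm_tendsto[OF y(1)]]])
      (auto intro: mult)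
qed

lemma completion_smult:
  assumes "X \<in> carrier \<C>"
  shows "cnorm \<C> (c \<odot>\<^bsub>\<C>\<^esub> X) = cmod c * cnorm \<C> X"
proof -
  obtain x where x: "x \<in> cauchy_seqs p" "X = cls x" using assms by (rule carrierE)
  show ?thesis
    unfolding x(2) cls_smult[OF x(1)]
    by (rule cls_norm_eqI) (use x in \<open>auto simp: scale intro!: tendsto_intros cls_norm_tendsto\<close>)
qed

lemma completion_cstar:
  assumes "X \<in> carrier \<C>"
  shows "cnorm \<C> (star \<C> X \<otimes>\<^bsub>\<C>\<^esub> X) = (cnorm \<C> X)\<^sup>2"
proof -
  obtain x where x: "x \<in> cauchy_seqs p" "X = cls x" using assms by (rule carrierE)
  have "cnorm \<C> (cls (\<lambda>n. fstar (x n) * x n)) = (cnorm \<C> (cls x))\<^sup>2"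
    by (rule cls_norm_eqI)
      (use x in \<open>auto simp: cstar intro!: tendsto_power cls_norm_tendsto\<close>)
  then show ?thesis using x by (simp add: cls_ops)
qed

lemma dist_commute:
  assumes "X \<in> carrier \<C>" "Y \<in> carrier \<C>"
  shows "cnorm \<C> (X \<ominus>\<^bsub>\<C>\<^esub> Y) = cnorm \<C> (Y \<ominus>\<^bsub>\<C>\<^esub> X)"
proof -
  obtain x y where xy: "x \<in> cauchy_seqs p" "X = cls x" "y \<in> cauchy_seqs p" "Y = cls y"
    using assms by (metis carrierE)
  have "(\<lambda>n. p (x n - y n)) \<longlonglongrightarrow> cnorm \<C> (Y \<ominus>\<^bsub>\<C>\<^esub> X)"
    using dist_tendsto[OF xy(3,1)] xy by (simp add: minus_commute)
  then show ?thesis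
    using dist_tendsto[OF xy(1,3)] xy LIMSEQ_unique by blast
qed

lemma dist_closed:
  assumes "X \<in> carrier \<C>" "Y \<in> carrier \<C>"
  shows "X \<ominus>\<^bsub>\<C>\<^esub> Y \<in> carrier \<C>"
  using abelian_group.minus_closed[OF completion_abelian_group assms] .

lemma dist_triangle:
  assumes "X \<in> carrier \<C>" "Y \<in> carrier \<C>" "Z \<in> carrier \<C>"
  shows "cnorm \<C> (X \<ominus>\<^bsub>\<C>\<^esub> Z) \<le> cnorm \<C> (X \<ominus>\<^bsub>\<C>\<^esub> Y) + cnorm \<C> (Y \<ominus>\<^bsub>\<C>\<^esub> Z)"
  unfolding abelian_group_minus_minus[OF completion_abelian_group assms]
  using assms by (intro completion_add dist_closed)

lemma dist_le:
  assumes "x \<in> cauchy_seqs p" "y \<in> cauchy_seqs p" "\<And>n. n \<ge> N \<Longrightarrow> p (x n - y n) \<le> e"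
  shows "cnorm \<C> (cls x \<ominus>\<^bsub>\<C>\<^esub> cls y) \<le> e"
  using assms(3) by (intro LIMSEQ_le_const2[OF dist_tendsto[OF assms(1,2)]]) auto

lemma completion_dense:
  assumes "X \<in> carrier \<C>" "0 < e"
  shows "\<exists>x. cnorm \<C> (X \<ominus>\<^bsub>\<C>\<^esub> cls (\<lambda>n. x)) < e"
proof -
  obtain y where y: "y \<in> cauchy_seqs p" "X = cls y" using assms(1) by (rule carrierE)
  from cauchyD[OF y(1), of "e / 2"] \<open>0 < e\<close> obtain N where
    "\<And>m n. m \<ge> N \<Longrightarrow> n \<ge> N \<Longrightarrow> p (y m - y n) < e / 2" by auto
  then have "cnorm \<C> (X \<ominus>\<^bsub>\<C>\<^esub> cls (\<lambda>n. y N)) \<le> e / 2"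
    unfolding y(2) by (intro dist_le[of _ _ N]) (auto simp: y less_imp_le)
  then show ?thesis using \<open>0 < e\<close> by (intro exI[of _ "y N"]) auto
qed

lemma completion_complete:
  assumes X: "\<And>n. X n \<in> carrier \<C>"
    and cauchy: "\<And>e. 0 < e \<Longrightarrow> \<exists>N. \<forall>m\<ge>N. \<forall>n\<ge>N. cnorm \<C> (X m \<ominus>\<^bsub>\<C>\<^esub> X n) < e"
  shows "\<exists>L\<in>carrier \<C>. (\<lambda>n. cnorm \<C> (X n \<ominus>\<^bsub>\<C>\<^esub> L)) \<longlonglongrightarrow> 0"
proof -
  let ?d = "\<lambda>X Y. cnorm \<C> (X \<ominus>\<^bsub>\<C>\<^esub> Y)"
  have "\<exists>x. ?d (X n) (cls (\<lambda>_. x)) < inverse (Suc n)" for n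
    by (rule completion_dense[OF X]) simp
  then obtain x where x: "\<And>n. ?d (X n) (cls (\<lambda>_. x n)) < inverse (Suc n)" by metis
  have pd: "p (x m - x n) = ?d (cls (\<lambda>_. x m)) (cls (\<lambda>_. x n))" for m n
    by (simp add: cls_minus)
  have xc: "x \<in> cauchy_seqs p"
    unfolding cauchy_seqs_def
  proof clarify
    fix e :: real assume "0 < e"
    obtain N1 where N1: "\<forall>m\<ge>N1. \<forall>n\<ge>N1. ?d (X m) (X n) < e / 3" using cauchy[of "e / 3"] \<open>0 < e\<close> by auto
    obtain N2 where N2: "inverse (real (Suc N2)) < e / 3"
      using reals_Archimedean[of "e / 3"] \<open>0 < e\<close> by auto
    have small: "?d (X n) (cls (\<lambda>_. x n)) < e / 3" if "n \<ge> N2" for n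
    proof -
      have "inverse (real (Suc n)) \<le> inverse (real (Suc N2))"
        using that by (intro le_imp_inverse_le) auto
      then show ?thesis using x[of n] N2 by linarith
    qed
    have "p (x m - x n) < e" if "m \<ge> max N1 N2" "n \<ge> max N1 N2" for m n
    proof -
      have "?d (cls (\<lambda>_. x m)) (cls (\<lambda>_. x n)) \<le>
          ?d (X m) (cls (\<lambda>_. x m)) + ?d (X m) (X n) + ?d (X n) (cls (\<lambda>_. x n))"
        using dist_triangle[of "cls (\<lambda>_. x m)" "X m" "cls (\<lambda>_. x n)"]
          dist_triangle[of "X m" "X n" "cls (\<lambda>_. x n)"]
          dist_commute[of "X m" "cls (\<lambda>_. x m)"] X by simp
      then show ?thesis
        unfolding pd using small[of m] small[of n] N1 that by fastforce
    qed
    then show "\<exists>N. \<forall>m\<ge>N. \<forall>n\<ge>N. p (x m - x n) < e" by blast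
  qed
  have "(\<lambda>n. ?d (cls (\<lambda>_. x n)) (cls x)) \<longlonglongrightarrow> 0"
  proof (rule LIMSEQ_I)
    fix e :: real assume "0 < e"
    from cauchyD[OF xc, of "e / 2"] \<open>0 < e\<close> obtain N where
      N: "\<And>m n. m \<ge> N \<Longrightarrow> n \<ge> N \<Longrightarrow> p (x m - x n) < e / 2" by auto
    have "?d (cls (\<lambda>_. x n)) (cls x) \<le> e / 2" if "n \<ge> N" for n
      by (rule dist_le[of _ _ N]) (use that N xc in \<open>auto simp: less_imp_le\<close>)
    then show "\<exists>N. \<forall>n\<ge>N. norm (?d (cls (\<lambda>_. x n)) (cls x) - 0) < e"
      using \<open>0 < e\<close> completion_nonneg[OF dist_closed, of "cls (\<lambda>_. x _)" "cls x"] xc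
      by (intro exI[of _ N] allI impI) (simp add: order.strict_trans1[of _ "e / 2" e])
  qed
  moreover have "(\<lambda>n. inverse (real (Suc n))) \<longlonglongrightarrow> 0" by (rule LIMSEQ_inverse_real_of_nat)
  ultimately have "(\<lambda>n. inverse (real (Suc n)) + ?d (cls (\<lambda>_. x n)) (cls x)) \<longlonglongrightarrow> 0 + 0"
    by (intro tendsto_add)
  then have "(\<lambda>n. inverse (real (Suc n)) + ?d (cls (\<lambda>_. x n)) (cls x)) \<longlonglongrightarrow> 0" by simp
  then have "(\<lambda>n. ?d (X n) (cls x)) \<longlonglongrightarrow> 0"
  proof (rule tendsto_zero_bound)
    fix n
    show "0 \<le> ?d (X n) (cls x)" by (intro completion_nonneg dist_closed X cls_closed xc)
    show "?d (X n) (cls x) \<le> inverse (real (Suc n)) + ?d (cls (\<lambda>_. x n)) (cls x)"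
      using x[of n] dist_triangle[of "X n" "cls (\<lambda>_. x n)" "cls x"] X xc
      by simp
  qed
  then show ?thesis using xc by blast
qed

theorem completion_unital_cstar_algebra: "unital_cstar_algebra \<C>"
proof (intro unital_cstar_algebra.intro completion_ring completion_module)
  show "unital_cstar_algebra_axioms \<C>"
    by unfold_locales
      (auto simp: completion_nonneg completion_eq_0 completion_add completion_mult completion_smult
        completion_cstar completion_complete,
       (auto elim!: carrierE simp: cls_ops mult.assoc fconst_left_commute fconst_commute))
qed

end


subsection \<open>Evaluation in a C*-algebra and its extension to the completion\<close>

fun eval_letter :: "('a, 'm) cstar_alg_scheme \<Rightarrow> ('g \<Rightarrow> 'a) \<Rightarrow> 'g letter \<Rightarrow> 'a" where
  "eval_letter A f (Gen g) = f g"
| "eval_letter A f (Adj g) = star A (f g)"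

fun eval_word :: "('a, 'm) cstar_alg_scheme \<Rightarrow> ('g \<Rightarrow> 'a) \<Rightarrow> 'g word \<Rightarrow> 'a" where
  "eval_word A f (Word u) = foldr (\<lambda>l y. eval_letter A f l \<otimes>\<^bsub>A\<^esub> y) u \<one>\<^bsub>A\<^esub>"

definition free_eval :: "('a, 'm) cstar_alg_scheme \<Rightarrow> ('g \<Rightarrow> 'a) \<Rightarrow> 'g free_alg \<Rightarrow> 'a" where
  "free_eval A f x = (\<Oplus>\<^bsub>A\<^esub>w\<in>Poly_Mapping.keys x. Poly_Mapping.lookup x w \<odot>\<^bsub>A\<^esub> eval_word A f w)"

lemma a_inv_complex_ring [simp]: "\<ominus>\<^bsub>complex_ring\<^esub> c = - c"
proof -
  interpret cring complex_ring by (rule cring_complex_ring)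
  show ?thesis by (rule minus_equality) simp_all
qed

context unital_cstar_algebra
begin

lemma scalar_closed [simp, intro]: "x \<in> carrier A \<Longrightarrow> c \<odot> x \<in> carrier A"
  using scalars.smult_closed[of c x] by simp

lemma scalar_add_left: "x \<in> carrier A \<Longrightarrow> (c + d) \<odot> x = c \<odot> x \<oplus> d \<odot> x"
  using scalars.smult_l_distr[of c d x] by simp

lemma scalar_add_right:
  "\<lbrakk>x \<in> carrier A; y \<in> carrier A\<rbrakk> \<Longrightarrow> c \<odot> (x \<oplus> y) = c \<odot> x \<oplus> c \<odot> y"
  using scalars.smult_r_distr[of c x y] by simp

lemma scalar_scalar: "x \<in> carrier A \<Longrightarrow> c \<odot> (d \<odot> x) = (c * d) \<odot> x"
  using scalars.smult_assoc1[of c d x] by simp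

lemma scalar_one: "x \<in> carrier A \<Longrightarrow> 1 \<odot> x = x"
  using scalars.smult_one[of x] by simp

lemma scalar_zero_left: "x \<in> carrier A \<Longrightarrow> 0 \<odot> x = \<zero>"
  using scalars.smult_l_null[of x] by simp

lemma scalar_zero_right: "c \<odot> \<zero> = \<zero>"
  using scalars.smult_r_null[of c] by simp

lemma scalar_minus_one: "x \<in> carrier A \<Longrightarrow> (- 1) \<odot> x = \<ominus> x"
  using scalars.smult_l_minus[of 1 x] scalar_one by simp

lemma cnorm_uminus: "x \<in> carrier A \<Longrightarrow> cnorm A (\<ominus> x) = cnorm A x"
  using cnorm_smult[of x "- 1"] by (simp add: scalar_minus_one)

lemma cnorm_minus_commute:
  assumes "x \<in> carrier A" "y \<in> carrier A"
  shows "cnorm A (x \<ominus> y) = cnorm A (y \<ominus> x)"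
proof -
  have "x \<ominus> y = \<ominus> (y \<ominus> x)"
    using assms by (simp add: a_minus_def minus_add a_comm)
  then show ?thesis using assms by (simp add: cnorm_uminus)
qed

lemma cnorm_triangle:
  assumes "x \<in> carrier A" "y \<in> carrier A" "z \<in> carrier A"
  shows "cnorm A (x \<ominus> z) \<le> cnorm A (x \<ominus> y) + cnorm A (y \<ominus> z)"
  unfolding abelian_group_minus_minus[OF abelian_group_axioms assms]
  using assms by (intro cnorm_add) auto

lemma cnorm_diff_abs:
  assumes "x \<in> carrier A" "y \<in> carrier A"
  shows "\<bar>cnorm A x - cnorm A y\<bar> \<le> cnorm A (x \<ominus> y)"
  using cnorm_triangle[of x y \<zero>] cnorm_triangle[of y x \<zero>] assms cnorm_minus_commute[of x y]
  by (auto simp: a_minus_def)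

lemma minus_eq_zeroD: "\<lbrakk>x \<in> carrier A; y \<in> carrier A; x \<ominus> y = \<zero>\<rbrakk> \<Longrightarrow> x = y"
  by (metis a_minus_def add.inv_closed minus_equality minus_minus)

lemma limit_unique:
  assumes "l \<in> carrier A" "m \<in> carrier A" "\<And>n. s n \<in> carrier A"
    and "(\<lambda>n. cnorm A (s n \<ominus> l)) \<longlonglongrightarrow> 0" "(\<lambda>n. cnorm A (s n \<ominus> m)) \<longlonglongrightarrow> 0"
  shows "l = m"
proof -
  have "(\<lambda>n. cnorm A (s n \<ominus> l) + cnorm A (s n \<ominus> m)) \<longlonglongrightarrow> 0 + 0"
    by (intro tendsto_add assms)
  moreover have "cnorm A (l \<ominus> m) \<le> cnorm A (s n \<ominus> l) + cnorm A (s n \<ominus> m)" for n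
    using cnorm_triangle[of l "s n" m] assms(1-3) by (simp add: cnorm_minus_commute[of l])
  ultimately have "cnorm A (l \<ominus> m) \<le> 0"
    by (intro LIMSEQ_le_const[of _ 0]) auto
  then have "l \<ominus> m = \<zero>"
    using cnorm_nonneg[of "l \<ominus> m"] cnorm_eq_0[of "l \<ominus> m"] assms(1,2) by simp
  then show ?thesis using assms(1,2) by (rule minus_eq_zeroD[rotated 2])
qed

lemma star_zero [simp]: "star A \<zero> = \<zero>"
  using star_smult[of \<zero> 0] by (simp add: scalar_zero_right scalar_zero_left star_closed)

lemma cnorm_zero [simp]: "cnorm A \<zero> = 0"
  by (simp add: cnorm_eq_0)

lemma star_one [simp]: "star A \<one> = \<one>"
  by (metis star_mult star_star star_closed one_closed l_one r_one)

context
  fixes f :: "'g \<Rightarrow> 'a"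
  assumes f: "\<And>g. f g \<in> carrier A"
begin

lemma eval_letter_closed [simp]: "eval_letter A f l \<in> carrier A"
  by (cases l) (auto simp: f star_closed)

lemma foldr_letters_closed:
  "foldr (\<lambda>l y. eval_letter A f l \<otimes> y) u \<one> \<in> carrier A"
  by (induction u) auto

lemma eval_word_closed [simp]: "eval_word A f w \<in> carrier A"
  by (cases w) (simp add: foldr_letters_closed)

lemma eval_word_append:
  "eval_word A f (Word (u @ v)) = eval_word A f (Word u) \<otimes> eval_word A f (Word v)"
  by (induction u) (simp_all add: foldr_letters_closed m_assoc)

lemma eval_word_plus: "eval_word A f (u + v) = eval_word A f u \<otimes> eval_word A f v"
  by (cases u; cases v) (simp only: plus_word.simps eval_word_append)

lemma eval_word_zero [simp]: "eval_word A f 0 = \<one>"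
  by (simp add: zero_word_def)

lemma star_eval_letter: "star A (eval_letter A f l) = eval_letter A f (adj_letter l)"
  by (cases l) (simp_all add: f star_star)

lemma star_eval_word: "star A (eval_word A f w) = eval_word A f (adj_word w)"
proof (cases w)
  case (Word u)
  have "star A (eval_word A f (Word u)) = eval_word A f (adj_word (Word u))"
  proof (induction u)
    case (Cons l u)
    have "star A (eval_word A f (Word (l # u))) =
        star A (eval_word A f (Word u)) \<otimes> star A (eval_letter A f l)"
      by (simp add: star_mult foldr_letters_closed)
    also have "\<dots> = eval_word A f (adj_word (Word u)) \<otimes> eval_word A f (Word [adj_letter l])"
      by (simp only: Cons.IH star_eval_letter) simp
    also have "\<dots> = eval_word A f (adj_word (Word (l # u)))"
      by (simp only: adj_word.simps list.map rev.simps eval_word_append)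
    finally show ?case .
  qed simp
  then show ?thesis by (simp add: Word)
qed

lemma free_eval_superset:
  assumes "finite S" "Poly_Mapping.keys x \<subseteq> S"
  shows "free_eval A f x = (\<Oplus>w\<in>S. Poly_Mapping.lookup x w \<odot> eval_word A f w)"
  unfolding free_eval_def using assms
  by (intro add.finprod_mono_neutral_cong_left)
    (auto simp: in_keys_iff scalar_zero_left)

lemma free_eval_closed [simp]: "free_eval A f x \<in> carrier A"
  unfolding free_eval_def by (intro finsum_closed) auto

lemma free_eval_add [simp]: "free_eval A f (x + y) = free_eval A f x \<oplus> free_eval A f y"
proof -
  let ?S = "Poly_Mapping.keys x \<union> Poly_Mapping.keys y"
  have "free_eval A f (x + y) = (\<Oplus>w\<in>?S. Poly_Mapping.lookup x w \<odot> eval_word A f w \<oplus>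
      Poly_Mapping.lookup y w \<odot> eval_word A f w)"
    by (subst free_eval_superset[of ?S])
      (auto simp: lookup_add scalar_add_left keys_add)
  also have "\<dots> = free_eval A f x \<oplus> free_eval A f y"
    by (subst finsum_addf) (auto simp: free_eval_superset[of ?S])
  finally show ?thesis .
qed

lemma free_eval_zero [simp]: "free_eval A f 0 = \<zero>"
  by (simp add: free_eval_def)

lemma free_eval_single [simp]: "free_eval A f (Poly_Mapping.single w c) = c \<odot> eval_word A f w"
  by (cases "c = 0") (simp_all add: free_eval_def scalar_zero_left)

lemma free_eval_one [simp]: "free_eval A f 1 = \<one>"
  using free_eval_single[of 0 1] by (simp add: scalar_one)

lemma free_eval_mult [simp]: "free_eval A f (x * y) = free_eval A f x \<otimes> free_eval A f y"
proof (induction x rule: free_alg_induct)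
  case (single w c)
  show ?case
  proof (induction y rule: free_alg_induct)
    case (single v d)
    show ?case
      by (simp add: mult_single eval_word_plus smult_mult_left smult_mult_right scalar_scalar
          mult.commute)
  qed (simp_all add: distrib_left r_distr)
qed (simp_all add: distrib_right l_distr)

lemma free_eval_fconst [simp]: "free_eval A f (fconst c * x) = c \<odot> free_eval A f x"
  by (simp add: smult_mult_left)

lemma free_eval_uminus [simp]: "free_eval A f (- x) = \<ominus> free_eval A f x"
  using free_eval_add[of "- x" x] by (metis add.left_inverse free_eval_closed free_eval_zero minus_equality)

lemma free_eval_minus [simp]: "free_eval A f (x - y) = free_eval A f x \<ominus> free_eval A f y"
  using free_eval_add[of x "- y"] by (simp add: a_minus_def del: free_eval_add)

lemma free_eval_fstar [simp]: "free_eval A f (fstar x) = star A (free_eval A f x)"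
  by (induction x rule: free_alg_induct) (simp_all add: star_add star_smult star_eval_word)

lemma free_eval_fgen [simp]: "free_eval A f (fgen g) = f g"
  by (simp add: f scalar_one)

lemma free_eval_seminorm: "cstar_seminorm (\<lambda>x. cnorm A (free_eval A f x))"
proof
  show "cnorm A (free_eval A f (fconst c * x)) = cmod c * cnorm A (free_eval A f x)" for c x
    by (simp only: free_eval_fconst free_eval_closed cnorm_smult)
qed (simp_all only: free_eval_add free_eval_mult free_eval_fstar free_eval_closed
      cnorm_nonneg cnorm_add cnorm_mult cstar_identity)

context
  fixes p
  assumes p: "cstar_seminorm p" and dom: "\<And>x. cnorm A (free_eval A f x) \<le> p x"
begin

interpretation cstar_seminorm p by (rule p)

definition completion_lift :: "(nat \<Rightarrow> 'g free_alg) set \<Rightarrow> 'a" where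
  "completion_lift X = (THE l. l \<in> carrier A \<and> (\<lambda>n. cnorm A (free_eval A f (rep X n) \<ominus> l)) \<longlonglongrightarrow> 0)"

lemma free_eval_limit_exists:
  assumes "x \<in> cauchy_seqs p"
  shows "\<exists>l\<in>carrier A. (\<lambda>n. cnorm A (free_eval A f (x n) \<ominus> l)) \<longlonglongrightarrow> 0"
proof (rule complete)
  fix e :: real assume "0 < e"
  from cauchyD[OF assms this] obtain N where "\<forall>m\<ge>N. \<forall>n\<ge>N. p (x m - x n) < e" by blast
  then show "\<exists>N. \<forall>m\<ge>N. \<forall>n\<ge>N. cnorm A (free_eval A f (x m) \<ominus> free_eval A f (x n)) < e"
    using dom[of "x _ - x _"] by (intro exI[of _ N]) (metis free_eval_minus order.strict_trans1)
qed simp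

lemma lift_cls:
  assumes x: "x \<in> cauchy_seqs p"
  shows "completion_lift (cls x) \<in> carrier A" "(\<lambda>n. cnorm A (free_eval A f (x n) \<ominus> completion_lift (cls x))) \<longlonglongrightarrow> 0"
proof -
  note r = rep_cls[OF x]
  let ?r = "rep (cls x)"
  have "\<exists>!l. l \<in> carrier A \<and> (\<lambda>n. cnorm A (free_eval A f (?r n) \<ominus> l)) \<longlonglongrightarrow> 0"
    using free_eval_limit_exists[OF r(1)] limit_unique[of _ _ "\<lambda>n. free_eval A f (?r n)"] by auto
  then have *: "completion_lift (cls x) \<in> carrier A \<and> (\<lambda>n. cnorm A (free_eval A f (?r n) \<ominus> completion_lift (cls x))) \<longlonglongrightarrow> 0"
    unfolding completion_lift_def by (rule theI')
  then show c: "completion_lift (cls x) \<in> carrier A" by simp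
  have "(\<lambda>n. p (?r n - x n) + cnorm A (free_eval A f (?r n) \<ominus> completion_lift (cls x))) \<longlonglongrightarrow> 0 + 0"
    using r(2) * by (intro tendsto_add) auto
  moreover have "cnorm A (free_eval A f (x n) \<ominus> completion_lift (cls x)) \<le>
      p (?r n - x n) + cnorm A (free_eval A f (?r n) \<ominus> completion_lift (cls x))" for n
    using cnorm_triangle[of "free_eval A f (x n)" "free_eval A f (?r n)" "completion_lift (cls x)"] c
      dom[of "x n - ?r n"] minus_commute[of "x n" "?r n"] by simp
  ultimately show "(\<lambda>n. cnorm A (free_eval A f (x n) \<ominus> completion_lift (cls x))) \<longlonglongrightarrow> 0"
    using cnorm_nonneg c
    by - (rule tendsto_zero_bound[of "\<lambda>n. p (?r n - x n) + cnorm A (free_eval A f (?r n) \<ominus> completion_lift (cls x))"],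
      simp_all)
qed

lemma lift_cls_eqI:
  assumes "x \<in> cauchy_seqs p" "l \<in> carrier A"
    and "g \<longlonglongrightarrow> 0" "\<And>n. cnorm A (free_eval A f (x n) \<ominus> l) \<le> g n"
  shows "completion_lift (cls x) = l"
proof (rule limit_unique[of _ _ "\<lambda>n. free_eval A f (x n)"])
  show "(\<lambda>n. cnorm A (free_eval A f (x n) \<ominus> l)) \<longlonglongrightarrow> 0"
    by (rule tendsto_zero_bound[OF assms(3)]) (auto simp: assms cnorm_nonneg)
qed (use assms lift_cls in auto)

lemma lift_const: "completion_lift (cls (\<lambda>n. x)) = free_eval A f x"
  by (rule lift_cls_eqI[of _ _ "\<lambda>_. 0"])
    (simp_all add: a_minus_def r_neg)

lemma lift_add:
  assumes x: "x \<in> cauchy_seqs p" and y: "y \<in> cauchy_seqs p"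
  shows "completion_lift (cls (\<lambda>n. x n + y n)) = completion_lift (cls x) \<oplus> completion_lift (cls y)"
proof (rule lift_cls_eqI[OF cauchy_add[OF x y]])
  let ?l = "completion_lift (cls x)" and ?m = "completion_lift (cls y)"
  show "(\<lambda>n. cnorm A (free_eval A f (x n) \<ominus> ?l) + cnorm A (free_eval A f (y n) \<ominus> ?m)) \<longlonglongrightarrow> 0"
    using tendsto_add[OF lift_cls(2)[OF x] lift_cls(2)[OF y]] by simp
  fix n
  have "free_eval A f (x n + y n) \<ominus> (?l \<oplus> ?m) = (free_eval A f (x n) \<ominus> ?l) \<oplus> (free_eval A f (y n) \<ominus> ?m)"
    using lift_cls(1)[OF x] lift_cls(1)[OF y]
    by (simp add: a_minus_def minus_add a_ac)
  then show "cnorm A (free_eval A f (x n + y n) \<ominus> (?l \<oplus> ?m)) \<le>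
      cnorm A (free_eval A f (x n) \<ominus> ?l) + cnorm A (free_eval A f (y n) \<ominus> ?m)"
    using lift_cls(1)[OF x] lift_cls(1)[OF y] by (simp add: cnorm_add)
qed (use assms lift_cls in auto)

lemma lift_mult:
  assumes x: "x \<in> cauchy_seqs p" and y: "y \<in> cauchy_seqs p"
  shows "completion_lift (cls (\<lambda>n. x n * y n)) = completion_lift (cls x) \<otimes> completion_lift (cls y)"
proof -
  let ?l = "completion_lift (cls x)" and ?m = "completion_lift (cls y)"
  note lm = lift_cls(1)[OF x] lift_cls(1)[OF y]
  obtain B where B: "\<And>n. p (x n) \<le> B" using cauchy_bounded[OF x] by blast
  show ?thesis
  proof (rule lift_cls_eqI[OF cauchy_mult[OF x y]])
    have "(\<lambda>n. B * cnorm A (free_eval A f (y n) \<ominus> ?m) + cnorm A (free_eval A f (x n) \<ominus> ?l) * cnorm A ?m)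
        \<longlonglongrightarrow> B * 0 + 0 * cnorm A ?m"
      by (intro tendsto_intros lift_cls(2) x y)
    then show "(\<lambda>n. B * cnorm A (free_eval A f (y n) \<ominus> ?m) + cnorm A (free_eval A f (x n) \<ominus> ?l) * cnorm A ?m)
        \<longlonglongrightarrow> 0" by simp
    fix n
    let ?x = "free_eval A f (x n)" and ?y = "free_eval A f (y n)"
    have "?x \<otimes> ?y \<ominus> ?l \<otimes> ?m = (?x \<otimes> ?y \<ominus> ?x \<otimes> ?m) \<oplus> (?x \<otimes> ?m \<ominus> ?l \<otimes> ?m)"
      using lm by (intro abelian_group_minus_minus[OF abelian_group_axioms]) auto
    also have "\<dots> = ?x \<otimes> (?y \<ominus> ?m) \<oplus> (?x \<ominus> ?l) \<otimes> ?m"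
      using lm by (simp add: a_minus_def r_distr l_distr r_minus l_minus)
    finally have "cnorm A (?x \<otimes> ?y \<ominus> ?l \<otimes> ?m) \<le>
        cnorm A (?x \<otimes> (?y \<ominus> ?m)) + cnorm A ((?x \<ominus> ?l) \<otimes> ?m)"
      using lm by (simp add: cnorm_add)
    also have "cnorm A (?x \<otimes> (?y \<ominus> ?m)) \<le> cnorm A ?x * cnorm A (?y \<ominus> ?m)"
      using lm by (intro cnorm_mult) auto
    also have "\<dots> \<le> B * cnorm A (?y \<ominus> ?m)"
      using lm dom[of "x n"] B[of n] by (intro mult_right_mono cnorm_nonneg) auto
    also have "cnorm A ((?x \<ominus> ?l) \<otimes> ?m) \<le> cnorm A (?x \<ominus> ?l) * cnorm A ?m"
      using lm by (intro cnorm_mult) auto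
    finally show "cnorm A (free_eval A f (x n * y n) \<ominus> ?l \<otimes> ?m) \<le>
        B * cnorm A (?y \<ominus> ?m) + cnorm A (?x \<ominus> ?l) * cnorm A ?m" by simp
  qed (use lm in auto)
qed

lemma lift_smult:
  assumes x: "x \<in> cauchy_seqs p"
  shows "completion_lift (cls (\<lambda>n. fconst c * x n)) = c \<odot> completion_lift (cls x)"
  using lift_mult[of "\<lambda>_. fconst c" x] x lift_cls(1)[OF x]
  by (simp add: lift_const smult_mult_left)

lemma cnorm_star: "x \<in> carrier A \<Longrightarrow> cnorm A (star A x) = cnorm A x"
proof -
  have *: "cnorm A x \<le> cnorm A (star A x)" if x: "x \<in> carrier A" for x
  proof (cases "cnorm A x = 0")
    case False
    then have "0 < cnorm A x" using cnorm_nonneg[OF x] by simp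
    moreover have "cnorm A x * cnorm A x \<le> cnorm A (star A x) * cnorm A x"
      using cstar_identity[OF x] cnorm_mult[of "star A x" x] x star_closed
      by (simp add: power2_eq_square)
    ultimately show ?thesis by simp
  qed (use x cnorm_nonneg star_closed in simp)
  show "x \<in> carrier A \<Longrightarrow> ?thesis"
    using *[of x] *[of "star A x"] star_closed star_star by fastforce
qed

lemma lift_star:
  assumes x: "x \<in> cauchy_seqs p"
  shows "completion_lift (cls (\<lambda>n. fstar (x n))) = star A (completion_lift (cls x))"
proof (rule lift_cls_eqI[OF cauchy_fstar[OF x] _ lift_cls(2)[OF x]])
  fix n
  let ?l = "completion_lift (cls x)" and ?x = "free_eval A f (x n)"
  note l = lift_cls(1)[OF x]
  have "star A (?x \<ominus> ?l) = star A ?x \<ominus> star A ?l"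
    using l star_smult[OF l, of "- 1"] star_closed
    by (simp add: a_minus_def star_add scalar_minus_one)
  then show "cnorm A (free_eval A f (fstar (x n)) \<ominus> star A ?l) \<le> cnorm A (?x \<ominus> ?l)"
    using l cnorm_star[of "?x \<ominus> ?l"] by simp
qed (use lift_cls(1)[OF x] star_closed in auto)

lemma lift_star_hom: "completion_lift \<in> star_hom \<C> A"
proof -
  have "completion_lift \<in> ring_hom \<C> A"
    by (rule ring_hom_memI)
      (auto elim!: carrierE simp: cls_ops lift_cls(1) lift_mult lift_add lift_const)
  then show ?thesis
    by (auto simp: star_hom_def cls_ops lift_smult lift_star elim!: carrierE)
qed

end
end
end


subsection \<open>Boundedness of the seminorms\<close>

primrec sqrt_seq :: "'g free_alg \<Rightarrow> nat \<Rightarrow> 'g free_alg" where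
  "sqrt_seq t 0 = 0"
| "sqrt_seq t (Suc n) = fconst (1 / 2) * (t + sqrt_seq t n * sqrt_seq t n)"

primrec sqrt_bound :: "nat \<Rightarrow> real" where
  "sqrt_bound 0 = 0"
| "sqrt_bound (Suc n) = (1 + (sqrt_bound n)\<^sup>2) / 2"

lemma sqrt_bound_le: "0 \<le> sqrt_bound n \<and> sqrt_bound n \<le> 1"
  by (induction n) (auto simp: power_le_one)

lemma sqrt_bound_step: "\<exists>n. sqrt_bound (Suc n) - sqrt_bound n < e" if "0 < e"
proof -
  have "sqrt_bound n \<le> sqrt_bound (Suc n)" for n
    using zero_le_power2[of "1 - sqrt_bound n"] by (simp add: power2_diff)
  then have "incseq sqrt_bound" by (rule incseq_SucI)
  then obtain L where "sqrt_bound \<longlonglongrightarrow> L"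
    using sqrt_bound_le incseq_convergent[of sqrt_bound 1] by blast
  then have "(\<lambda>n. sqrt_bound (Suc n) - sqrt_bound n) \<longlonglongrightarrow> L - L"
    by (intro tendsto_diff) (simp_all only: LIMSEQ_Suc)
  then have "eventually (\<lambda>n. sqrt_bound (Suc n) - sqrt_bound n < e) sequentially"
    using that by (intro order_tendstoD(2)) simp_all
  then show ?thesis by (auto simp: eventually_sequentially)
qed

lemma fconst_two: "fconst 2 * x = x + (x :: 'g free_alg)"
proof -
  have "fconst (1 + 1) * x = x + x"
    unfolding fconst_add[symmetric] by (simp only: distrib_right single_one mult_1)
  then show ?thesis by (simp only: one_add_one)
qed

lemma fconst_cancel: "c * d = 1 \<Longrightarrow> fconst c * (fconst d * x) = (x :: 'g free_alg)"
  by (simp add: mult.assoc[symmetric])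

lemma fconst_mult_mult: "(fconst c * x) * (fconst d * y) = fconst (c * d) * (x * (y :: 'g free_alg))"
  by (metis fconst_left_commute fconst_mult mult.assoc)

lemma fconst_neg: "fconst (- c) * x = - (fconst c * (x :: 'g free_alg))"
  by (simp add: fconst_minus[symmetric] del: fconst_minus)

lemma sqrt_seq_commute:
  assumes "z * t = t * z"
  shows "z * sqrt_seq t n = sqrt_seq t n * z"
proof (induction n)
  case (Suc n)
  have "z * (sqrt_seq t n * sqrt_seq t n) = sqrt_seq t n * sqrt_seq t n * z"
    by (metis Suc mult.assoc)
  then show ?case
    by (simp add: fconst_left_commute distrib_left distrib_right assms mult.assoc)
qed simp

lemma sqrt_seq_commute': "sqrt_seq t m * sqrt_seq t n = sqrt_seq t n * sqrt_seq t m"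
  by (rule sqrt_seq_commute, rule sqrt_seq_commute[symmetric]) simp

lemma fstar_sqrt_seq: "fstar t = t \<Longrightarrow> fstar (sqrt_seq t n) = sqrt_seq t n"
  by (induction n) (simp_all add: fconst_commute)

context cstar_seminorm
begin

lemma sqrt_seq_bounds:
  assumes "p t \<le> 1"
  shows "p (sqrt_seq t n) \<le> sqrt_bound n \<and>
    p (sqrt_seq t (Suc n) - sqrt_seq t n) \<le> sqrt_bound (Suc n) - sqrt_bound n"
proof (induction n)
  case 0
  then show ?case using assms by (simp add: scale)
next
  case (Suc n)
  let ?y = "sqrt_seq t" and ?b = sqrt_bound
  have 1: "p (?y (Suc n)) \<le> ?b (Suc n)"
  proof -
    have "p (?y n * ?y n) \<le> (?b n)\<^sup>2"
      using mult[of "?y n" "?y n"] mult_mono[of "p (?y n)" "?b n" "p (?y n)" "?b n"] Suc.IH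
        sqrt_bound_le[of n] nonneg by (simp add: power2_eq_square)
    then show ?thesis
      using add[of t "?y n * ?y n"] assms by (simp add: scale)
  qed
  have "?y (Suc (Suc n)) - ?y (Suc n) =
      fconst (1 / 2) * (?y (Suc n) * ?y (Suc n) - ?y n * ?y n)"
    unfolding sqrt_seq.simps(2)[of t "Suc n"] sqrt_seq.simps(2)[of t n]
    by (simp add: right_diff_distrib[symmetric])
  also have "?y (Suc n) * ?y (Suc n) - ?y n * ?y n = (?y (Suc n) + ?y n) * (?y (Suc n) - ?y n)"
    using sqrt_seq_commute'[of t "Suc n" n] by (simp only: algebra_simps)
  finally have "p (?y (Suc (Suc n)) - ?y (Suc n)) =
      1 / 2 * p ((?y (Suc n) + ?y n) * (?y (Suc n) - ?y n))" by (simp only: scale) simp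
  also have "\<dots> \<le> 1 / 2 * ((?b (Suc n) + ?b n) * (?b (Suc n) - ?b n))"
  proof -
    have "p (?y (Suc n) + ?y n) \<le> ?b (Suc n) + ?b n"
      using add[of "?y (Suc n)" "?y n"] 1 Suc.IH by linarith
    then have "p (?y (Suc n) + ?y n) * p (?y (Suc n) - ?y n) \<le>
        (?b (Suc n) + ?b n) * (?b (Suc n) - ?b n)"
      using Suc.IH nonneg sqrt_bound_le[of n] sqrt_bound_le[of "Suc n"]
      by (intro mult_mono) (simp_all del: sqrt_seq.simps sqrt_bound.simps)
    then show ?thesis
      using mult[of "?y (Suc n) + ?y n" "?y (Suc n) - ?y n"] by linarith
  qed
  also have "\<dots> = ?b (Suc (Suc n)) - ?b (Suc n)"
    unfolding sqrt_bound.simps(2)[of "Suc n"]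
    by (simp add: field_simps power2_eq_square)
  finally show ?case using 1 by blast
qed

lemma approx_sqrt:
  assumes x: "fstar x = x" "p (1 - x) \<le> 1" and "0 < e"
  obtains s where "fstar s = s" "\<And>z. z * x = x * z \<Longrightarrow> z * s = s * z" "p (x - s * s) < e"
proof -
  let ?y = "sqrt_seq (1 - x)"
  obtain n where n: "sqrt_bound (Suc n) - sqrt_bound n < e / 2"
    using sqrt_bound_step[of "e / 2"] \<open>0 < e\<close> by auto
  define s where "s = 1 - ?y n"
  have two: "fconst 2 * ?y (Suc n) = 1 - x + ?y n * ?y n"
    unfolding sqrt_seq.simps(2) by (rule fconst_cancel) simp
  have "x - s * s = fconst 2 * (?y n - ?y (Suc n))"
    unfolding right_diff_distrib two s_def by (simp add: mult_2 algebra_simps)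
  then have "p (x - s * s) = cmod 2 * p (?y n - ?y (Suc n))"
    by (simp only: scale)
  then have "p (x - s * s) = 2 * p (?y (Suc n) - ?y n)"
    by (simp only: minus_commute[of "?y n"]) simp
  moreover have "p (?y (Suc n) - ?y n) \<le> sqrt_bound (Suc n) - sqrt_bound n"
    using sqrt_seq_bounds[OF x(2)] by blast
  ultimately have "p (x - s * s) < e"
    using n by linarith
  moreover have "fstar s = s"
    using x(1) by (simp add: s_def fstar_sqrt_seq)
  moreover have "z * s = s * z" if "z * x = x * z" for z
    using sqrt_seq_commute[of z "1 - x" n] that by (simp add: s_def algebra_simps)
  ultimately show ?thesis using that by blast
qed

lemma norm_le_sum_squares:
  assumes "fstar h = h" "fstar k = k" "h * k = k * h"
  shows "(p h)\<^sup>2 \<le> p (h * h + k * k)"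
proof -
  define w where "w = h + fconst \<i> * k"
  have sw: "fstar w = h - fconst \<i> * k"
    using assms by (simp add: w_def fconst_commute fconst_minus[symmetric] del: fconst_minus)
  have "fstar w * w = h * h + k * k"
  proof -
    have "(h - fconst \<i> * k) * (h + fconst \<i> * k) =
        h * h + h * (fconst \<i> * k) - fconst \<i> * k * h - fconst \<i> * k * (fconst \<i> * k)"
      by (simp add: algebra_simps)
    also have "h * (fconst \<i> * k) = fconst \<i> * k * h"
      by (simp only: fconst_left_commute assms(3) mult.assoc)
    also have "fconst \<i> * k * (fconst \<i> * k) = - (k * k)"
      by (simp only: fconst_mult_mult i_squared fconst_neg single_one mult_1)
    also have "h * h + fconst \<i> * k * h - fconst \<i> * k * h - - (k * k) = h * h + k * k"
      by simp
    finally show ?thesis unfolding sw unfolding w_def .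
  qed
  then have "(p w)\<^sup>2 = p (h * h + k * k)"
    using cstar[of w] by simp
  moreover have "p h \<le> p w"
  proof -
    have "fconst 2 * h = w + fstar w" unfolding sw unfolding w_def by (simp add: mult_2)
    then have "2 * p h = p (w + fstar w)" using scale[of 2 h] by simp
    then show ?thesis using add[of w "fstar w"] by simp
  qed
  ultimately show ?thesis using nonneg by (metis power_mono)
qed

lemma one_minus_square_le:
  assumes "fstar h = h" "p h \<le> 1"
  shows "p (1 - h * h) \<le> 1"
proof (rule field_le_epsilon)
  fix e :: real assume "0 < e"
  have "p (h * h) \<le> 1"
    using mult[of h h] mult_le_one[OF assms(2) nonneg assms(2)] by linarith
  then have "p (1 - (1 - h * h)) \<le> 1" by simp
  have sa: "fstar (1 - h * h) = 1 - h * h" "0 < e / 2"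
    using assms(1) \<open>0 < e\<close> by simp_all
  obtain s where
    s: "fstar s = s" "\<And>z. z * (1 - h * h) = (1 - h * h) * z \<Longrightarrow> z * s = s * z"
      "p (1 - h * h - s * s) < e / 2"
    using approx_sqrt[OF sa(1) \<open>p (1 - (1 - h * h)) \<le> 1\<close> sa(2)] by blast
  have "h * s = s * h" by (rule s(2)) (simp add: algebra_simps)
  then have "(p s)\<^sup>2 \<le> p (s * s + h * h)"
    using s(1) assms(1) by (intro norm_le_sum_squares) auto
  also have "p (s * s + h * h) \<le> p 1 + p (s * s + h * h - 1)"
    using add[of 1 "s * s + h * h - 1"] by simp
  also have "s * s + h * h - 1 = - (1 - h * h - s * s)" by simp
  finally have "(p s)\<^sup>2 \<le> 1 + e / 2"
    using s(3) one_le by (simp only: uminus)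
  then have "p (s * s) \<le> 1 + e / 2"
    using mult[of s s] by (simp add: power2_eq_square)
  then show "p (1 - h * h) \<le> 1 + e"
    using add[of "1 - h * h - s * s" "s * s"] s(3) by simp
qed

lemma complement_bound:
  assumes u: "fstar u = u" and "0 < c"
    and 1: "p (1 - fconst (of_real c) * u) \<le> 1"
    and 2: "p (1 - fconst (of_real c) * (1 - u)) \<le> 1"
  shows "p u \<le> 1"
proof -
  have "c * p u \<le> c"
  proof (rule field_le_epsilon)
    fix e :: real assume "0 < e"
    then have e3: "0 < e / 3" by simp
    let ?x = "fconst (of_real c) * u" and ?y = "fconst (of_real c) * (1 - u)"
    have sa: "fstar ?x = ?x" "fstar ?y = ?y"
      using u by (simp_all add: fconst_commute del: right_diff_distrib)
    obtain s where s: "fstar s = s" "\<And>z. z * ?x = ?x * z \<Longrightarrow> z * s = s * z" "p (?x - s * s) < e / 3"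
      using approx_sqrt[OF sa(1) 1 e3] by blast
    obtain t where t: "fstar t = t" "\<And>z. z * ?y = ?y * z \<Longrightarrow> z * t = t * z" "p (?y - t * t) < e / 3"
      using approx_sqrt[OF sa(2) 2 e3] by blast
    have "u * s = s * u" by (rule s(2)) (simp add: fconst_left_commute mult.assoc)
    then have "s * t = t * s"
      by (intro t(2), simp only: fconst_left_commute mult.assoc)
        (simp only: left_diff_distrib right_diff_distrib mult_1_left mult_1_right)
    then have "(p s)\<^sup>2 \<le> p (s * s + t * t)"
      using s(1) t(1) by (intro norm_le_sum_squares) auto
    also have "s * s + t * t = fconst (of_real c) - ((?x - s * s) + (?y - t * t))"
      by (simp add: algebra_simps)
    also have "p \<dots> \<le> c + (e / 3 + e / 3)"
      using diff[of "fconst (of_real c)" "(?x - s * s) + (?y - t * t)"]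
        add[of "?x - s * s" "?y - t * t"] fconst_le[of "of_real c"] s(3) t(3) \<open>0 < c\<close>
      by simp
    finally have "p (s * s) \<le> c + (e / 3 + e / 3)"
      using mult[of s s] by (simp add: power2_eq_square)
    then have "p ?x \<le> c + e"
      using add[of "?x - s * s" "s * s"] s(3) by simp
    then show "c * p u \<le> c + e"
      using \<open>0 < c\<close> by (simp add: scale)
  qed
  then show ?thesis using \<open>0 < c\<close> by simp
qed

abbreviation sym_square :: "'a free_alg \<Rightarrow> 'a free_alg" where
  "sym_square a \<equiv> fconst (1 / 2) * (a * fstar a + fstar a * a)"

lemma sym_square_bound:
  assumes "p a \<le> r" "0 < r"
  shows "p (1 - fconst (of_real (1 / (2 * r\<^sup>2))) * sym_square a) \<le> 1"
proof -
  define h where "h = fconst (of_real (1 / (2 * r))) * (a + fstar a)"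
  define k where "k = fconst (\<i> * of_real (1 / (2 * r))) * (a - fstar a)"
  have h: "fstar h = h" by (simp add: h_def fconst_commute add.commute)
  have k: "fstar k = k"
    by (simp add: k_def fconst_commute right_diff_distrib fconst_minus[symmetric] del: fconst_minus)
  have "p h \<le> 1"
    unfolding h_def scale using assms add[of a "fstar a"] by (simp add: norm_divide norm_mult field_simps)
  moreover have "p k \<le> 1"
    unfolding k_def scale using assms diff[of a "fstar a"] by (simp add: norm_divide norm_mult field_simps)
  ultimately have le: "p (1 - h * h) \<le> 1" "p (1 - k * k) \<le> 1"
    using h k by (auto intro: one_minus_square_le)
  have "h * h + k * k = fconst (of_real (1 / r\<^sup>2)) * sym_square a"
  proof -
    let ?c = "complex_of_real (1 / (4 * r\<^sup>2))"
    have "h * h = fconst ?c * ((a + fstar a) * (a + fstar a))"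
      unfolding h_def fconst_mult_mult by (simp add: power2_eq_square)
    moreover have "k * k = fconst (- ?c) * ((a - fstar a) * (a - fstar a))"
      unfolding k_def fconst_mult_mult by (simp add: power2_eq_square)
    ultimately have "h * h + k * k =
        fconst ?c * ((a + fstar a) * (a + fstar a) - (a - fstar a) * (a - fstar a))"
      by (simp add: right_diff_distrib fconst_minus[symmetric] del: fconst_minus)
    also have "(a + fstar a) * (a + fstar a) - (a - fstar a) * (a - fstar a) =
        fconst 2 * (a * fstar a + fstar a * a)"
      by (simp add: mult_2 algebra_simps)
    also have "fconst ?c * \<dots> = fconst (of_real (1 / r\<^sup>2)) * sym_square a"
      unfolding mult.assoc[symmetric] fconst_mult
      by (rule arg_cong[of _ _ "\<lambda>c. fconst c * (a * fstar a + fstar a * a)"]) simp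
    finally show ?thesis .
  qed
  then have eq: "fconst (of_real (1 / (2 * r\<^sup>2))) * sym_square a = fconst (1 / 2) * (h * h + k * k)"
    unfolding \<open>h * h + k * k = _\<close> mult.assoc[symmetric] fconst_mult
    by (intro arg_cong[of _ _ "\<lambda>c. fconst c * (a * fstar a + fstar a * a)"]) simp
  have "1 - fconst (of_real (1 / (2 * r\<^sup>2))) * sym_square a =
      fconst (1 / 2) * ((1 - h * h) + (1 - k * k))"
  proof -
    have "fconst (1 / 2) * (1 + 1) = (1 :: 'a free_alg)"
      using fconst_cancel[of "1 / 2" 2 1] by (simp add: fconst_two[of 1, symmetric])
    then have "fconst (1 / 2) * ((1 - h * h) + (1 - k * k)) = 1 - fconst (1 / 2) * (h * h + k * k)"
      by (simp add: algebra_simps)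
    then show ?thesis unfolding eq by (rule sym)
  qed
  then show ?thesis
    using le add[of "1 - h * h" "1 - k * k"] by (simp add: scale)
qed

lemma normal_pair_bound:
  assumes a: "p (a * fstar a - fstar a * a) = 0" and b: "p (b * fstar b - fstar b * b) = 0"
    and ab: "p (a * fstar a + b * fstar b - 1) = 0"
  shows "p a \<le> 1"
proof -
  define r where "r = 1 + p a + p b"
  have r: "p a \<le> r" "p b \<le> r" "0 < r" using nonneg[of a] nonneg[of b] by (auto simp: r_def)
  define u where "u = sym_square a"
  define c where "c = 1 / (2 * r\<^sup>2)"
  have c: "0 < c" using r by (simp add: c_def)
  have half: "p (sym_square x - x * fstar x) = 0" if "p (x * fstar x - fstar x * x) = 0" for x
  proof -
    have "x * fstar x = fconst (1 / 2) * (x * fstar x + x * fstar x)"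
      unfolding fconst_two[symmetric] by (rule fconst_cancel[symmetric]) simp
    then have "sym_square x - x * fstar x = fconst (1 / 2) * (fstar x * x - x * fstar x)"
      by (simp add: algebra_simps)
    then show ?thesis using that by (simp add: scale minus_commute)
  qed
  have eq: "p (1 - u - sym_square b) = 0"
  proof -
    have "1 - u - sym_square b =
        - ((a * fstar a + b * fstar b - 1) + (u - a * fstar a) + (sym_square b - b * fstar b))"
      by simp
    then have "p (1 - u - sym_square b) \<le> p (a * fstar a + b * fstar b - 1) +
        p (u - a * fstar a) + p (sym_square b - b * fstar b)"
      using add[of "(a * fstar a + b * fstar b - 1) + (u - a * fstar a)" "sym_square b - b * fstar b"]
        add[of "a * fstar a + b * fstar b - 1" "u - a * fstar a"] by (simp only: uminus)
    then show ?thesis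
      using ab half[OF a] half[OF b] nonneg[of "1 - u - sym_square b"] by (simp add: u_def)
  qed
  have "p u \<le> 1"
  proof (rule complement_bound[OF _ c])
    show "fstar u = u" by (simp add: u_def fconst_commute add.commute)
    show "p (1 - fconst (of_real c) * u) \<le> 1"
      unfolding u_def c_def by (rule sym_square_bound[OF r(1,3)])
    have "(1 - fconst (of_real c) * (1 - u)) - (1 - fconst (of_real c) * y) =
        - (fconst (of_real c) * (1 - u - y))" for y
      by (simp add: algebra_simps)
    then have "p ((1 - fconst (of_real c) * (1 - u)) - (1 - fconst (of_real c) * sym_square b)) =
        p (fconst (of_real c) * (1 - u - sym_square b))"
      by (simp only: uminus)
    also have "\<dots> = 0" using eq by (simp add: scale)
    finally have "p (1 - fconst (of_real c) * (1 - u)) = p (1 - fconst (of_real c) * sym_square b)"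
      by (rule diff_zero_cong)
    then show "p (1 - fconst (of_real c) * (1 - u)) \<le> 1"
      using sym_square_bound[OF r(2,3)] by (simp add: c_def)
  qed
  then have "(p a)\<^sup>2 \<le> 1"
    using diff_zero_cong[OF half[OF a]] by (simp add: u_def cstar')
  then show ?thesis using nonneg[of a] unfolding abs_square_le_1 by simp
qed

end

lemma seminorms_bounded:
  assumes gens: "\<And>g. \<exists>K. \<forall>p\<in>relator_seminorms R. p (fgen g) \<le> K"
  shows "bdd_above ((\<lambda>p. p x) ` relator_seminorms R)"
proof -
  have sn: "cstar_seminorm p" if "p \<in> relator_seminorms R" for p
    using that by (simp add: relator_seminorms_def)
  have letter: "\<exists>K. \<forall>p\<in>relator_seminorms R. p (Poly_Mapping.single (Word [l]) 1) \<le> K" for l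
  proof (cases l)
    case (Adj g)
    obtain K where K: "\<And>p. p \<in> relator_seminorms R \<Longrightarrow> p (fgen g) \<le> K" using gens by blast
    have "p (Poly_Mapping.single (Word [l]) 1) \<le> K" if "p \<in> relator_seminorms R" for p
      using cstar_seminorm.fstar[OF sn[OF that], of "fgen g"] K[OF that] by (simp add: Adj)
    then show ?thesis by blast
  qed (use gens in auto)
  have word: "\<exists>K. \<forall>p\<in>relator_seminorms R. p (Poly_Mapping.single (Word u) 1) \<le> K" for u
  proof (induction u)
    case Nil
    then show ?case
      using cstar_seminorm.one_le[OF sn] by (metis single_one zero_word_def)
  next
    case (Cons l u)
    obtain K where K: "\<And>p. p \<in> relator_seminorms R \<Longrightarrow> p (Poly_Mapping.single (Word u) 1) \<le> K"
      using Cons by blast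
    obtain L where L: "\<And>p. p \<in> relator_seminorms R \<Longrightarrow> p (Poly_Mapping.single (Word [l]) 1) \<le> L"
      using letter by blast
    have "p (Poly_Mapping.single (Word (l # u)) 1) \<le> L * K" if p: "p \<in> relator_seminorms R" for p
    proof -
      interpret cstar_seminorm p by (rule sn[OF p])
      have "p (Poly_Mapping.single (Word (l # u)) 1) =
          p (Poly_Mapping.single (Word [l]) 1 * Poly_Mapping.single (Word u) 1)"
        by (simp add: mult_single)
      also have "\<dots> \<le> p (Poly_Mapping.single (Word [l]) 1) * p (Poly_Mapping.single (Word u) 1)"
        by (rule mult)
      also have "\<dots> \<le> L * K"
        using K[OF p] L[OF p] nonneg order.trans[OF nonneg L[OF p]] by (intro mult_mono) auto
      finally show ?thesis .
    qed
    then show ?case by blast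
  qed
  have "\<exists>K. \<forall>p\<in>relator_seminorms R. p x \<le> K"
  proof (induction x rule: free_alg_induct)
    case zero
    have "p 0 \<le> 0" if "p \<in> relator_seminorms R" for p
      using cstar_seminorm.zero[OF sn[OF that]] by simp
    then show ?case by blast
  next
    case (single w c)
    obtain u where u: "w = Word u" by (cases w)
    obtain K where K: "\<And>p. p \<in> relator_seminorms R \<Longrightarrow> p (Poly_Mapping.single (Word u) 1) \<le> K"
      using word by blast
    have "p (Poly_Mapping.single w c) \<le> cmod c * K" if p: "p \<in> relator_seminorms R" for p
      using cstar_seminorm.scale[OF sn[OF p], of c "Poly_Mapping.single (Word u) 1"] K[OF p]
      by (simp add: mult_single u mult_left_mono)
    then show ?case by blast
  next
    case (plus x y)
    then obtain K L where K: "\<And>p. p \<in> relator_seminorms R \<Longrightarrow> p x \<le> K"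
      and L: "\<And>p. p \<in> relator_seminorms R \<Longrightarrow> p y \<le> L" by blast
    have "p (x + y) \<le> K + L" if "p \<in> relator_seminorms R" for p
      using cstar_seminorm.add[OF sn[OF that], of x y] K[OF that] L[OF that] by linarith
    then show ?case by blast
  qed
  then show ?thesis by (auto simp: bdd_above_def)
qed

lemma Uq2_seminorms_bounded:
  assumes "q \<noteq> 0"
  shows "bdd_above ((\<lambda>p. p x) ` relator_seminorms (Uq2_relators q))"
proof (rule seminorms_bounded)
  define t where "t = (cmod q)\<^sup>2"
  have t: "0 < t" using assms by (simp add: t_def)
  define K where "K = 2 + 2 / \<bar>1 - t\<bar>"
  have "p (fgen g) \<le> 2 + K" if p: "p \<in> relator_seminorms (Uq2_relators q)" for p g
  proof -
    interpret cstar_seminorm p using p by (simp add: relator_seminorms_def)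
    let ?a = "fgen gen_a" and ?b = "fgen gen_b" and ?D = "fgen gen_D"
    have rel: "p (?b * fstar ?b - fstar ?b * ?b) = 0" "p (?a * fstar ?a + ?b * fstar ?b - 1) = 0"
      "p (fstar ?D * ?D - 1) = 0" "p (fstar ?a * ?a + fconst (of_real t) * fstar ?b * ?b - 1) = 0"
      using p unfolding relator_seminorms_def Uq2_relators_def Let_def t_def by blast+
    have "(p ?D)\<^sup>2 \<le> 1"
      using diff_zero_cong[OF rel(3)] one_le by (simp only: cstar)
    then have D: "p ?D \<le> 1"
      using nonneg[of ?D] unfolding abs_square_le_1 by simp
    have K: "2 \<le> K" by (simp add: K_def)
    have b0: "(p ?a)\<^sup>2 = p (1 - ?b * fstar ?b)"
    proof -
      have "?a * fstar ?a - (1 - ?b * fstar ?b) = ?a * fstar ?a + ?b * fstar ?b - 1" by simp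
      then show ?thesis using diff_zero_cong[of "?a * fstar ?a" "1 - ?b * fstar ?b"] rel(2)
        by (simp only: cstar')
    qed
    have ab: "(p ?a)\<^sup>2 \<le> K + 1 \<and> (p ?b)\<^sup>2 \<le> K"
    proof (cases "t = 1")
      case True
      have "p (?a * fstar ?a - fstar ?a * ?a) = 0"
      proof -
        have "?a * fstar ?a - fstar ?a * ?a = (?a * fstar ?a + ?b * fstar ?b - 1) -
            (?b * fstar ?b - fstar ?b * ?b) - (fstar ?a * ?a + fconst (of_real t) * fstar ?b * ?b - 1)"
          using True by simp
        then have "p (?a * fstar ?a - fstar ?a * ?a) \<le> p (?a * fstar ?a + ?b * fstar ?b - 1) +
            p (?b * fstar ?b - fstar ?b * ?b) + p (fstar ?a * ?a + fconst (of_real t) * fstar ?b * ?b - 1)"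
          using diff[of "?a * fstar ?a + ?b * fstar ?b - 1" "?b * fstar ?b - fstar ?b * ?b"]
            diff[of "(?a * fstar ?a + ?b * fstar ?b - 1) - (?b * fstar ?b - fstar ?b * ?b)"
              "fstar ?a * ?a + fconst (of_real t) * fstar ?b * ?b - 1"]
          by (simp only: order.trans[OF _ add_right_mono])
        then show ?thesis using rel nonneg[of "?a * fstar ?a - fstar ?a * ?a"] by linarith
      qed
      then have "p ?a \<le> 1" by (rule normal_pair_bound[OF _ rel(1,2)])
      then have a: "(p ?a)\<^sup>2 \<le> 1" using nonneg[of ?a] by (simp only: abs_square_le_1 abs_of_nonneg)
      have "(p ?b)\<^sup>2 \<le> p 1 + p (1 - ?b * fstar ?b)"
        using diff[of 1 "1 - ?b * fstar ?b"] cstar'[of ?b] by simp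
      then show ?thesis using a b0 one_le K by linarith
    next
      case False
      let ?N = "(p ?b)\<^sup>2"
      have eq: "p (1 - ?b * fstar ?b) = p (1 - fconst (of_real t) * (fstar ?b * ?b))"
      proof -
        have "fstar ?a * ?a - (1 - fconst (of_real t) * (fstar ?b * ?b)) =
            fstar ?a * ?a + fconst (of_real t) * fstar ?b * ?b - 1"
          by (simp add: mult.assoc)
        then show ?thesis
          using diff_zero_cong[of "fstar ?a * ?a" "1 - fconst (of_real t) * (fstar ?b * ?b)"]
            rel(4) b0 cstar[of ?a] by metis
      qed
      have c: "p (fstar ?b * ?b) = ?N" "p (?b * fstar ?b) = ?N" by (rule cstar cstar')+
      have s: "p (fconst (of_real t) * (fstar ?b * ?b)) = t * ?N"
        using t by (simp only: scale c) simp
      have 1: "p (1 - ?b * fstar ?b) \<le> 1 + ?N" "?N \<le> 1 + p (1 - ?b * fstar ?b)"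
        using diff[of 1 "?b * fstar ?b"] diff[of 1 "1 - ?b * fstar ?b"] one_le c(2) by auto
      have 2: "p (1 - fconst (of_real t) * (fstar ?b * ?b)) \<le> 1 + t * ?N"
        "t * ?N \<le> 1 + p (1 - fconst (of_real t) * (fstar ?b * ?b))"
        using diff[of 1 "fconst (of_real t) * (fstar ?b * ?b)"]
          diff[of 1 "1 - fconst (of_real t) * (fstar ?b * ?b)"] one_le s by auto
      have "\<bar>1 - t\<bar> * ?N \<le> 2"
        using 1 2 eq by (cases "t < 1") (auto simp: left_diff_distrib)
      then have "?N \<le> 2 / \<bar>1 - t\<bar>"
        using False by (simp add: field_simps)
      then show ?thesis using b0 1(1) by (simp add: K_def)
    qed
    have sq: "y \<le> 2 + K" if "y\<^sup>2 \<le> K + 1" for y :: real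
    proof (rule ccontr)
      assume "\<not> y \<le> 2 + K"
      then have "y * 1 \<le> y * y" using K by (intro mult_left_mono) auto
      then show False using that \<open>\<not> y \<le> 2 + K\<close> by (simp add: power2_eq_square)
    qed
    show ?thesis
      using ab D K sq by (cases g) auto
  qed
  then show "\<exists>K. \<forall>p\<in>relator_seminorms (Uq2_relators q). p (fgen g) \<le> K" for g by blast
qed


subsection \<open>Conclusion\<close>

definition Uq2_triple :: "complex \<Rightarrow> ('a, 'm) cstar_alg_scheme \<Rightarrow> 'a \<Rightarrow> 'a \<Rightarrow> 'a \<Rightarrow> bool" where
  "Uq2_triple q A a b D \<longleftrightarrow>
     a \<in> carrier A \<and> b \<in> carrier A \<and> D \<in> carrier A \<and>
     b \<otimes>\<^bsub>A\<^esub> a = q \<odot>\<^bsub>A\<^esub> (a \<otimes>\<^bsub>A\<^esub> b) \<and>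
     star A a \<otimes>\<^bsub>A\<^esub> b = q \<odot>\<^bsub>A\<^esub> (b \<otimes>\<^bsub>A\<^esub> star A a) \<and>
     b \<otimes>\<^bsub>A\<^esub> star A b = star A b \<otimes>\<^bsub>A\<^esub> b \<and>
     a \<otimes>\<^bsub>A\<^esub> star A a \<oplus>\<^bsub>A\<^esub> b \<otimes>\<^bsub>A\<^esub> star A b = \<one>\<^bsub>A\<^esub> \<and>
     a \<otimes>\<^bsub>A\<^esub> D = D \<otimes>\<^bsub>A\<^esub> a \<and>
     b \<otimes>\<^bsub>A\<^esub> D = (q\<^sup>2 / of_real ((cmod q)\<^sup>2)) \<odot>\<^bsub>A\<^esub> (D \<otimes>\<^bsub>A\<^esub> b) \<and>
     D \<otimes>\<^bsub>A\<^esub> star A D = \<one>\<^bsub>A\<^esub> \<and>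
     star A D \<otimes>\<^bsub>A\<^esub> D = \<one>\<^bsub>A\<^esub> \<and>
     star A a \<otimes>\<^bsub>A\<^esub> a \<oplus>\<^bsub>A\<^esub> of_real ((cmod q)\<^sup>2) \<odot>\<^bsub>A\<^esub> (star A b \<otimes>\<^bsub>A\<^esub> b) = \<one>\<^bsub>A\<^esub>"

lemma (in unital_cstar_algebra) minus_eq_zero_iff:
  "\<lbrakk>x \<in> carrier A; y \<in> carrier A\<rbrakk> \<Longrightarrow> x \<ominus> y = \<zero> \<longleftrightarrow> x = y"
  using minus_eq_zeroD by (auto simp: a_minus_def r_neg)

lemma (in unital_cstar_algebra) Uq2_triple_iff:
  assumes f: "\<And>g. f g \<in> carrier A"
  shows "Uq2_triple q A (f gen_a) (f gen_b) (f gen_D) \<longleftrightarrow>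
    (\<forall>r\<in>Uq2_relators q. free_eval A f r = \<zero>)"
  unfolding Uq2_triple_def Uq2_relators_def Let_def
  by (simp only: ball_simps mult.assoc free_eval_minus[OF f] free_eval_add[OF f] free_eval_fconst[OF f]
      free_eval_mult[OF f] free_eval_fstar[OF f] free_eval_one[OF f] free_eval_fgen[OF f])
    (simp add: f minus_eq_zero_iff star_closed smult_mult_left)

context
  fixes R :: "'g free_alg set"
  assumes bdd: "\<And>x. bdd_above ((\<lambda>p. p x) ` relator_seminorms R)"
begin

interpretation u: cstar_seminorm "universal_seminorm R"
  using universal_seminorm_in[OF bdd] by (simp add: relator_seminorms_def)

theorem universal_cstar_algebra: "unital_cstar_algebra (universal_cstar R)"
  unfolding universal_cstar_def by (rule u.completion_unital_cstar_algebra)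

interpretation C: unital_cstar_algebra "universal_cstar R"
  by (rule universal_cstar_algebra)

lemma universal_gen_closed: "universal_gen R g \<in> carrier (universal_cstar R)"
  by (simp add: universal_gen_def universal_cstar_def)

lemma universal_eval:
  "free_eval (universal_cstar R) (universal_gen R) x = cauchy_class (universal_seminorm R) (\<lambda>n. x)"
proof -
  note gen = universal_gen_closed
  have letter: "eval_letter (universal_cstar R) (universal_gen R) l =
      cauchy_class (universal_seminorm R) (\<lambda>n. Poly_Mapping.single (Word [l]) 1)" for l
    by (cases l) (simp_all add: universal_gen_def universal_cstar_def u.cls_ops)
  have word: "eval_word (universal_cstar R) (universal_gen R) (Word w) =
      cauchy_class (universal_seminorm R) (\<lambda>n. Poly_Mapping.single (Word w) 1)" for w
  proof (induction w)
    case Nil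
    have "Poly_Mapping.single (Word []) 1 = (1 :: 'g free_alg)"
      by (metis single_one zero_word_def)
    then show ?case
      by (simp add: universal_cstar_def u.cls_ops)
  next
    case (Cons l w)
    then show ?case
      by (simp add: letter) (simp add: universal_cstar_def u.cls_ops mult_single)
  qed
  show ?thesis
  proof (induction x rule: free_alg_induct)
    case zero
    show ?case by (simp add: C.free_eval_zero[OF gen]) (simp add: universal_cstar_def u.cls_ops)
  next
    case (single w c)
    obtain v where v: "w = Word v" by (cases w)
    show ?case
      unfolding C.free_eval_single[OF gen] v word
      by (simp add: universal_cstar_def u.cls_ops mult_single)
  next
    case (plus x y)
    then show ?case
      by (simp add: C.free_eval_add[OF gen]) (simp add: universal_cstar_def u.cls_ops)
  qed
qed

theorem universal_cstar_relators:
  assumes "r \<in> R"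
  shows "free_eval (universal_cstar R) (universal_gen R) r = \<zero>\<^bsub>universal_cstar R\<^esub>"
proof -
  have "universal_seminorm R r = 0"
    using assms universal_seminorm_in[OF bdd] by (simp add: relator_seminorms_def)
  then show ?thesis
    unfolding universal_eval by (simp add: universal_cstar_def u.cls_zero u.cls_eq_iff)
qed

theorem universal_cstar_dense:
  assumes "X \<in> carrier (universal_cstar R)" "0 < e"
  shows "\<exists>x. cnorm (universal_cstar R)
    (X \<ominus>\<^bsub>universal_cstar R\<^esub> free_eval (universal_cstar R) (universal_gen R) x) < e"
  unfolding universal_eval
  using u.completion_dense[OF assms(1)[unfolded universal_cstar_def] assms(2)]
  by (simp add: universal_cstar_def)

theorem universal_cstar_lift:
  assumes B: "unital_cstar_algebra B" and f: "\<And>g. f g \<in> carrier B"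
    and rel: "\<And>r. r \<in> R \<Longrightarrow> free_eval B f r = \<zero>\<^bsub>B\<^esub>"
  shows "\<exists>h\<in>star_hom (universal_cstar R) B. \<forall>g. h (universal_gen R g) = f g"
proof -
  interpret B: unital_cstar_algebra B by (rule B)
  have "(\<lambda>x. cnorm B (free_eval B f x)) \<in> relator_seminorms R"
    using B.free_eval_seminorm[OF f] rel by (simp add: relator_seminorms_def)
  then have dom: "cnorm B (free_eval B f x) \<le> universal_seminorm R x" for x
    by (rule universal_seminorm_upper[OF bdd])
  let ?h = "B.completion_lift f"
  have "?h \<in> star_hom (universal_cstar R) B"
    unfolding universal_cstar_def
    by (rule B.lift_star_hom[OF f u.cstar_seminorm_axioms dom])
  moreover have "?h (universal_gen R g) = f g" for g
    unfolding universal_gen_def B.lift_const[OF f u.cstar_seminorm_axioms dom]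
    by (rule B.free_eval_fgen[OF f])
  ultimately show ?thesis by blast
qed

end

theorem C_Uq2_cstar_algebra: "q \<noteq> 0 \<Longrightarrow> unital_cstar_algebra (C_Uq2 q)"
  unfolding C_Uq2_def by (intro universal_cstar_algebra Uq2_seminorms_bounded)

theorem C_Uq2_triple:
  assumes "q \<noteq> 0"
  shows "Uq2_triple q (C_Uq2 q) (universal_gen (Uq2_relators q) gen_a)
    (universal_gen (Uq2_relators q) gen_b) (universal_gen (Uq2_relators q) gen_D)"
proof -
  note bdd = Uq2_seminorms_bounded[OF assms]
  show ?thesis
    using universal_cstar_relators[OF bdd] unfolding C_Uq2_def
    by (subst unital_cstar_algebra.Uq2_triple_iff[OF universal_cstar_algebra[OF bdd]
          universal_gen_closed[OF bdd]]) blast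
qed

theorem C_Uq2_dense:
  assumes "q \<noteq> 0" "X \<in> carrier (C_Uq2 q)" "0 < e"
  shows "\<exists>x. cnorm (C_Uq2 q)
    (X \<ominus>\<^bsub>C_Uq2 q\<^esub> free_eval (C_Uq2 q) (universal_gen (Uq2_relators q)) x) < e"
  using universal_cstar_dense[OF Uq2_seminorms_bounded] assms unfolding C_Uq2_def by blast

theorem C_Uq2_universal:
  assumes "q \<noteq> 0" "unital_cstar_algebra B" "Uq2_triple q B a b D"
  shows "\<exists>h\<in>star_hom (C_Uq2 q) B.
    h (universal_gen (Uq2_relators q) gen_a) = a \<and>
    h (universal_gen (Uq2_relators q) gen_b) = b \<and>
    h (universal_gen (Uq2_relators q) gen_D) = D"
proof -
  define f where "f = case_Uq2_gen a b D"
  have f: "f g \<in> carrier B" for g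
    using assms(3) by (cases g) (auto simp: f_def Uq2_triple_def)
  have "\<forall>r\<in>Uq2_relators q. free_eval B f r = \<zero>\<^bsub>B\<^esub>"
    using unital_cstar_algebra.Uq2_triple_iff[of B f q, OF assms(2) f] assms(3) by (simp add: f_def)
  then obtain h where h: "h \<in> star_hom (C_Uq2 q) B"
    "\<And>g. h (universal_gen (Uq2_relators q) g) = f g"
    unfolding C_Uq2_def
    using universal_cstar_lift[of "Uq2_relators q" B f, OF Uq2_seminorms_bounded[OF assms(1)] assms(2) f]
    by blast
  then show ?thesis by (intro bexI[OF _ h(1)]) (simp add: f_def)
qed

end

theory Submission
  imports Defs
begin

text \<open>For real \<open>q'\<close> the unitary \<open>D\<close> is central in \<open>C(U\<^bsub>q'\<^esub>(2))\<close>, yet the characters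
  \<open>a \<mapsto> 1\<close>, \<open>b \<mapsto> 0\<close>, \<open>D \<mapsto> d\<close> take it to any \<open>d\<close> in the unit circle. In contrast, all
  characters of \<open>C(U\<^sub>q(2))\<close> agree on every central element \<open>z\<close>. Indeed \<open>b\<close> acts diagonally with
  pairwise distinct eigenvalues in the representation on \<open>\<ell>\<^sup>2(\<nat> \<times> \<int>)\<close>, because \<open>\<bar>q\<bar> \<noteq> 1\<close> and
  \<open>\<theta>\<close> is irrational, so \<open>z\<close> acts as a scalar \<open>\<lambda>\<close>. Every character is a limit of vector states
  of approximate joint eigenvectors of \<open>a\<close> and \<open>D\<close> far out in the \<open>\<nat>\<close> direction, where \<open>b\<close>
  is small, and hence takes \<open>z\<close> to \<open>\<lambda>\<close>. Working with finitely supported vectors only,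
  no Hilbert space completion and no operator algebra is needed: the operator norm is a
  C*-seminorm on the free algebra as soon as generators have formal adjoints.\<close>

section \<open>Characters and central elements\<close>

definition complex_cstar :: "complex cstar_alg" where
  "complex_cstar = \<lparr>carrier = UNIV, mult = (*), one = 1, zero = 0, add = (+),
     smult = (*), star = cnj, cnorm = cmod\<rparr>"

lemma complex_cstar_simps [simp]:
  "carrier complex_cstar = UNIV" "\<one>\<^bsub>complex_cstar\<^esub> = 1" "\<zero>\<^bsub>complex_cstar\<^esub> = 0"
  "x \<oplus>\<^bsub>complex_cstar\<^esub> y = x + y" "x \<otimes>\<^bsub>complex_cstar\<^esub> y = x * y"
  "c \<odot>\<^bsub>complex_cstar\<^esub> x = c * x" "star complex_cstar x = cnj x" "cnorm complex_cstar x = cmod x"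
  by (simp_all add: complex_cstar_def)

lemma abelian_group_complex_cstar: "abelian_group complex_cstar"
  by (rule abelian_groupI) (auto simp: algebra_simps intro: exI[of _ "- _"] add.right_inverse)

lemma complex_cstar_minus [simp]: "x \<ominus>\<^bsub>complex_cstar\<^esub> y = x - y"
  by (rule abelian_group_minusI[OF abelian_group_complex_cstar]) auto

text \<open>This is what lets \<open>C_Uq2_universal\<close> produce characters, as *-homomorphisms
  into \<open>complex_cstar\<close>.\<close>

lemma unital_cstar_algebra_complex: "unital_cstar_algebra complex_cstar"
proof (intro unital_cstar_algebra.intro)
  show "ring complex_cstar"
    by (rule ringI[OF abelian_group_complex_cstar])
      (auto simp: algebra_simps intro!: Group.monoidI)
  show "module complex_ring complex_cstar"
    by (rule moduleI[OF cring_complex_ring abelian_group_complex_cstar]) (auto simp: algebra_simps)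
  show "unital_cstar_algebra_axioms complex_cstar"
  proof
    fix s :: "nat \<Rightarrow> complex"
    assume "\<And>e. 0 < e \<Longrightarrow> \<exists>N. \<forall>m\<ge>N. \<forall>n\<ge>N. cnorm complex_cstar (s m \<ominus>\<^bsub>complex_cstar\<^esub> s n) < e"
    then have "Cauchy s" by (simp add: Cauchy_iff)
    then obtain l where "s \<longlonglongrightarrow> l" using Cauchy_convergent unfolding convergent_def by blast
    then show "\<exists>l\<in>carrier complex_cstar. (\<lambda>n. cnorm complex_cstar (s n \<ominus>\<^bsub>complex_cstar\<^esub> l)) \<longlonglongrightarrow> 0"
      using tendsto_norm_zero[OF LIM_zero] by (intro bexI[of _ l]) auto
  qed (auto simp: norm_triangle_ineq norm_mult power2_eq_square)
qed

section \<open>Neumann series and contractivity of characters\<close>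

context unital_cstar_algebra
begin

text \<open>The C*-identity makes this norm idempotent, hence 0 or 1; the value 0 occurs in the zero
  algebra, which the locale allows.\<close>

lemma cnorm_one_le: "cnorm A \<one> \<le> 1"
proof -
  have "cnorm A \<one> = (cnorm A \<one>)\<^sup>2"
    using cstar_identity[of \<one>] by simp
  then have "cnorm A \<one> = 0 \<or> cnorm A \<one> = 1" by (auto simp: power2_eq_square)
  then show ?thesis by auto
qed

text \<open>Horner form of the sum of the powers of \<open>x\<close> with exponent below
  \<open>n\<close>.\<close>

primrec neumann :: "'a \<Rightarrow> nat \<Rightarrow> 'a" where
  "neumann x 0 = \<zero>"
| "neumann x (Suc n) = \<one> \<oplus> x \<otimes> neumann x n"

lemma neumann_closed [simp]: "x \<in> carrier A \<Longrightarrow> neumann x n \<in> carrier A"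
  by (induction n) auto

lemma mult_minus_right:
  assumes "x \<in> carrier A" "y \<in> carrier A" "z \<in> carrier A"
  shows "x \<otimes> (y \<ominus> z) = x \<otimes> y \<ominus> x \<otimes> z"
  using assms by (simp add: a_minus_def r_distr r_minus)

lemma mult_minus_left:
  assumes "x \<in> carrier A" "y \<in> carrier A" "z \<in> carrier A"
  shows "(x \<ominus> y) \<otimes> z = x \<otimes> z \<ominus> y \<otimes> z"
  using assms by (simp add: a_minus_def l_distr l_minus)

lemma add_minus_cancel_left:
  assumes "x \<in> carrier A" "y \<in> carrier A" "z \<in> carrier A"
  shows "(z \<oplus> x) \<ominus> (z \<oplus> y) = x \<ominus> y"
proof (rule abelian_group_minusI[OF abelian_group_axioms])
  have "(x \<ominus> y) \<oplus> (z \<oplus> y) = z \<oplus> ((x \<oplus> \<ominus> y) \<oplus> y)"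
    unfolding a_minus_def using assms by (intro a_lcomm) auto
  also have "(x \<oplus> \<ominus> y) \<oplus> y = x"
    using assms by (simp add: a_assoc l_neg)
  finally show "(x \<ominus> y) \<oplus> (z \<oplus> y) = z \<oplus> x" .
qed (use assms in auto)

text \<open>Convergence of the geometric series: its sum \<open>y\<close> is a right inverse of
  \<open>\<one> \<ominus> x\<close>, stated in the form to which a character can be applied
  directly.\<close>

lemma neumann_fixpoint:
  assumes x: "x \<in> carrier A" and lt: "cnorm A x < 1"
  obtains y where "y \<in> carrier A" "y = \<one> \<oplus> x \<otimes> y"
proof -
  let ?y = "neumann x" and ?r = "cnorm A x"
  have r: "0 \<le> ?r" using x by (rule cnorm_nonneg)
  have bound: "cnorm A (?y n) \<le> 1 / (1 - ?r)" for n
  proof (induction n)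
    case (Suc n)
    have "cnorm A (?y (Suc n)) \<le> 1 + ?r * cnorm A (?y n)"
      using x cnorm_add[of \<one> "x \<otimes> ?y n"] cnorm_one_le cnorm_mult[of x "?y n"] by simp
    also have "\<dots> \<le> 1 + ?r * (1 / (1 - ?r))"
      using Suc r by (intro add_left_mono mult_left_mono)
    also have "\<dots> = 1 / (1 - ?r)" using lt by (simp add: field_simps)
    finally show ?case .
  qed (use lt in simp)
  \<comment> \<open>Both sums have the same outermost factor, so their difference is
    \<open>x\<close> times the previous one; after \<open>n\<close> rounds only the uniform bound on
    \<open>neumann x k\<close> remains.\<close>
  have diff: "cnorm A (?y (n + k) \<ominus> ?y n) \<le> ?r ^ n * (1 / (1 - ?r))" for n k
  proof (induction n)
    case 0
    then show ?case using x bound[of k] by (simp add: a_minus_def)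
  next
    case (Suc n)
    have "?y (Suc n + k) \<ominus> ?y (Suc n) = x \<otimes> (?y (n + k) \<ominus> ?y n)"
      using x by (simp add: mult_minus_right add_minus_cancel_left)
    then have "cnorm A (?y (Suc n + k) \<ominus> ?y (Suc n)) \<le> ?r * cnorm A (?y (n + k) \<ominus> ?y n)"
      using x by (simp add: cnorm_mult)
    also have "\<dots> \<le> ?r * (?r ^ n * (1 / (1 - ?r)))"
      using Suc r by (intro mult_left_mono)
    finally show ?case by (simp add: mult.assoc)
  qed
  have "\<exists>l\<in>carrier A. (\<lambda>n. cnorm A (?y n \<ominus> l)) \<longlonglongrightarrow> 0"
  proof (rule complete)
    show "?y n \<in> carrier A" for n using x by simp
    fix e :: real assume "0 < e"
    have "(\<lambda>n. ?r ^ n * (1 / (1 - ?r))) \<longlonglongrightarrow> 0 * (1 / (1 - ?r))"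
      using r lt by (intro tendsto_intros LIMSEQ_power_zero) simp
    then have "eventually (\<lambda>n. ?r ^ n * (1 / (1 - ?r)) < e / 2) sequentially"
      using \<open>0 < e\<close> by (intro order_tendstoD(2)) auto
    then obtain N where N: "?r ^ N * (1 / (1 - ?r)) < e / 2" by (auto simp: eventually_sequentially)
    have "cnorm A (?y m \<ominus> ?y n) < e" if "m \<ge> N" "n \<ge> N" for m n
    proof -
      have "cnorm A (?y k \<ominus> ?y N) < e / 2" if "k \<ge> N" for k
        using order.strict_trans1[OF diff[of N "k - N"] N] that by (simp del: neumann.simps)
      from this[OF \<open>m \<ge> N\<close>] this[OF \<open>n \<ge> N\<close>] show ?thesis
        using cnorm_triangle[of "?y m" "?y N" "?y n"] cnorm_minus_commute[of "?y N" "?y n"] x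
        by (simp del: neumann.simps)
    qed
    then show "\<exists>N. \<forall>m\<ge>N. \<forall>n\<ge>N. cnorm A (?y m \<ominus> ?y n) < e" by blast
  qed
  then obtain y where y: "y \<in> carrier A" "(\<lambda>n. cnorm A (?y n \<ominus> y)) \<longlonglongrightarrow> 0" by blast
  have "y = \<one> \<oplus> x \<otimes> y"
  proof (rule limit_unique[of _ _ "\<lambda>n. ?y (Suc n)"])
    show "(\<lambda>n. cnorm A (?y (Suc n) \<ominus> y)) \<longlonglongrightarrow> 0"
      using y(2) by (rule LIMSEQ_Suc)
    have eq: "?y (Suc n) \<ominus> (\<one> \<oplus> x \<otimes> y) = x \<otimes> (?y n \<ominus> y)" for n
      using x y(1) by (simp add: mult_minus_right add_minus_cancel_left)
    have "(\<lambda>n. ?r * cnorm A (?y n \<ominus> y)) \<longlonglongrightarrow> ?r * 0"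
      by (intro tendsto_intros y(2))
    then have lim: "(\<lambda>n. ?r * cnorm A (?y n \<ominus> y)) \<longlonglongrightarrow> 0" by simp
    show "(\<lambda>n. cnorm A (?y (Suc n) \<ominus> (\<one> \<oplus> x \<otimes> y))) \<longlonglongrightarrow> 0"
      unfolding eq by (rule real_tendsto_sandwich[OF _ _ tendsto_const lim])
        (use x y(1) in \<open>simp_all add: cnorm_nonneg cnorm_mult\<close>)
  qed (use x y(1) in auto)
  then show ?thesis using y(1) that by blast
qed

lemma character_simps:
  assumes "\<phi> \<in> star_hom A complex_cstar"
  shows "\<phi> \<one> = 1"
    and "\<lbrakk>x \<in> carrier A; y \<in> carrier A\<rbrakk> \<Longrightarrow> \<phi> (x \<oplus> y) = \<phi> x + \<phi> y"
    and "\<lbrakk>x \<in> carrier A; y \<in> carrier A\<rbrakk> \<Longrightarrow> \<phi> (x \<otimes> y) = \<phi> x * \<phi> y"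
    and "x \<in> carrier A \<Longrightarrow> \<phi> (c \<odot> x) = c * \<phi> x"
    and "x \<in> carrier A \<Longrightarrow> \<phi> (star A x) = cnj (\<phi> x)"
  using assms by (auto simp: star_hom_def ring_hom_def)

text \<open>Otherwise \<open>x\<close> divided by \<open>\<phi> x\<close> has norm below 1 but value
  1 under \<open>\<phi>\<close>, and applying \<open>\<phi>\<close> to the fixed point equation of
  its Neumann series gives \<open>\<phi> y = 1 + \<phi> y\<close>.\<close>

lemma character_le_cnorm:
  assumes \<phi>: "\<phi> \<in> star_hom A complex_cstar" and x: "x \<in> carrier A"
  shows "cmod (\<phi> x) \<le> cnorm A x"
proof (rule ccontr)
  note [simp] = character_simps[OF \<phi>]
  assume *: "\<not> cmod (\<phi> x) \<le> cnorm A x"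
  then have "\<phi> x \<noteq> 0" using cnorm_nonneg[OF x] by auto
  let ?z = "inverse (\<phi> x) \<odot> x"
  have "cnorm A ?z < 1"
    using * \<open>\<phi> x \<noteq> 0\<close> by (simp add: cnorm_smult x norm_inverse norm_divide field_simps)
  then obtain y where y: "y \<in> carrier A" "y = \<one> \<oplus> ?z \<otimes> y"
    using neumann_fixpoint[of ?z] x by auto
  have "\<phi> y = \<phi> (\<one> \<oplus> ?z \<otimes> y)" using y(2) by simp
  also have "\<dots> = 1 + \<phi> y"
    using x y(1) \<open>\<phi> x \<noteq> 0\<close> by simp
  finally show False by simp
qed

section \<open>Commutation, and the centre for a real parameter\<close>

text \<open>Commutation passes from the letters to words by induction, and to linear combinations by
  bilinearity of the product.\<close>

lemma commutes_with_free_eval: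
  assumes f: "\<And>g. f g \<in> carrier A" and c: "c \<in> carrier A"
    and gen: "\<And>g. c \<otimes> f g = f g \<otimes> c" "\<And>g. c \<otimes> star A (f g) = star A (f g) \<otimes> c"
  shows "c \<otimes> free_eval A f x = free_eval A f x \<otimes> c"
proof (induction x rule: free_alg_induct)
  case zero
  show ?case using c by (simp add: free_eval_zero[OF f])
next
  case (single w k)
  have letter: "c \<otimes> eval_letter A f l = eval_letter A f l \<otimes> c" for l
    by (cases l) (simp_all add: gen)
  have "c \<otimes> eval_word A f (Word u) = eval_word A f (Word u) \<otimes> c" for u
  proof (induction u)
    case (Cons l u)
    let ?l = "eval_letter A f l" and ?u = "eval_word A f (Word u)"
    have cl: "?l \<in> carrier A" "?u \<in> carrier A"
      using eval_letter_closed[of f, OF f] eval_word_closed[of f, OF f] by blast+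
    have "c \<otimes> (?l \<otimes> ?u) = ?l \<otimes> ?u \<otimes> c"
      using cl c letter[of l] Cons.IH m_assoc by metis
    then show ?case by simp
  qed (use c in simp)
  then have "c \<otimes> eval_word A f w = eval_word A f w \<otimes> c" by (cases w) simp
  then show ?case
    using c eval_word_closed[of f w, OF f]
    by (simp add: free_eval_single[OF f] smult_mult_left smult_mult_right)
next
  case (plus x y)
  then show ?case
    using c by (simp add: free_eval_add[OF f] free_eval_closed[OF f] l_distr r_distr)
qed

text \<open>The commutant of \<open>c\<close> is closed in norm, since the commutator with
  \<open>c\<close> is continuous.\<close>

lemma commutes_with_closure:
  assumes c: "c \<in> carrier A" and x: "x \<in> carrier A"
    and dense: "\<And>e. 0 < e \<Longrightarrow> \<exists>y\<in>carrier A. c \<otimes> y = y \<otimes> c \<and> cnorm A (x \<ominus> y) < e"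
  shows "c \<otimes> x = x \<otimes> c"
proof -
  have "cnorm A (c \<otimes> x \<ominus> x \<otimes> c) \<le> 0 + e" if "0 < e" for e
  proof -
    \<comment> \<open>The commutator with \<open>c\<close> changes by at most
      \<open>2 * cnorm A c\<close> times the distance of \<open>x\<close> and \<open>y\<close>;
      adding 1 keeps the divisor \<open>k\<close> positive when \<open>c\<close> is zero.\<close>
    define k where "k = 2 * cnorm A c + 1"
    have k: "0 < k" using cnorm_nonneg[OF c] by (simp add: k_def)
    obtain y where y: "y \<in> carrier A" "c \<otimes> y = y \<otimes> c" "cnorm A (x \<ominus> y) < e / k"
      using dense[of "e / k"] \<open>0 < e\<close> k by auto
    have "cnorm A (c \<otimes> x \<ominus> x \<otimes> c) \<le> cnorm A (c \<otimes> x \<ominus> c \<otimes> y) + cnorm A (y \<otimes> c \<ominus> x \<otimes> c)"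
      using cnorm_triangle[of "c \<otimes> x" "c \<otimes> y" "x \<otimes> c"] c x y by simp
    also have "\<dots> \<le> cnorm A c * cnorm A (x \<ominus> y) + cnorm A (x \<ominus> y) * cnorm A c"
      using c x y cnorm_mult[of c "x \<ominus> y"] cnorm_mult[of "y \<ominus> x" c] cnorm_minus_commute[of x y]
      by (intro add_mono) (simp_all add: mult_minus_left mult_minus_right)
    also have "\<dots> \<le> cnorm A (x \<ominus> y) * k"
      using cnorm_nonneg[of "x \<ominus> y"] x y by (simp add: k_def algebra_simps)
    also have "\<dots> \<le> e"
      using y(3) k by (simp add: field_simps)
    finally show ?thesis by simp
  qed
  then have "cnorm A (c \<otimes> x \<ominus> x \<otimes> c) \<le> 0" by (rule field_le_epsilon)
  then have "c \<otimes> x \<ominus> x \<otimes> c = \<zero>"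
    using cnorm_nonneg[of "c \<otimes> x \<ominus> x \<otimes> c"] cnorm_eq_0[of "c \<otimes> x \<ominus> x \<otimes> c"] c x
    by (simp only: m_closed minus_closed order_antisym)
  then show ?thesis using c x by (simp add: minus_eq_zero_iff)
qed

text \<open>Multiplying \<open>x \<otimes> d = d \<otimes> x\<close> by \<open>star A d\<close> on
  both sides shows that \<open>x\<close> commutes with \<open>star A d\<close>; now take adjoints.
  This supplies the adjoints of generators, about which the relations with \<open>D\<close> say
  nothing directly.\<close>

lemma commute_unitary_star:
  assumes "x \<in> carrier A" "d \<in> carrier A"
    and "x \<otimes> d = d \<otimes> x" "d \<otimes> star A d = \<one>" "star A d \<otimes> d = \<one>"
  shows "d \<otimes> star A x = star A x \<otimes> d"
proof -
  note sd = star_closed[OF assms(2)]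
  have "star A d \<otimes> x = star A d \<otimes> x \<otimes> (d \<otimes> star A d)"
    using assms sd by simp
  also have "\<dots> = star A d \<otimes> (x \<otimes> d) \<otimes> star A d"
    using assms(1,2) sd by (simp add: m_assoc)
  also have "\<dots> = star A d \<otimes> d \<otimes> x \<otimes> star A d"
    using assms(1-3) sd by (simp add: m_assoc)
  also have "\<dots> = x \<otimes> star A d"
    using assms sd by simp
  finally have "star A (star A d \<otimes> x) = star A (x \<otimes> star A d)" by simp
  then show ?thesis using assms(1,2) sd by (simp add: star_mult star_star)
qed

end

text \<open>For real \<open>q\<close> the twist in the relation between \<open>b\<close> and
  \<open>D\<close> is 1, so \<open>D\<close> commutes with all generators, with their adjoints
  because \<open>D\<close> is unitary, and density does the rest.\<close>

lemma gen_D_central: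
  assumes "q \<noteq> 0" and X: "X \<in> carrier (C_Uq2 (complex_of_real q))"
  defines "A \<equiv> C_Uq2 (complex_of_real q)" and "D \<equiv> universal_gen (Uq2_relators (complex_of_real q)) gen_D"
  shows "D \<otimes>\<^bsub>A\<^esub> X = X \<otimes>\<^bsub>A\<^esub> D"
proof -
  let ?R = "Uq2_relators (complex_of_real q)" and ?f = "universal_gen (Uq2_relators (complex_of_real q))"
  have q: "complex_of_real q \<noteq> 0" using assms(1) by simp
  interpret unital_cstar_algebra A unfolding A_def using q by (rule C_Uq2_cstar_algebra)
  have T: "Uq2_triple (complex_of_real q) A (?f gen_a) (?f gen_b) D"
    unfolding A_def D_def by (rule C_Uq2_triple[OF q])
  have f: "?f g \<in> carrier A" for g
    using T by (cases g) (auto simp: Uq2_triple_def D_def)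
  have D: "D \<in> carrier A" "D \<otimes>\<^bsub>A\<^esub> star A D = \<one>\<^bsub>A\<^esub>" "star A D \<otimes>\<^bsub>A\<^esub> D = \<one>\<^bsub>A\<^esub>"
    using T by (auto simp: Uq2_triple_def)
  have "(complex_of_real q)\<^sup>2 / complex_of_real ((cmod (complex_of_real q))\<^sup>2) = 1"
    using assms(1) by (simp flip: of_real_power)
  then have gen: "?f g \<otimes>\<^bsub>A\<^esub> D = D \<otimes>\<^bsub>A\<^esub> ?f g" for g
    using T D_def by (cases g) (auto simp: Uq2_triple_def scalar_one)
  show ?thesis
  proof (rule commutes_with_closure[OF D(1)])
    show "X \<in> carrier A" using X by (simp add: A_def)
    fix e :: real assume "0 < e"
    then obtain x where "cnorm A (X \<ominus>\<^bsub>A\<^esub> free_eval A ?f x) < e"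
      using C_Uq2_dense[OF q X] unfolding A_def by blast
    moreover have "D \<otimes>\<^bsub>A\<^esub> free_eval A ?f x = free_eval A ?f x \<otimes>\<^bsub>A\<^esub> D"
      by (rule commutes_with_free_eval[of ?f, OF f D(1) gen[symmetric] commute_unitary_star[OF f D(1) gen D(2,3)]])
    ultimately show "\<exists>y\<in>carrier A. D \<otimes>\<^bsub>A\<^esub> y = y \<otimes>\<^bsub>A\<^esub> D \<and> cnorm A (X \<ominus>\<^bsub>A\<^esub> y) < e"
      using free_eval_closed[of ?f, OF f] by blast
  qed
qed


section \<open>Actions of the free algebra on finitely supported vectors\<close>

definition finsupp :: "('j \<Rightarrow> complex) set" where
  "finsupp = {v. finite {j. v j \<noteq> 0}}"

text \<open>The sum runs over the support of \<open>v\<close> alone, so it is finite as soon as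
  \<open>v\<close> is in \<open>finsupp\<close>, and the rules for the second argument hold without
  side conditions.\<close>

definition inner_prod :: "('j \<Rightarrow> complex) \<Rightarrow> ('j \<Rightarrow> complex) \<Rightarrow> complex" where
  "inner_prod v w = (\<Sum>j | v j \<noteq> 0. v j * cnj (w j))"

definition norm2 :: "('j \<Rightarrow> complex) \<Rightarrow> real" where
  "norm2 v = L2_set (\<lambda>j. cmod (v j)) {j. v j \<noteq> 0}"

lemma inner_prod_superset:
  "\<lbrakk>finite S; {j. v j \<noteq> 0} \<subseteq> S\<rbrakk> \<Longrightarrow> inner_prod v w = (\<Sum>j\<in>S. v j * cnj (w j))"
  unfolding inner_prod_def by (rule sum.mono_neutral_left) auto

lemma norm2_superset:
  "\<lbrakk>finite S; {j. v j \<noteq> 0} \<subseteq> S\<rbrakk> \<Longrightarrow> norm2 v = L2_set (\<lambda>j. cmod (v j)) S"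
  unfolding norm2_def L2_set_def by (intro arg_cong[where f = sqrt] sum.mono_neutral_left) auto

lemma norm2_nonneg [simp]: "0 \<le> norm2 v"
  by (simp add: norm2_def)

lemma finsupp_subset: "\<lbrakk>finite S; \<And>j. j \<notin> S \<Longrightarrow> v j = 0\<rbrakk> \<Longrightarrow> v \<in> finsupp"
  by (auto simp: finsupp_def elim!: finite_subset[rotated])

lemma finsupp_zero [simp]: "(\<lambda>j. 0) \<in> finsupp"
  by (simp add: finsupp_def)

lemma finsupp_add [intro]: "\<lbrakk>v \<in> finsupp; w \<in> finsupp\<rbrakk> \<Longrightarrow> (\<lambda>j. v j + w j) \<in> finsupp"
  by (rule finsupp_subset[of "{j. v j \<noteq> 0} \<union> {j. w j \<noteq> 0}"]) (auto simp: finsupp_def)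

lemma finsupp_scale [intro]: "v \<in> finsupp \<Longrightarrow> (\<lambda>j. c * v j) \<in> finsupp"
  by (rule finsupp_subset[of "{j. v j \<noteq> 0}"]) (auto simp: finsupp_def)

lemma finsupp_minus [intro]:
  assumes "v \<in> finsupp" "w \<in> finsupp"
  shows "(\<lambda>j. v j - w j) \<in> finsupp"
  using finsupp_add[OF assms(1) finsupp_scale[OF assms(2), of "- 1"]] by simp

lemma inner_prod_commute:
  assumes "v \<in> finsupp" "w \<in> finsupp"
  shows "inner_prod v w = cnj (inner_prod w v)"
proof -
  let ?S = "{j. v j \<noteq> 0} \<union> {j. w j \<noteq> 0}"
  have "finite ?S" using assms by (simp add: finsupp_def)
  then show ?thesis
    by (simp add: inner_prod_superset[of ?S] cnj_sum mult.commute)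
qed

lemma inner_prod_add_left:
  assumes "v \<in> finsupp" "w \<in> finsupp"
  shows "inner_prod (\<lambda>j. v j + w j) u = inner_prod v u + inner_prod w u"
proof -
  let ?S = "{j. v j \<noteq> 0} \<union> {j. w j \<noteq> 0}"
  have "finite ?S" "{j. v j + w j \<noteq> 0} \<subseteq> ?S" using assms by (auto simp: finsupp_def)
  then show ?thesis
    by (simp add: inner_prod_superset[of ?S] sum.distrib distrib_right)
qed

lemma inner_prod_scale_left: "inner_prod (\<lambda>j. c * v j) u = c * inner_prod v u"
  by (cases "c = 0") (simp_all add: inner_prod_def sum_distrib_left mult.assoc)

lemma inner_prod_add_right: "inner_prod u (\<lambda>j. v j + w j) = inner_prod u v + inner_prod u w"
  by (simp add: inner_prod_def sum.distrib distrib_left)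

lemma inner_prod_scale_right: "inner_prod u (\<lambda>j. c * v j) = cnj c * inner_prod u v"
  by (simp add: inner_prod_def sum_distrib_left mult_ac)

lemma inner_prod_self: "inner_prod v v = of_real ((norm2 v)\<^sup>2)"
  by (simp add: inner_prod_def norm2_def L2_set_def sum_nonneg flip: complex_norm_square)

text \<open>Cauchy-Schwarz, read off from finite sums over the union of the two supports.\<close>

lemma inner_prod_le:
  assumes "v \<in> finsupp" "w \<in> finsupp"
  shows "cmod (inner_prod v w) \<le> norm2 v * norm2 w"
proof -
  let ?S = "{j. v j \<noteq> 0} \<union> {j. w j \<noteq> 0}"
  have S: "finite ?S" using assms by (auto simp: finsupp_def)
  have "cmod (inner_prod v w) \<le> (\<Sum>j\<in>?S. \<bar>cmod (v j)\<bar> * \<bar>cmod (w j)\<bar>)"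
    using S by (simp add: inner_prod_superset[of ?S] sum_norm_le norm_mult)
  also have "\<dots> \<le> norm2 v * norm2 w"
    using S by (simp only: norm2_superset[of ?S] L2_set_mult_ineq Un_upper1 Un_upper2)
  finally show ?thesis .
qed

lemma norm2_add:
  assumes "v \<in> finsupp" "w \<in> finsupp"
  shows "norm2 (\<lambda>j. v j + w j) \<le> norm2 v + norm2 w"
proof -
  let ?S = "{j. v j \<noteq> 0} \<union> {j. w j \<noteq> 0}"
  have S: "finite ?S" "{j. v j + w j \<noteq> 0} \<subseteq> ?S" using assms by (auto simp: finsupp_def)
  have "norm2 (\<lambda>j. v j + w j) \<le> L2_set (\<lambda>j. cmod (v j) + cmod (w j)) ?S"
    using S by (auto simp: norm2_superset[of ?S] intro!: L2_set_mono norm_triangle_ineq)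
  also have "\<dots> \<le> norm2 v + norm2 w"
    using S by (simp only: norm2_superset[of ?S] L2_set_triangle_ineq Un_upper1 Un_upper2)
  finally show ?thesis .
qed

lemma norm2_scale: "norm2 (\<lambda>j. c * v j) = cmod c * norm2 v"
  by (cases "c = 0") (simp_all add: norm2_def norm_mult L2_set_right_distrib)

lemma norm2_eq_0: "v \<in> finsupp \<Longrightarrow> norm2 v = 0 \<longleftrightarrow> v = (\<lambda>j. 0)"
  by (auto simp: norm2_def L2_set_eq_0_iff finsupp_def)

lemma norm_component_le:
  assumes "v \<in> finsupp"
  shows "cmod (v j) \<le> norm2 v"
proof (cases "v j = 0")
  case False
  then show ?thesis
    using assms member_le_L2_set[of "{j. v j \<noteq> 0}" j "\<lambda>j. cmod (v j)"] by (simp add: norm2_def finsupp_def)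
qed simp

section \<open>Star-actions of the free algebra\<close>

text \<open>A bounded *-representation on an uncompleted space: \<open>T_adjoint\<close> postulates
  the adjoint of each letter, which boundedness alone would yield only after completion.\<close>

locale star_action =
  fixes T :: "'g letter \<Rightarrow> ('j \<Rightarrow> complex) \<Rightarrow> 'j \<Rightarrow> complex"
  assumes T_add: "T l (\<lambda>j. v j + w j) = (\<lambda>j. T l v j + T l w j)"
    and T_scale: "T l (\<lambda>j. c * v j) = (\<lambda>j. c * T l v j)"
    and T_finsupp: "v \<in> finsupp \<Longrightarrow> T l v \<in> finsupp"
    and T_adjoint: "\<lbrakk>v \<in> finsupp; w \<in> finsupp\<rbrakk> \<Longrightarrow> inner_prod (T l v) w = inner_prod v (T (adj_letter l) w)"
    and T_bounded: "\<exists>C. \<forall>v\<in>finsupp. norm2 (T l v) \<le> C * norm2 v"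
begin

fun act_word :: "'g word \<Rightarrow> ('j \<Rightarrow> complex) \<Rightarrow> 'j \<Rightarrow> complex" where
  "act_word (Word u) v = foldr T u v"

definition act :: "'g free_alg \<Rightarrow> ('j \<Rightarrow> complex) \<Rightarrow> 'j \<Rightarrow> complex" where
  "act x v = (\<lambda>j. \<Sum>w\<in>Poly_Mapping.keys x. Poly_Mapping.lookup x w * act_word w v j)"

lemma act_word_add: "act_word u (\<lambda>j. v j + w j) = (\<lambda>j. act_word u v j + act_word u w j)"
proof (cases u)
  case (Word l)
  have "foldr T l (\<lambda>j. v j + w j) = (\<lambda>j. foldr T l v j + foldr T l w j)"
    by (induction l) (simp_all add: T_add)
  then show ?thesis by (simp add: Word)
qed

lemma act_word_scale: "act_word u (\<lambda>j. c * v j) = (\<lambda>j. c * act_word u v j)"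
proof (cases u)
  case (Word l)
  have "foldr T l (\<lambda>j. c * v j) = (\<lambda>j. c * foldr T l v j)"
    by (induction l) (simp_all add: T_scale)
  then show ?thesis by (simp add: Word)
qed

lemma act_word_zero [simp]: "act_word 0 v = v"
  by (simp add: zero_word_def)

lemma act_word_plus: "act_word (u + w) v = act_word u (act_word w v)"
  by (cases u; cases w) simp

lemma act_word_finsupp: "v \<in> finsupp \<Longrightarrow> act_word u v \<in> finsupp"
proof (cases u)
  case (Word l)
  show "v \<in> finsupp \<Longrightarrow> act_word u v \<in> finsupp"
    unfolding Word act_word.simps by (induction l) (simp_all add: T_finsupp)
qed

lemma act_superset:
  assumes "finite S" "Poly_Mapping.keys x \<subseteq> S"
  shows "act x v j = (\<Sum>w\<in>S. Poly_Mapping.lookup x w * act_word w v j)"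
  unfolding act_def using assms by (intro sum.mono_neutral_left) (auto simp: in_keys_iff)

lemma act_zero [simp]: "act 0 v = (\<lambda>j. 0)"
  by (simp add: act_def)

lemma act_single: "act (Poly_Mapping.single w c) v = (\<lambda>j. c * act_word w v j)"
  by (cases "c = 0") (simp_all add: act_def)

lemma act_add: "act (x + y) v = (\<lambda>j. act x v j + act y v j)"
proof
  fix j
  let ?S = "Poly_Mapping.keys x \<union> Poly_Mapping.keys y"
  show "act (x + y) v j = act x v j + act y v j"
    using keys_add[of x y]
    by (simp add: act_superset[of ?S] lookup_add distrib_right sum.distrib)
qed

lemma act_one [simp]: "act 1 v = v"
  using act_single[of 0 1 v] by simp

lemma act_fgen: "act (fgen g) v = T (Gen g) v"
  by (simp add: act_single)

lemma act_fstar_fgen: "act (fstar (fgen g)) v = T (Adj g) v"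
  by (simp add: act_single)

lemma act_vector_add: "act x (\<lambda>j. v j + w j) = (\<lambda>j. act x v j + act x w j)"
  by (simp add: act_def act_word_add distrib_left sum.distrib)

lemma act_vector_scale: "act x (\<lambda>j. c * v j) = (\<lambda>j. c * act x v j)"
  by (simp add: act_def act_word_scale sum_distrib_left mult_ac)

lemma act_fconst: "act (fconst c) v = (\<lambda>j. c * v j)"
  by (simp add: act_single)

lemma act_mult: "act (x * y) v = act x (act y v)"
proof (induction x rule: free_alg_induct)
  case (single w c)
  have 0: "act_word w (\<lambda>j. 0) = (\<lambda>j. 0)"
    using act_word_scale[of w 0 "\<lambda>j. 0"] by simp
  show ?case
    by (induction y rule: free_alg_induct)
      (simp_all add: 0 mult_single act_single act_word_plus act_word_scale act_word_add
        act_add distrib_left mult_ac)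
qed (simp_all add: act_add distrib_right)

lemma act_uminus: "act (- x) v = (\<lambda>j. - act x v j)"
  using act_add[of "- x" x v] by (simp add: fun_eq_iff eq_neg_iff_add_eq_0)

lemma act_diff: "act (x - y) v = (\<lambda>j. act x v j - act y v j)"
  using act_add[of x "- y" v] by (simp add: act_uminus)

lemma act_finsupp: "v \<in> finsupp \<Longrightarrow> act x v \<in> finsupp"
  by (induction x rule: free_alg_induct)
    (auto simp: act_single act_add act_word_finsupp)

lemma act_word_adjoint:
  assumes "v \<in> finsupp" "w \<in> finsupp"
  shows "inner_prod (act_word u v) w = inner_prod v (act_word (adj_word u) w)"
proof (cases u)
  case (Word l)
  have "inner_prod (foldr T l v) w = inner_prod v (foldr T (rev (map adj_letter l)) w)"
    using assms(2)
  proof (induction l arbitrary: w)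
    case (Cons a l)
    have "foldr T l v \<in> finsupp" using act_word_finsupp[OF assms(1), of "Word l"] by simp
    then show ?case
      using Cons by (simp add: T_adjoint T_finsupp)
  qed simp
  then show ?thesis by (simp add: Word)
qed

lemma act_adjoint:
  assumes "v \<in> finsupp" "w \<in> finsupp"
  shows "inner_prod (act x v) w = inner_prod v (act (fstar x) w)"
proof (induction x rule: free_alg_induct)
  case zero
  show ?case by (simp add: inner_prod_def)
next
  case (single u c)
  show ?case
    using assms by (simp add: act_single inner_prod_scale_left inner_prod_scale_right act_word_adjoint)
next
  case (plus x y)
  then show ?case
    using assms by (simp add: act_add inner_prod_add_left inner_prod_add_right act_finsupp)
qed

lemma act_bounded: "\<exists>C\<ge>0. \<forall>v\<in>finsupp. norm2 (act x v) \<le> C * norm2 v"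
proof (induction x rule: free_alg_induct)
  case zero
  show ?case by (intro exI[of _ 0]) (simp add: norm2_def)
next
  case (single w c)
  have "\<exists>C\<ge>0. \<forall>v\<in>finsupp. norm2 (foldr T u v) \<le> C * norm2 v" for u
  proof (induction u)
    case Nil
    show ?case by (intro exI[of _ 1]) simp
  next
    case (Cons l u)
    then obtain C where C: "0 \<le> C" "\<And>v. v \<in> finsupp \<Longrightarrow> norm2 (foldr T u v) \<le> C * norm2 v" by blast
    obtain D where D: "\<And>v. v \<in> finsupp \<Longrightarrow> norm2 (T l v) \<le> D * norm2 v" using T_bounded by blast
    have "norm2 (foldr T (l # u) v) \<le> (\<bar>D\<bar> * C) * norm2 v" if v: "v \<in> finsupp" for v
    proof -
      have "foldr T u v \<in> finsupp" using act_word_finsupp[OF v, of "Word u"] by simp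
      then have "norm2 (foldr T (l # u) v) \<le> D * norm2 (foldr T u v)" using D by simp
      also have "\<dots> \<le> \<bar>D\<bar> * (C * norm2 v)"
        using C v by (intro mult_mono) auto
      finally show ?thesis by (simp add: mult.assoc)
    qed
    then show ?case using C(1) by (intro exI[of _ "\<bar>D\<bar> * C"]) simp
  qed
  moreover obtain u where "w = Word u" by (cases w)
  ultimately obtain C where C: "0 \<le> C" "\<And>v. v \<in> finsupp \<Longrightarrow> norm2 (act_word w v) \<le> C * norm2 v"
    by (metis act_word.simps)
  then show ?case
    by (intro exI[of _ "cmod c * C"]) (simp add: act_single norm2_scale mult.assoc mult_left_mono)
next
  case (plus x y)
  then obtain C D where C: "0 \<le> C" "\<And>v. v \<in> finsupp \<Longrightarrow> norm2 (act x v) \<le> C * norm2 v"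
    and D: "0 \<le> D" "\<And>v. v \<in> finsupp \<Longrightarrow> norm2 (act y v) \<le> D * norm2 v" by blast
  have "norm2 (act (x + y) v) \<le> (C + D) * norm2 v" if v: "v \<in> finsupp" for v
    using norm2_add[OF act_finsupp[OF v] act_finsupp[OF v], of x y] C(2)[OF v] D(2)[OF v]
    by (simp add: act_add distrib_right)
  then show ?case using C(1) D(1) by (intro exI[of _ "C + D"]) simp
qed

section \<open>The operator norm as a C*-seminorm\<close>

definition opnorm :: "'g free_alg \<Rightarrow> real" where
  "opnorm x = (SUP v\<in>{v \<in> finsupp. norm2 v \<le> 1}. norm2 (act x v))"

lemma unit_ball_zero: "(\<lambda>j. 0) \<in> {v \<in> finsupp. norm2 v \<le> 1}"
  by (simp add: norm2_def)

lemma unit_ball_nonempty: "{v \<in> finsupp. norm2 v \<le> 1} \<noteq> {}"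
  using unit_ball_zero by (rule ex_in_conv[THEN iffD1, OF exI])

lemma opnorm_bdd: "bdd_above ((\<lambda>v. norm2 (act x v)) ` {v \<in> finsupp. norm2 v \<le> 1})"
proof -
  obtain C where C: "0 \<le> C" "\<forall>v\<in>finsupp. norm2 (act x v) \<le> C * norm2 v" using act_bounded by blast
  have "norm2 (act x v) \<le> C" if "v \<in> finsupp" "norm2 v \<le> 1" for v
    using C that by (meson mult_left_le order.trans)
  then show ?thesis by (intro bdd_aboveI[of _ C]) auto
qed

lemma opnorm_nonneg: "0 \<le> opnorm x"
  unfolding opnorm_def
  by (rule cSUP_upper2[OF opnorm_bdd unit_ball_zero norm2_nonneg])

lemma opnorm_bound:
  assumes v: "v \<in> finsupp"
  shows "norm2 (act x v) \<le> opnorm x * norm2 v"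
proof (cases "norm2 v = 0")
  case True
  then have "v = (\<lambda>j. 0)" using v norm2_eq_0 by blast
  then have "act x v = (\<lambda>j. 0)" using act_vector_scale[of x 0 v] by simp
  then show ?thesis using True by (simp add: norm2_def)
next
  case False
  let ?w = "\<lambda>j. complex_of_real (inverse (norm2 v)) * v j"
  have "norm2 ?w = 1"
    unfolding norm2_scale using False by (simp add: norm_inverse)
  then have "norm2 (act x ?w) \<le> opnorm x"
    unfolding opnorm_def using v by (intro cSUP_upper opnorm_bdd) auto
  then have "inverse (norm2 v) * norm2 (act x v) \<le> opnorm x"
    unfolding act_vector_scale norm2_scale by (simp add: norm_inverse)
  moreover have "0 < norm2 v" using False norm2_nonneg[of v] by linarith
  ultimately show ?thesis by (simp add: field_simps)
qed

lemma opnorm_least: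
  assumes "0 \<le> C" "\<And>v. v \<in> finsupp \<Longrightarrow> norm2 (act x v) \<le> C * norm2 v"
  shows "opnorm x \<le> C"
  unfolding opnorm_def
proof (rule cSUP_least[OF unit_ball_nonempty])
  fix v :: "'j \<Rightarrow> complex" assume "v \<in> {v \<in> finsupp. norm2 v \<le> 1}"
  then show "norm2 (act x v) \<le> C"
    using assms(2)[of v] mult_left_le[of "norm2 v" C] assms(1) by simp
qed

lemma opnorm_mult: "opnorm (x * y) \<le> opnorm x * opnorm y"
proof (rule opnorm_least)
  fix v :: "'j \<Rightarrow> complex" assume v: "v \<in> finsupp"
  have "norm2 (act (x * y) v) \<le> opnorm x * norm2 (act y v)"
    unfolding act_mult by (intro opnorm_bound act_finsupp v)
  also have "\<dots> \<le> opnorm x * (opnorm y * norm2 v)"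
    by (intro mult_left_mono opnorm_bound v opnorm_nonneg)
  finally show "norm2 (act (x * y) v) \<le> opnorm x * opnorm y * norm2 v" by (simp add: mult.assoc)
qed (simp add: opnorm_nonneg)

text \<open>The squared norm of \<open>act x v\<close> is the inner product of \<open>v\<close> with
  \<open>act (fstar x * x) v\<close>, which Cauchy-Schwarz bounds by
  \<open>opnorm (fstar x * x)\<close> times the squared norm of \<open>v\<close>.\<close>

lemma opnorm_square_le: "(opnorm x)\<^sup>2 \<le> opnorm (fstar x * x)"
proof -
  have "opnorm x \<le> sqrt (opnorm (fstar x * x))"
  proof (rule opnorm_least)
    fix v :: "'j \<Rightarrow> complex" assume v: "v \<in> finsupp"
    have "complex_of_real ((norm2 (act x v))\<^sup>2) = inner_prod v (act (fstar x * x) v)"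
      unfolding act_mult inner_prod_self[symmetric] by (rule act_adjoint[OF v act_finsupp[OF v]])
    then have "(norm2 (act x v))\<^sup>2 = cmod (inner_prod v (act (fstar x * x) v))"
      by (metis abs_of_nonneg norm_of_real zero_le_power2)
    also have "\<dots> \<le> norm2 v * norm2 (act (fstar x * x) v)"
      by (intro inner_prod_le act_finsupp v)
    also have "\<dots> \<le> norm2 v * (opnorm (fstar x * x) * norm2 v)"
      by (intro mult_left_mono opnorm_bound v norm2_nonneg)
    also have "\<dots> = (sqrt (opnorm (fstar x * x)) * norm2 v)\<^sup>2"
      by (simp add: power_mult_distrib opnorm_nonneg power2_eq_square[of "norm2 v"])
    finally show "norm2 (act x v) \<le> sqrt (opnorm (fstar x * x)) * norm2 v"
      by (rule power2_le_imp_le) (simp add: opnorm_nonneg)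
  qed (simp add: opnorm_nonneg)
  then have "(opnorm x)\<^sup>2 \<le> (sqrt (opnorm (fstar x * x)))\<^sup>2"
    using opnorm_nonneg by (intro power_mono)
  then show ?thesis by (simp add: opnorm_nonneg)
qed

text \<open>Cancel one factor in \<open>opnorm x * opnorm x \<le> opnorm (fstar x * x) \<le> opnorm
  (fstar x) * opnorm x\<close>.\<close>

lemma opnorm_fstar_le: "opnorm x \<le> opnorm (fstar x)"
proof (cases "opnorm x = 0")
  case False
  then have "0 < opnorm x" using opnorm_nonneg[of x] by simp
  moreover have "opnorm x * opnorm x \<le> opnorm (fstar x) * opnorm x"
    using opnorm_square_le[of x] opnorm_mult[of "fstar x" x] by (simp add: power2_eq_square)
  ultimately show ?thesis by simp
qed (simp add: opnorm_nonneg)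

lemma opnorm_cstar_seminorm: "cstar_seminorm opnorm"
proof
  fix x y :: "'g free_alg" and c
  show "0 \<le> opnorm x" by (rule opnorm_nonneg)
  show "opnorm (x + y) \<le> opnorm x + opnorm y"
  proof (rule opnorm_least)
    fix v :: "'j \<Rightarrow> complex" assume v: "v \<in> finsupp"
    show "norm2 (act (x + y) v) \<le> (opnorm x + opnorm y) * norm2 v"
      using norm2_add[OF act_finsupp[OF v] act_finsupp[OF v], of x y]
        opnorm_bound[OF v, of x] opnorm_bound[OF v, of y]
      by (simp add: act_add distrib_right)
  qed (simp add: opnorm_nonneg)
  have scale_le: "opnorm (fconst c * x) \<le> cmod c * opnorm x" for c x
  proof (rule opnorm_least)
    fix v :: "'j \<Rightarrow> complex" assume "v \<in> finsupp"
    then show "norm2 (act (fconst c * x) v) \<le> cmod c * opnorm x * norm2 v"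
      by (simp add: act_mult act_fconst norm2_scale mult.assoc mult_left_mono opnorm_bound)
  qed (simp add: opnorm_nonneg)
  show "opnorm (fconst c * x) = cmod c * opnorm x"
  proof (cases "c = 0")
    case True
    then show ?thesis using scale_le[of 0 x] opnorm_nonneg[of 0] by simp
  next
    case False
    \<comment> \<open>Scaling back by the inverse turns the inequality into an equality.\<close>
    have "opnorm (fconst (inverse c) * (fconst c * x)) \<le> cmod (inverse c) * opnorm (fconst c * x)"
      by (rule scale_le)
    also have "fconst (inverse c) * (fconst c * x) = x"
      using False by (intro fconst_cancel) simp
    finally show ?thesis
      using False scale_le[of c x] by (simp add: norm_inverse norm_divide field_simps)
  qed
  show "opnorm (x * y) \<le> opnorm x * opnorm y" by (rule opnorm_mult)
  have "opnorm (fstar x) = opnorm x"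
    using opnorm_fstar_le[of x] opnorm_fstar_le[of "fstar x"] by simp
  then show "opnorm (fstar x * x) = (opnorm x)\<^sup>2"
    using opnorm_square_le[of x] opnorm_mult[of "fstar x" x] by (simp add: power2_eq_square)
qed

text \<open>This places \<open>opnorm\<close> below a bounded universal seminorm, so that Cauchy
  sequences representing elements of the universal algebra stay Cauchy for the action.\<close>

lemma opnorm_relator_seminorm:
  assumes "\<And>r v. \<lbrakk>r \<in> R; v \<in> finsupp\<rbrakk> \<Longrightarrow> act r v = (\<lambda>j. 0)"
  shows "opnorm \<in> relator_seminorms R"
proof -
  have "opnorm r = 0" if "r \<in> R" for r
    using opnorm_nonneg[of r] opnorm_least[of 0 r] assms[OF that] by (simp add: norm2_def)
  then show ?thesis using opnorm_cstar_seminorm by (simp add: relator_seminorms_def)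
qed

end

section \<open>Matrix entries and approximate eigenvectors\<close>

definition basis :: "'j \<Rightarrow> 'j \<Rightarrow> complex" where
  "basis j = (\<lambda>k. if k = j then 1 else 0)"

lemma basis_finsupp [simp]: "basis j \<in> finsupp"
  by (rule finsupp_subset[of "{j}"]) (auto simp: basis_def)

lemma norm2_basis [simp]: "norm2 (basis j) = 1"
  by (simp add: norm2_superset[of "{j}"] basis_def)

context star_action
begin

text \<open>Reduces limits of \<open>act x v\<close> to limits of matrix entries, as only finitely
  many columns enter.\<close>

lemma act_basis_expansion:
  assumes "v \<in> finsupp"
  shows "act x v k = (\<Sum>j | v j \<noteq> 0. v j * act x (basis j) k)"
proof -
  have S: "finite S \<Longrightarrow> act x (\<lambda>k. \<Sum>j\<in>S. v j * basis j k) = (\<lambda>k. \<Sum>j\<in>S. v j * act x (basis j) k)" for S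
  proof (induction S rule: finite_induct)
    case empty
    show ?case using act_vector_scale[of x 0 "\<lambda>j. 0"] by simp
  next
    case (insert a S)
    then show ?case by (simp add: act_vector_add act_vector_scale)
  qed
  have fin: "finite {j. v j \<noteq> 0}" using assms by (simp add: finsupp_def)
  have "v = (\<lambda>k. \<Sum>j | v j \<noteq> 0. v j * basis j k)"
  proof
    fix k
    have "(\<Sum>j | v j \<noteq> 0. v j * basis j k) = (\<Sum>j | v j \<noteq> 0. if j = k then v k else 0)"
      by (intro sum.cong) (auto simp: basis_def)
    then show "v k = (\<Sum>j | v j \<noteq> 0. v j * basis j k)" using fin by simp
  qed
  then show ?thesis using S[OF fin] by (metis (no_types, lifting))
qed

text \<open>Norms of vectors are lower semicontinuous under pointwise convergence, so an
  entrywise limit of a Cauchy sequence is a limit in norm.\<close>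

lemma opnorm_tendsto_scalar:
  assumes cauchy: "x \<in> cauchy_seqs opnorm"
    and entries: "\<And>j k. (\<lambda>n. act (x n) (basis j) k) \<longlonglongrightarrow> lam * basis j k"
  shows "(\<lambda>n. opnorm (x n - fconst lam)) \<longlonglongrightarrow> 0"
proof (rule LIMSEQ_I)
  fix e :: real assume "0 < e"
  then have "0 < e / 2" by simp
  from cstar_seminorm.cauchyD[OF opnorm_cstar_seminorm cauchy this]
  obtain N where N: "\<And>m n. m \<ge> N \<Longrightarrow> n \<ge> N \<Longrightarrow> opnorm (x m - x n) < e / 2" by blast
  have "opnorm (x n - fconst lam) \<le> e / 2" if n: "n \<ge> N" for n
  proof (rule opnorm_least)
    fix v :: "'j \<Rightarrow> complex" assume v: "v \<in> finsupp"
    let ?w = "act (x n - fconst lam) v"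
    let ?S = "{k. ?w k \<noteq> 0}"
    have S: "finite ?S" using act_finsupp[OF v] by (simp add: finsupp_def)
    have lim: "(\<lambda>m. act (x m) v k) \<longlonglongrightarrow> lam * v k" for k
    proof -
      have "(\<lambda>m. act (x m) v k) \<longlonglongrightarrow> (\<Sum>j | v j \<noteq> 0. v j * (lam * basis j k))"
        unfolding act_basis_expansion[OF v] by (intro tendsto_intros entries)
      also have "(\<Sum>j | v j \<noteq> 0. v j * (lam * basis j k)) = (\<Sum>j | v j \<noteq> 0. if j = k then lam * v k else 0)"
        by (intro sum.cong) (auto simp: basis_def)
      also have "\<dots> = lam * v k" using v by (simp add: finsupp_def)
      finally show ?thesis .
    qed
    \<comment> \<open>For fixed \<open>n\<close> the vector \<open>?w\<close> lives on the finite
      set \<open>?S\<close>, and there the limit in \<open>m\<close> may be taken inside the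
      sum.\<close>
    have "L2_set (\<lambda>k. cmod (act (x n) v k - act (x m) v k)) ?S \<le> e / 2 * norm2 v" if m: "m \<ge> N" for m
    proof -
      let ?u = "act (x n - x m) v"
      have u: "finite {k. ?u k \<noteq> 0}" using act_finsupp[OF v] by (simp add: finsupp_def)
      have "L2_set (\<lambda>k. cmod (?u k)) ?S \<le> L2_set (\<lambda>k. cmod (?u k)) (?S \<union> {k. ?u k \<noteq> 0})"
        unfolding L2_set_def using S u by (intro real_sqrt_le_mono sum_mono2) auto
      also have "\<dots> = norm2 ?u" using S u by (intro norm2_superset[symmetric]) auto
      also have "\<dots> \<le> opnorm (x n - x m) * norm2 v" by (rule opnorm_bound[OF v])
      also have "\<dots> \<le> e / 2 * norm2 v" using N[OF n m] by (intro mult_right_mono) auto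
      finally show ?thesis by (simp add: act_diff)
    qed
    moreover have "(\<lambda>m. L2_set (\<lambda>k. cmod (act (x n) v k - act (x m) v k)) ?S)
        \<longlonglongrightarrow> L2_set (\<lambda>k. cmod (act (x n) v k - lam * v k)) ?S"
      unfolding L2_set_def by (intro tendsto_intros lim)
    ultimately have "L2_set (\<lambda>k. cmod (act (x n) v k - lam * v k)) ?S \<le> e / 2 * norm2 v"
      by (intro LIMSEQ_le_const2[of _ _ "e / 2 * norm2 v"]) blast+
    then show "norm2 ?w \<le> e / 2 * norm2 v"
      unfolding norm2_def[of ?w] by (simp add: act_diff act_fconst)
  qed (use \<open>0 < e\<close> in simp)
  then show "\<exists>no. \<forall>n\<ge>no. norm (opnorm (x n - fconst lam) - 0) < e"
    using opnorm_nonneg \<open>0 < e\<close> by (intro exI[of _ N]) fastforce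
qed

text \<open>Approximate joint eigenvectors of the letters are approximate eigenvectors of every
  \<open>x\<close>, with eigenvalue \<open>\<phi> x\<close> by multiplicativity; being unit vectors,
  they bound \<open>\<phi> x\<close> up to a vanishing error.\<close>

lemma character_le_opnorm:
  assumes add: "\<And>x y. \<phi> (x + y) = \<phi> x + \<phi> y" and mult: "\<And>x y. \<phi> (x * y) = \<phi> x * \<phi> y"
    and fconst: "\<And>c. \<phi> (fconst c) = c"
    and \<xi>: "\<And>n. \<xi> n \<in> finsupp" "\<And>n. norm2 (\<xi> n) = 1"
    and eigen: "\<And>l. (\<lambda>n. norm2 (\<lambda>j. T l (\<xi> n) j - \<phi> (Poly_Mapping.single (Word [l]) 1) * \<xi> n j)) \<longlonglongrightarrow> 0"
  shows "cmod (\<phi> x) \<le> opnorm x"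
proof -
  let ?err = "\<lambda>x n j. act x (\<xi> n) j - \<phi> x * \<xi> n j"
  have err: "?err x n \<in> finsupp" for x n
    by (intro finsupp_minus finsupp_scale act_finsupp \<xi>)
  have \<phi>_zero: "\<phi> 0 = 0" using fconst[of 0] by simp
  have err_mult: "(\<lambda>n. norm2 (?err (x * y) n)) \<longlonglongrightarrow> 0"
    if "(\<lambda>n. norm2 (?err x n)) \<longlonglongrightarrow> 0" "(\<lambda>n. norm2 (?err y n)) \<longlonglongrightarrow> 0" for x y
  proof (rule real_tendsto_sandwich[OF _ _ tendsto_const])
    show "(\<lambda>n. opnorm x * norm2 (?err y n) + cmod (\<phi> y) * norm2 (?err x n)) \<longlonglongrightarrow> 0"
      using tendsto_add[OF tendsto_mult[OF tendsto_const that(2)] tendsto_mult[OF tendsto_const that(1)]]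
      by simp
    have "norm2 (?err (x * y) n) \<le> opnorm x * norm2 (?err y n) + cmod (\<phi> y) * norm2 (?err x n)" for n
    proof -
      \<comment> \<open>Insert \<open>\<phi> y\<close> times \<open>act x (\<xi> n)\<close>: the
        error of \<open>y\<close> is hit by \<open>x\<close>, the error of \<open>x\<close> is
        scaled by \<open>\<phi> y\<close>.\<close>
      have "?err (x * y) n = (\<lambda>j. act x (?err y n) j + \<phi> y * ?err x n j)"
        using act_vector_add[of x "act y (\<xi> n)" "\<lambda>j. - \<phi> y * \<xi> n j"] act_vector_scale[of x "- \<phi> y" "\<xi> n"]
        by (simp add: act_mult mult algebra_simps)
      then have "norm2 (?err (x * y) n) \<le> norm2 (act x (?err y n)) + norm2 (\<lambda>j. \<phi> y * ?err x n j)"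
        using norm2_add[OF act_finsupp[OF err, of x y n] finsupp_scale[OF err, of "\<phi> y" x n]] by simp
      then show ?thesis
        using opnorm_bound[OF err, of x y n] norm2_scale[of "\<phi> y" "?err x n"] by simp
    qed
    then show "\<forall>\<^sub>F n in sequentially. norm2 (?err (x * y) n)
        \<le> opnorm x * norm2 (?err y n) + cmod (\<phi> y) * norm2 (?err x n)" by simp
  qed simp
  have err_fconst: "(\<lambda>n. norm2 (?err (fconst c) n)) \<longlonglongrightarrow> 0" for c
    by (simp add: act_fconst fconst norm2_def)
  have err_word: "(\<lambda>n. norm2 (?err (Poly_Mapping.single (Word u) 1) n)) \<longlonglongrightarrow> 0" for u
  proof (induction u)
    case Nil
    show ?case using err_fconst[of 1] by (simp add: zero_word_def)
  next
    case (Cons l u)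
    have "(\<lambda>n. norm2 (?err (Poly_Mapping.single (Word [l]) 1) n)) \<longlonglongrightarrow> 0"
      using eigen[of l] by (simp add: act_single)
    from err_mult[OF this Cons.IH] show ?case by (simp add: mult_single)
  qed
  have "(\<lambda>n. norm2 (?err x n)) \<longlonglongrightarrow> 0"
  proof (induction x rule: free_alg_induct)
    case zero
    show ?case by (simp add: \<phi>_zero norm2_def)
  next
    case (single w c)
    obtain u where u: "w = Word u" by (cases w)
    show ?case
      using err_mult[OF err_fconst[of c] err_word[of u]] by (simp add: mult_single u)
  next
    case (plus x y)
    have "norm2 (?err (x + y) n) \<le> norm2 (?err x n) + norm2 (?err y n)" for n
      using norm2_add[OF err err, of x n y n] by (simp add: act_add add algebra_simps)
    moreover have lim: "(\<lambda>n. norm2 (?err x n) + norm2 (?err y n)) \<longlonglongrightarrow> 0"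
      using tendsto_add[OF plus] by simp
    ultimately show ?case
      by (intro real_tendsto_sandwich[OF _ _ tendsto_const lim] always_eventually allI norm2_nonneg)
  qed
  then have lim: "(\<lambda>n. opnorm x + norm2 (?err x n)) \<longlonglongrightarrow> opnorm x + 0"
    by (intro tendsto_intros)
  have "cmod (\<phi> x) \<le> opnorm x + norm2 (?err x n)" for n
  proof -
    have "(\<lambda>j. \<phi> x * \<xi> n j) = (\<lambda>j. act x (\<xi> n) j + - 1 * ?err x n j)" by simp
    then have "norm2 (\<lambda>j. \<phi> x * \<xi> n j) \<le> norm2 (act x (\<xi> n)) + norm2 (\<lambda>j. - 1 * ?err x n j)"
      using norm2_add[OF act_finsupp[OF \<xi>(1)] finsupp_scale[OF err], of x n "- 1" x n] by simp
    then show ?thesis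
      using opnorm_bound[OF \<xi>(1), of x n] unfolding norm2_scale by (simp add: \<xi>(2))
  qed
  then show ?thesis using LIMSEQ_le_const[OF lim, of "cmod (\<phi> x)"] by auto
qed

end

text \<open>The map \<open>f\<close> sends each position in \<open>w\<close> to the one in
  \<open>v\<close> from which its entry stems; weighted shifts and diagonal operators both have this
  form.\<close>

lemma finsupp_reindex:
  assumes "v \<in> finsupp" "inj_on f {j. w j \<noteq> 0}" "\<And>j. w j \<noteq> 0 \<Longrightarrow> v (f j) \<noteq> 0"
  shows "w \<in> finsupp"
proof -
  have "f ` {j. w j \<noteq> 0} \<subseteq> {j. v j \<noteq> 0}" using assms(3) by auto
  then have "finite (f ` {j. w j \<noteq> 0})"
    using assms(1) by (auto simp: finsupp_def intro: finite_subset)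
  then show ?thesis
    using finite_imageD[OF _ assms(2)] by (simp add: finsupp_def)
qed

lemma norm2_reindex_le:
  assumes v: "v \<in> finsupp" and f: "inj_on f {j. w j \<noteq> 0}" and le: "\<And>j. w j \<noteq> 0 \<Longrightarrow> cmod (w j) \<le> cmod (v (f j))"
  shows "norm2 w \<le> norm2 v"
proof -
  have fin: "finite {j. v j \<noteq> 0}" using v by (simp add: finsupp_def)
  have sub: "f ` {j. w j \<noteq> 0} \<subseteq> {j. v j \<noteq> 0}" using le by fastforce
  have "(\<Sum>j | w j \<noteq> 0. (cmod (w j))\<^sup>2) \<le> (\<Sum>j | w j \<noteq> 0. (cmod (v (f j)))\<^sup>2)"
    using le by (intro sum_mono power_mono) auto
  also have "\<dots> = (\<Sum>j\<in>f ` {j. w j \<noteq> 0}. (cmod (v j))\<^sup>2)"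
    by (simp add: sum.reindex[OF f])
  also have "\<dots> \<le> (\<Sum>j | v j \<noteq> 0. (cmod (v j))\<^sup>2)"
    using fin sub by (intro sum_mono2) auto
  finally show ?thesis by (simp add: norm2_def L2_set_def)
qed


section \<open>A representation with scalar commutant\<close>

text \<open>Meant for error vectors whose entries are tiny on the large set \<open>A\<close> and
  merely bounded on the comparatively small set \<open>B\<close>.\<close>

lemma norm2_le_two_level:
  assumes "finite A" "finite B" "0 \<le> \<alpha>" "0 \<le> \<beta>"
    and le: "\<And>j. (cmod (v j))\<^sup>2 \<le> (if j \<in> A then \<alpha> else 0) + (if j \<in> B then \<beta> else 0)"
  shows "(norm2 v)\<^sup>2 \<le> real (card A) * \<alpha> + real (card B) * \<beta>"
proof -
  have sub: "{j. v j \<noteq> 0} \<subseteq> A \<union> B"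
  proof
    fix j assume "j \<in> {j. v j \<noteq> 0}"
    then have "0 < (cmod (v j))\<^sup>2" by simp
    then show "j \<in> A \<union> B" using le[of j] by (auto split: if_splits)
  qed
  have "(norm2 v)\<^sup>2 = (\<Sum>j\<in>A \<union> B. (cmod (v j))\<^sup>2)"
    using assms(1,2) by (simp add: norm2_superset[OF _ sub] L2_set_def sum_nonneg)
  also have "\<dots> \<le> (\<Sum>j\<in>A \<union> B. (if j \<in> A then \<alpha> else 0) + (if j \<in> B then \<beta> else 0))"
    by (intro sum_mono le)
  also have "\<dots> = real (card A) * \<alpha> + real (card B) * \<beta>"
    using assms(1,2) by (simp add: sum.distrib sum.If_cases Int_absorb2 Un_Int_eq)
  finally show ?thesis .
qed

text \<open>By \<open>b a = q a b\<close> the weights of \<open>b\<close> get multiplied by \<open>q\<close> along \<open>a\<close>, and they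
  have to stay bounded, so \<open>a\<close> is a forward shift for \<open>cmod q < 1\<close> and a backward shift
  for \<open>cmod q > 1\<close>. The weight \<open>vac\<close> at \<open>(0, 0)\<close> is forced by \<open>a\<^sup>* e = 0\<close> respectively
  \<open>a e = 0\<close> for the vector \<open>e\<close> at \<open>(0, 0)\<close>.\<close>

locale Uq2_rep =
  fixes q :: complex
  assumes q_nonzero: "q \<noteq> 0" and q_modulus: "cmod q \<noteq> 1"
begin

section \<open>Weights and operators of the representation\<close>

text \<open>Ratio of the eigenvalues of \<open>b\<close> at successive levels; it is below 1 in
  modulus in both cases.\<close>

definition kappa :: complex where
  "kappa = (if cmod q < 1 then q else inverse q)"

definition vac :: complex where
  "vac = (if cmod q < 1 then 1 else inverse q)"

text \<open>The twist in the relation between \<open>b\<close> and \<open>D\<close>, equal to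
  \<open>cis (2 * Arg q)\<close>; if it is no root of unity, its powers separate the eigenvalues of
  \<open>b\<close> within a level.\<close>

definition rho :: complex where
  "rho = q\<^sup>2 / of_real ((cmod q)\<^sup>2)"

text \<open>Forced by the two sphere relations: with \<open>b\<close> of modulus
  \<open>cmod vac * cmod kappa ^ n\<close> at level \<open>n\<close>, the squared weight between the
  levels \<open>n\<close> and \<open>Suc n\<close> has to be
  \<open>1 - cmod kappa ^ (2 * Suc n)\<close>.\<close>

definition wt :: "nat \<Rightarrow> real" where
  "wt n = sqrt (1 - cmod kappa ^ (2 * Suc n))"

definition eig :: "nat \<times> int \<Rightarrow> complex" where
  "eig j = vac * kappa ^ fst j * rho powi snd j"

definition up :: "(nat \<times> int \<Rightarrow> complex) \<Rightarrow> nat \<times> int \<Rightarrow> complex" where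
  "up v = (\<lambda>(n, m). case n of 0 \<Rightarrow> 0 | Suc k \<Rightarrow> of_real (wt k) * v (k, m))"

definition down :: "(nat \<times> int \<Rightarrow> complex) \<Rightarrow> nat \<times> int \<Rightarrow> complex" where
  "down v = (\<lambda>(n, m). of_real (wt n) * v (Suc n, m))"

definition shift :: "int \<Rightarrow> (nat \<times> int \<Rightarrow> complex) \<Rightarrow> nat \<times> int \<Rightarrow> complex" where
  "shift k v = (\<lambda>(n, m). v (n, m - k))"

fun gen_act :: "Uq2_gen letter \<Rightarrow> (nat \<times> int \<Rightarrow> complex) \<Rightarrow> nat \<times> int \<Rightarrow> complex" where
  "gen_act (Gen gen_a) = (if cmod q < 1 then up else down)"
| "gen_act (Adj gen_a) = (if cmod q < 1 then down else up)"
| "gen_act (Gen gen_b) = (\<lambda>v j. eig j * v j)"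
| "gen_act (Adj gen_b) = (\<lambda>v j. cnj (eig j) * v j)"
| "gen_act (Gen gen_D) = shift 1"
| "gen_act (Adj gen_D) = shift (- 1)"

lemma up_simps [simp]: "up v (0, m) = 0" "up v (Suc n, m) = of_real (wt n) * v (n, m)"
  by (simp_all add: up_def)

lemma down_simp [simp]: "down v (n, m) = of_real (wt n) * v (Suc n, m)"
  by (simp add: down_def)

lemma shift_simp [simp]: "shift k v (n, m) = v (n, m - k)"
  by (simp add: shift_def)

lemma kappa: "0 < cmod kappa" "cmod kappa < 1"
  using q_nonzero q_modulus by (auto simp: kappa_def norm_inverse inverse_less_1_iff)

lemma vac: "vac \<noteq> 0" "cmod vac \<le> 1"
  using q_nonzero q_modulus by (auto simp: vac_def norm_inverse inverse_le_1_iff)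

lemma cmod_rho [simp]: "cmod rho = 1"
  using q_nonzero by (simp add: rho_def norm_divide norm_power)

lemma rho_nonzero [simp]: "rho \<noteq> 0"
  using cmod_rho by fastforce

lemma cmod_eig: "cmod (eig (n, m)) = cmod vac * cmod kappa ^ n"
  by (simp add: eig_def norm_mult norm_power norm_power_int)

lemma wt_bounds: "0 < wt n" "wt n \<le> 1" "(wt n)\<^sup>2 = 1 - cmod kappa ^ (2 * Suc n)"
proof -
  have "cmod kappa ^ (2 * Suc n) < 1"
    using kappa power_strict_decreasing[of 0 "2 * Suc n" "cmod kappa"] by simp
  then show "0 < wt n" "wt n \<le> 1" "(wt n)\<^sup>2 = 1 - cmod kappa ^ (2 * Suc n)"
    using kappa by (simp_all add: wt_def)
qed

text \<open>The nested shape is what two successive weighted shifts leave behind when a relator is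
  applied to a vector; \<open>eig_mult\<close> has it for the same reason.\<close>

lemma wt_mult: "complex_of_real (wt n) * (complex_of_real (wt n) * z) = (1 - of_real (cmod kappa ^ (2 * Suc n))) * z"
proof -
  have "complex_of_real (wt n) * complex_of_real (wt n) = 1 - of_real (cmod kappa ^ (2 * Suc n))"
    using arg_cong[OF wt_bounds(3)[of n], of complex_of_real]
    unfolding power2_eq_square of_real_mult of_real_diff of_real_1 .
  then show ?thesis by (metis mult.assoc)
qed

lemma eig_mult: "eig (n, m) * (cnj (eig (n, m)) * z) = of_real ((cmod vac)\<^sup>2 * cmod kappa ^ (2 * n)) * z"
  "cnj (eig (n, m)) * (eig (n, m) * z) = of_real ((cmod vac)\<^sup>2 * cmod kappa ^ (2 * n)) * z"
proof -
  have "eig (n, m) * cnj (eig (n, m)) = of_real ((cmod vac)\<^sup>2 * cmod kappa ^ (2 * n))"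
    unfolding complex_norm_square[symmetric] cmod_eig
    by (simp add: power_mult_distrib power_mult mult.commute flip: power_mult)
  then show "eig (n, m) * (cnj (eig (n, m)) * z) = of_real ((cmod vac)\<^sup>2 * cmod kappa ^ (2 * n)) * z"
    "cnj (eig (n, m)) * (eig (n, m) * z) = of_real ((cmod vac)\<^sup>2 * cmod kappa ^ (2 * n)) * z"
    by (metis mult.assoc mult.commute)+
qed

lemma eig_Suc: "eig (Suc n, m) = kappa * eig (n, m)"
  by (simp add: eig_def)

lemma eig_shift: "eig (n, m) = rho * eig (n, m - 1)"
  by (simp add: eig_def power_int_diff)

lemma up_down_adjoint:
  assumes "v \<in> finsupp"
  shows "inner_prod (up v) w = inner_prod v (down w)"
proof -
  let ?f = "\<lambda>(n :: nat, m :: int). (Suc n, m)"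
  have inj: "inj_on ?f {j. v j \<noteq> 0}" by (auto simp: inj_on_def)
  have "{j. up v j \<noteq> 0} \<subseteq> ?f ` {j. v j \<noteq> 0}"
  proof
    fix j assume "j \<in> {j. up v j \<noteq> 0}"
    then show "j \<in> ?f ` {j. v j \<noteq> 0}"
      by (cases j; cases "fst j") (auto intro!: image_eqI[of _ _ "(fst j - 1, snd j)"])
  qed
  then have "inner_prod (up v) w = (\<Sum>j\<in>?f ` {j. v j \<noteq> 0}. up v j * cnj (w j))"
    using assms by (intro inner_prod_superset) (auto simp: finsupp_def)
  also have "\<dots> = inner_prod v (down w)"
    unfolding inner_prod_def by (auto simp: sum.reindex[OF inj] intro!: sum.cong)
  finally show ?thesis .
qed

lemma shift_adjoint:
  assumes "v \<in> finsupp"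
  shows "inner_prod (shift k v) w = inner_prod v (shift (- k) w)"
proof -
  let ?f = "\<lambda>(n :: nat, m :: int). (n, m + k)"
  have inj: "inj_on ?f {j. v j \<noteq> 0}" by (auto simp: inj_on_def)
  have "{j. shift k v j \<noteq> 0} \<subseteq> ?f ` {j. v j \<noteq> 0}"
    by (auto intro!: image_eqI[of _ _ "(_, _ - k)"])
  then have "inner_prod (shift k v) w = (\<Sum>j\<in>?f ` {j. v j \<noteq> 0}. shift k v j * cnj (w j))"
    using assms by (intro inner_prod_superset) (auto simp: finsupp_def)
  also have "\<dots> = inner_prod v (shift (- k) w)"
    unfolding inner_prod_def by (auto simp: sum.reindex[OF inj] intro!: sum.cong)
  finally show ?thesis .
qed

lemma diag_adjoint:
  assumes "v \<in> finsupp"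
  shows "inner_prod (\<lambda>j. d j * v j) w = inner_prod v (\<lambda>j. cnj (d j) * w j)"
  using assms by (subst inner_prod_superset[of "{j. v j \<noteq> 0}"])
    (auto simp: finsupp_def inner_prod_def mult_ac)

text \<open>Every letter only moves entries injectively and multiplies them by numbers of modulus at
  most 1; this yields finite support and boundedness at once.\<close>

lemma gen_act_reindex:
  "\<exists>f. \<forall>v. inj_on f {j. gen_act l v j \<noteq> 0} \<and> (\<forall>j. gen_act l v j \<noteq> 0 \<longrightarrow> cmod (gen_act l v j) \<le> cmod (v (f j)))"
proof -
  let ?P = "\<lambda>T f. \<forall>v. inj_on f {j. T v j \<noteq> 0} \<and> (\<forall>j. T v j \<noteq> 0 \<longrightarrow> cmod (T v j) \<le> cmod (v (f j)))"
  have wt: "cmod (of_real (wt n) * z) \<le> cmod z" for n z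
    using wt_bounds(1,2)[of n] by (simp add: norm_mult mult_left_le_one_le)
  \<comment> \<open>Truncated subtraction merges levels 0 and 1, but \<open>up v\<close> vanishes at
    level 0, so the map is injective on its support.\<close>
  have "?P up (\<lambda>(n, m). (n - 1, m))"
    by (auto simp: up_def inj_on_def wt split: nat.splits)
  moreover have "?P down (\<lambda>(n, m). (Suc n, m))"
    by (auto simp: inj_on_def wt)
  moreover have "?P (shift 1) (\<lambda>(n, m). (n, m - 1))" "?P (shift (- 1)) (\<lambda>(n, m). (n, m + 1))"
    by (auto simp: inj_on_def)
  moreover have eig: "cmod (eig j) \<le> 1" for j
    using vac(2) kappa by (cases j) (simp add: cmod_eig mult_le_one power_le_one)
  have "?P (\<lambda>v j. eig j * v j) (\<lambda>j. j)" "?P (\<lambda>v j. cnj (eig j) * v j) (\<lambda>j. j)"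
    using eig by (simp_all add: norm_mult mult_left_le_one_le)
  ultimately show ?thesis
    by (cases l rule: letter.exhaust; rename_tac g; case_tac g; simp only: gen_act.simps split: if_split) blast+
qed

sublocale star_action gen_act
proof
  fix l and v w :: "nat \<times> int \<Rightarrow> complex" and c :: complex
  show "gen_act l (\<lambda>j. v j + w j) = (\<lambda>j. gen_act l v j + gen_act l w j)"
    by (cases l rule: letter.exhaust; rename_tac g; case_tac g)
      (auto simp: up_def down_def shift_def fun_eq_iff algebra_simps split: nat.splits)
  show "gen_act l (\<lambda>j. c * v j) = (\<lambda>j. c * gen_act l v j)"
    by (cases l rule: letter.exhaust; rename_tac g; case_tac g)
      (auto simp: up_def down_def shift_def fun_eq_iff algebra_simps split: nat.splits)
  obtain f where f: "\<And>v. inj_on f {j. gen_act l v j \<noteq> 0}"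
    "\<And>v j. gen_act l v j \<noteq> 0 \<Longrightarrow> cmod (gen_act l v j) \<le> cmod (v (f j))"
    using gen_act_reindex[of l] by blast
  show fin: "v \<in> finsupp \<Longrightarrow> gen_act l v \<in> finsupp"
    by (rule finsupp_reindex[OF _ f(1)]) (use f(2)[of v] in fastforce)+
  have "norm2 (gen_act l v) \<le> norm2 v" if "v \<in> finsupp" for v
    by (rule norm2_reindex_le[of v f, OF that f(1)]) (rule f(2))
  then show "\<exists>C. \<forall>v\<in>finsupp. norm2 (gen_act l v) \<le> C * norm2 v"
    by (intro exI[of _ 1]) simp
next
  fix l and v w :: "nat \<times> int \<Rightarrow> complex"
  assume v: "v \<in> finsupp" and w: "w \<in> finsupp"
  have up: "up v \<in> finsupp" if "v \<in> finsupp" for v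
  proof (rule finsupp_reindex[OF that, of "\<lambda>(n, m). (n - 1, m)"])
  qed (auto simp: up_def inj_on_def split: nat.splits)
  have down: "down v \<in> finsupp" if "v \<in> finsupp" for v
  proof (rule finsupp_reindex[OF that, of "\<lambda>(n, m). (Suc n, m)"])
  qed (auto simp: inj_on_def)
  \<comment> \<open>Conjugate symmetry turns \<open>up_down_adjoint\<close> around, for the letter
    that acts by \<open>down\<close>.\<close>
  have "inner_prod (down v) w = inner_prod v (up w)"
    using up_down_adjoint[OF w, of v] inner_prod_commute v w up down by metis
  then show "inner_prod (gen_act l v) w = inner_prod v (gen_act (adj_letter l) w)"
    using up_down_adjoint[OF v, of w] shift_adjoint[OF v, of _ w] diag_adjoint[OF v]
    by (cases l rule: letter.exhaust; rename_tac g; case_tac g) simp_all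
qed

text \<open>All relators are checked coordinatewise; level 0 is separate because \<open>up\<close>
  vanishes there, which is where the choice of \<open>vac\<close> enters.\<close>

lemma act_relator:
  assumes "r \<in> Uq2_relators q"
  shows "act r v = (\<lambda>j. 0)"
proof -
  define s where "s = complex_of_real ((cmod kappa)\<^sup>2)"
  define t where "t = complex_of_real ((cmod q)\<^sup>2)"
  have t: "t \<noteq> 0" using q_nonzero by (simp add: t_def)
  have s: "s = (if cmod q < 1 then t else inverse t)"
    by (simp add: s_def t_def kappa_def norm_inverse power_inverse)
  have vac: "complex_of_real ((cmod vac)\<^sup>2) = (if cmod q < 1 then 1 else inverse t)"
    by (simp add: t_def vac_def norm_inverse power_inverse)
  have wt: "complex_of_real (wt n) * (complex_of_real (wt n) * z) = (1 - s * s ^ n) * z" for n z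
    unfolding wt_mult s_def by (simp only: power_mult power_Suc of_real_power of_real_mult)
  have eig: "eig (n, m) * (cnj (eig (n, m)) * z) = (if cmod q < 1 then 1 else inverse t) * s ^ n * z"
    "cnj (eig (n, m)) * (eig (n, m) * z) = (if cmod q < 1 then 1 else inverse t) * s ^ n * z" for n m z
    unfolding eig_mult s_def vac[symmetric] by (simp_all only: power_mult of_real_power of_real_mult)
  have eig_D: "eig (n, m) * z = q\<^sup>2 / t * (eig (n, m - 1) * z)" for n m z
    unfolding t_def rho_def[symmetric] by (subst eig_shift) (simp only: mult.assoc)
  have "\<forall>r\<in>Uq2_relators q. act r v (n, m) = 0" for n m
    unfolding Uq2_relators_def Let_def t_def[symmetric]
    by (simp only: ball_simps mult.assoc act_diff act_add act_one act_mult act_fgen act_fstar_fgen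
        act_fconst gen_act.simps)
      (intro conjI; (simp add: eig_D[of _ m]; fail)?; cases "cmod q < 1"; cases n;
        (simp add: eig_Suc kappa_def field_simps q_nonzero; fail)?;
        simp add: wt eig; simp add: t s field_simps)
  then have "act r v (n, m) = 0" for n m using assms by blast
  then show ?thesis by auto
qed

section \<open>Matrix entries and the scalar commutant\<close>

lemma up_basis: "up (basis (n, m)) = (\<lambda>j. of_real (wt n) * basis (Suc n, m) j)"
  by (auto simp: fun_eq_iff basis_def up_def split: nat.splits)

lemma down_basis: "down (basis (Suc n, m)) = (\<lambda>j. of_real (wt n) * basis (n, m) j)"
  by (auto simp: fun_eq_iff basis_def)

lemma shift_basis: "shift 1 (basis (n, m)) = basis (n, m + 1)"
  by (auto simp: fun_eq_iff basis_def)

lemma eig_basis: "(\<lambda>k. eig k * basis j k) = (\<lambda>k. eig j * basis j k)"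
  by (auto simp: fun_eq_iff basis_def)

lemma entry_le_opnorm: "cmod (act x (basis j) k) \<le> opnorm x"
  using norm_component_le[OF act_finsupp[OF basis_finsupp], of x j k] opnorm_bound[OF basis_finsupp, of x j]
  by simp

text \<open>The modulus recovers the level because \<open>0 < cmod kappa < 1\<close>; after
  cancelling, \<open>rho powi m\<close> recovers the second coordinate because \<open>rho\<close> is
  no root of unity.\<close>

lemma eig_inj:
  assumes rho: "\<And>k :: nat. 0 < k \<Longrightarrow> rho ^ k \<noteq> 1" and eq: "eig j = eig k"
  shows "j = k"
proof -
  obtain n m n' m' where j: "j = (n, m)" and k: "k = (n', m')" by (cases j; cases k)
  have "cmod vac * cmod kappa ^ n = cmod vac * cmod kappa ^ n'"
    using arg_cong[OF eq, of cmod] unfolding j k cmod_eig .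
  then have "cmod kappa ^ n = cmod kappa ^ n'"
    using vac(1) by simp
  then have n: "n = n'"
    using power_strict_decreasing[OF _ kappa, of n n'] power_strict_decreasing[OF _ kappa, of n' n]
    by (cases n n' rule: linorder_cases) auto
  then have "rho powi m = rho powi m'"
    using eq vac(1) kappa by (auto simp: j k eig_def)
  then have diff: "rho powi (m - m') = 1" "rho powi (m' - m) = 1"
    by (simp_all add: power_int_diff)
  have "m = m'"
  proof (rule ccontr)
    assume "m \<noteq> m'"
    \<comment> \<open>A choice of sign reduces integer powers to the natural exponents of the
      hypothesis.\<close>
    then have "0 < nat (m - m') \<or> 0 < nat (m' - m)" by auto
    then show False using rho diff by (auto simp: power_int_def split: if_splits)
  qed
  then show ?thesis using n j k by simp
qed

text \<open>In the limit, commuting with \<open>b\<close> kills the entries off the diagonal, since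
  the eigenvalues are distinct, and commuting with \<open>D\<close> and \<open>a\<close> makes
  neighbouring diagonal entries agree, so that all follow the convergent entry at
  \<open>(0, 0)\<close>.\<close>

lemma commutant_scalar:
  assumes rho: "\<And>k :: nat. 0 < k \<Longrightarrow> rho ^ k \<noteq> 1"
    and x: "x \<in> cauchy_seqs opnorm"
    and comm: "\<And>g. (\<lambda>n. opnorm (x n * fgen g - fgen g * x n)) \<longlonglongrightarrow> 0"
  obtains lam where "\<And>j k. (\<lambda>n. act (x n) (basis j) k) \<longlonglongrightarrow> lam * basis j k"
proof -
  let ?e = "\<lambda>j k n. act (x n) (basis j) k"
  have comm': "(\<lambda>n. act (x n) (gen_act (Gen g) (basis j)) k - gen_act (Gen g) (act (x n) (basis j)) k) \<longlonglongrightarrow> 0" for g j k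
  proof (rule Lim_null_comparison[OF _ comm[of g]], intro always_eventually allI)
    fix n
    show "norm (act (x n) (gen_act (Gen g) (basis j)) k - gen_act (Gen g) (act (x n) (basis j)) k)
      \<le> opnorm (x n * fgen g - fgen g * x n)"
      using entry_le_opnorm[of "x n * fgen g - fgen g * x n" j k]
      by (simp only: act_diff act_mult act_fgen)
  qed
  have off: "?e j k \<longlonglongrightarrow> 0" if "j \<noteq> k" for j k
  proof -
    have eig: "eig j - eig k \<noteq> 0" using eig_inj[OF rho, of j k] that by auto
    \<comment> \<open>The entry at \<open>(j, k)\<close> of the commutator with \<open>b\<close> is
      \<open>eig j - eig k\<close> times that of \<open>x n\<close>.\<close>
    have "(\<lambda>n. (eig j - eig k) * ?e j k n) \<longlonglongrightarrow> 0"
      using comm'[of gen_b j k] by (simp add: eig_basis act_vector_scale left_diff_distrib)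
    then show ?thesis using tendsto_mult_left_iff[OF eig, of "?e j k" 0] by simp
  qed
  have step_m: "(\<lambda>i. ?e (n, m + 1) (n, m + 1) i - ?e (n, m) (n, m) i) \<longlonglongrightarrow> 0" for n m
    using comm'[of gen_D "(n, m)" "(n, m + 1)"] by (simp add: shift_basis)
  have step_n: "(\<lambda>i. ?e (Suc n, m) (Suc n, m) i - ?e (n, m) (n, m) i) \<longlonglongrightarrow> 0" for n m
  proof -
    have wt: "complex_of_real (wt n) \<noteq> 0" using wt_bounds(1)[of n] by simp
    \<comment> \<open>For \<open>cmod q < 1\<close> the generator \<open>a\<close> raises the level,
      otherwise it lowers it; the sign in the second case comes from the exchanged roles of the two
      levels.\<close>
    have "(\<lambda>i. of_real (wt n) * (?e (Suc n, m) (Suc n, m) i - ?e (n, m) (n, m) i)) \<longlonglongrightarrow> 0"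
    proof (cases "cmod q < 1")
      case True
      then show ?thesis
        using comm'[of gen_a "(n, m)" "(Suc n, m)"] by (simp add: up_basis act_vector_scale right_diff_distrib)
    next
      case False
      then show ?thesis
        using tendsto_minus[OF comm'[of gen_a "(Suc n, m)" "(n, m)"]]
        by (simp add: down_basis act_vector_scale right_diff_distrib)
    qed
    then show ?thesis by (rule tendsto_mult_left_iff[OF wt, of _ 0, unfolded mult_zero_right, THEN iffD1])
  qed
  have "Cauchy (?e (0, 0) (0, 0))"
  proof (rule CauchyI)
    fix e :: real assume "0 < e"
    from cstar_seminorm.cauchyD[OF opnorm_cstar_seminorm x this]
    obtain N where N: "\<forall>m\<ge>N. \<forall>n\<ge>N. opnorm (x m - x n) < e" by blast
    have "norm (?e (0, 0) (0, 0) m - ?e (0, 0) (0, 0) n) < e" if "m \<ge> N" "n \<ge> N" for m n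
    proof -
      have "norm (?e (0, 0) (0, 0) m - ?e (0, 0) (0, 0) n) \<le> opnorm (x m - x n)"
        using entry_le_opnorm[of "x m - x n" "(0, 0)" "(0, 0)"] by (simp only: act_diff)
      then show ?thesis using N that by (blast intro: le_less_trans)
    qed
    then show "\<exists>M. \<forall>m\<ge>M. \<forall>n\<ge>M. norm (?e (0, 0) (0, 0) m - ?e (0, 0) (0, 0) n) < e" by blast
  qed
  then obtain lam where lam: "?e (0, 0) (0, 0) \<longlonglongrightarrow> lam"
    using Cauchy_convergent unfolding convergent_def by blast
  have "?e (n, 0) (n, 0) \<longlonglongrightarrow> lam" for n
    by (induction n) (auto intro: lam Lim_transform[OF _ step_n])
  then have diag: "?e (n, m) (n, m) \<longlonglongrightarrow> lam" for n m
  proof (induction m rule: int_induct[of _ 0])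
    case (step1 i)
    then show ?case by (auto intro: Lim_transform[OF _ step_m])
  next
    case (step2 i)
    have "(\<lambda>k. ?e (n, i - 1) (n, i - 1) k - ?e (n, i) (n, i) k) \<longlonglongrightarrow> 0"
      using tendsto_minus[OF step_m[of n "i - 1"]] by simp
    then show ?case using step2 by (auto intro: Lim_transform)
  qed auto
  have "?e j k \<longlonglongrightarrow> lam * basis j k" for j k
    using diag[of "fst k" "snd k"] off[of j k] by (cases "j = k") (simp_all add: basis_def)
  then show ?thesis using that by blast
qed

section \<open>Approximate joint eigenvectors\<close>

text \<open>A square with side \<open>L\<close> that starts at level \<open>L\<close>: so far out
  \<open>b\<close> is small, while the boundary is negligible against the area.\<close>

definition window :: "nat \<Rightarrow> (nat \<times> int) set" where
  "window L = {L..<2 * L} \<times> {0..<int L}"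

text \<open>Points on both sides of the border, in both coordinates, so that one set serves
  \<open>up\<close>, \<open>down\<close> and the shifts in either direction.\<close>

definition edge :: "nat \<Rightarrow> (nat \<times> int) set" where
  "edge L = {L - 1, L, 2 * L - 1, 2 * L} \<times> {0..<int L} \<union> {L..<2 * L} \<times> {- 1, 0, int L - 1, int L}"

text \<open>Away from level 0, a formal joint eigenvector of the unweighted shifts with eigenvalues
  \<open>\<sigma>\<close> and \<open>\<tau>\<close>; for eigenvalues of modulus 1 it is not square
  summable, hence the cutoff in \<open>wave\<close>.\<close>

definition phase :: "complex \<Rightarrow> complex \<Rightarrow> nat \<times> int \<Rightarrow> complex" where
  "phase \<sigma> \<tau> j = \<sigma> powi (- int (fst j)) * \<tau> powi (- snd j)"

text \<open>Dividing by \<open>L\<close> normalises \<open>L * L\<close> entries of modulus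
  1.\<close>

definition wave :: "complex \<Rightarrow> complex \<Rightarrow> nat \<Rightarrow> nat \<times> int \<Rightarrow> complex" where
  "wave \<sigma> \<tau> L j = (if j \<in> window L then phase \<sigma> \<tau> j / of_nat L else 0)"

lemma finite_window [simp]: "finite (window L)"
  by (simp add: window_def)

lemma finite_edge [simp]: "finite (edge L)"
  by (simp add: edge_def)

lemma card_window: "card (window L) = L * L"
  by (simp add: window_def card_cartesian_product)

lemma card_edge: "card (edge L) \<le> 8 * L"
proof -
  have four: "card {L - 1, L, 2 * L - 1, 2 * L} \<le> 4" "card {- 1, 0, int L - 1, int L} \<le> 4"
    by (simp_all add: card_insert_if)
  have L: "card {0..<int L} = L" "card {L..<2 * L} = L" by simp_all
  have "card ({L - 1, L, 2 * L - 1, 2 * L} \<times> {0..<int L}) \<le> 4 * L"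
    "card ({L..<2 * L} \<times> {- 1, 0, int L - 1, int L}) \<le> L * 4"
    unfolding card_cartesian_product L by (intro mult_right_mono mult_left_mono four; simp)+
  then show ?thesis
    unfolding edge_def by (intro order.trans[OF card_Un_le]) linarith
qed

lemma edge_Suc:
  "((n, m) \<in> window L) \<noteq> ((Suc n, m) \<in> window L) \<Longrightarrow> (n, m) \<in> edge L \<and> (Suc n, m) \<in> edge L"
  by (auto simp: window_def edge_def)

lemma edge_plus_one:
  "((n, m) \<in> window L) \<noteq> ((n, m + 1) \<in> window L) \<Longrightarrow> (n, m) \<in> edge L \<and> (n, m + 1) \<in> edge L"
  by (auto simp: window_def edge_def)

lemma wave_finsupp: "wave \<sigma> \<tau> L \<in> finsupp"
  by (rule finsupp_subset[of "window L"]) (auto simp: wave_def)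

lemma norm2_wave:
  assumes "cmod \<sigma> = 1" "cmod \<tau> = 1" "0 < L"
  shows "norm2 (wave \<sigma> \<tau> L) = 1"
proof -
  have ph: "cmod (phase \<sigma> \<tau> j) = 1" for j
    using assms by (simp add: phase_def norm_mult norm_power_int)
  have "norm2 (wave \<sigma> \<tau> L) = L2_set (\<lambda>j. cmod (wave \<sigma> \<tau> L j)) (window L)"
    by (rule norm2_superset) (auto simp: wave_def)
  also have "\<dots> = L2_set (\<lambda>j. 1 / real L) (window L)"
    using ph by (auto simp: L2_set_def wave_def norm_divide intro!: sum.cong)
  also have "\<dots> = 1"
    using assms by (simp add: L2_set_def card_window power2_eq_square real_sqrt_divide)
  finally show ?thesis .
qed

text \<open>To the squared norm, \<open>L * L\<close> window entries of size
  \<open>cmod kappa ^ L / L\<close> contribute \<open>(cmod kappa ^ L)\<^sup>2\<close>, and at most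
  \<open>8 * L\<close> edge entries of size \<open>1 / L\<close> contribute \<open>8 / L\<close>.
  The index \<open>Suc n\<close> skips the empty window at \<open>L = 0\<close>.\<close>

lemma small_off_edge:
  assumes "\<And>L j. 0 < L \<Longrightarrow> cmod (w L j) \<le>
    (if j \<in> window L then cmod kappa ^ L / real L else 0) \<or> j \<in> edge L \<and> cmod (w L j) \<le> 1 / real L"
  shows "(\<lambda>n. norm2 (w (Suc n))) \<longlonglongrightarrow> 0"
proof -
  have bound: "norm2 (w L) \<le> sqrt ((cmod kappa ^ L)\<^sup>2 + 8 / real L)" if L: "0 < L" for L
  proof -
    let ?\<alpha> = "(cmod kappa ^ L / real L)\<^sup>2" and ?\<beta> = "(1 / real L)\<^sup>2"
    have "(norm2 (w L))\<^sup>2 \<le> real (card (window L)) * ?\<alpha> + real (card (edge L)) * ?\<beta>"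
    proof (rule norm2_le_two_level)
      fix j
      consider "j \<in> window L" "cmod (w L j) \<le> cmod kappa ^ L / real L" | "cmod (w L j) \<le> 0"
        | "j \<in> edge L" "cmod (w L j) \<le> 1 / real L"
        using assms[OF L, of j] by (auto split: if_splits)
      then show "(cmod (w L j))\<^sup>2 \<le> (if j \<in> window L then ?\<alpha> else 0) + (if j \<in> edge L then ?\<beta> else 0)"
      proof cases
        case 1
        then have "(cmod (w L j))\<^sup>2 \<le> ?\<alpha>" by (intro power_mono) auto
        then show ?thesis using 1 by (simp add: add_increasing2)
      next
        case 3
        then have "(cmod (w L j))\<^sup>2 \<le> ?\<beta>" by (intro power_mono) auto
        then show ?thesis using 3 by (simp add: add_increasing)
      qed simp
    qed simp_all
    also have "\<dots> \<le> real (L * L) * ?\<alpha> + real (8 * L) * ?\<beta>"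
      using card_edge[of L] by (intro add_mono mult_right_mono) (simp_all add: card_window)
    also have "\<dots> = (cmod kappa ^ L)\<^sup>2 + 8 / real L"
      using L by (simp add: power2_eq_square field_simps)
    finally show ?thesis by (rule real_le_rsqrt)
  qed
  have "(\<lambda>n. sqrt ((cmod kappa ^ n)\<^sup>2 + 8 * (1 / real n))) \<longlonglongrightarrow> sqrt (0\<^sup>2 + 8 * 0)"
    using kappa by (intro tendsto_intros LIMSEQ_power_zero lim_1_over_n) auto
  then have "(\<lambda>n. sqrt ((cmod kappa ^ n)\<^sup>2 + 8 / real n)) \<longlonglongrightarrow> 0" by simp
  then have "(\<lambda>n. sqrt ((cmod kappa ^ Suc n)\<^sup>2 + 8 / real (Suc n))) \<longlonglongrightarrow> 0"
    by (rule LIMSEQ_Suc)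
  then show ?thesis
    by (rule real_tendsto_sandwich[OF _ _ tendsto_const, rotated 2]) (simp_all add: bound del: power_Suc of_nat_Suc)
qed

text \<open>A weight lies between 0 and 1, so its distance from 1 is at most that of its square,
  which is a power of \<open>cmod kappa\<close>.\<close>

lemma wt_close: "cmod (of_real (wt k) - 1) \<le> cmod kappa ^ k" "cmod (of_real (wt k)) \<le> 1"
proof -
  have "1 - wt k \<le> 1 - (wt k)\<^sup>2"
    using wt_bounds(1,2)[of k] by (simp add: power2_eq_square mult_left_le)
  also have "\<dots> = cmod kappa ^ (2 * Suc k)" by (simp only: wt_bounds(3))
  also have "\<dots> \<le> cmod kappa ^ k" using kappa by (intro power_decreasing) auto
  finally have "\<bar>wt k - 1\<bar> \<le> cmod kappa ^ k" using wt_bounds(2)[of k] by linarith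
  then show "cmod (of_real (wt k) - 1) \<le> cmod kappa ^ k"
    by (metis norm_of_real of_real_1 of_real_diff)
  show "cmod (of_real (wt k)) \<le> 1" using wt_bounds(1,2)[of k] by simp
qed

lemma kappa_power_mono: "L \<le> k \<Longrightarrow> cmod kappa ^ k \<le> cmod kappa ^ L"
  using kappa by (intro power_decreasing) auto

context
  fixes \<sigma> \<tau> :: complex
  assumes \<sigma>: "cmod \<sigma> = 1" and \<tau>: "cmod \<tau> = 1"
begin

lemma unit_inverse: "\<sigma> \<noteq> 0" "\<tau> \<noteq> 0" "cnj \<sigma> = inverse \<sigma>" "cnj \<tau> = inverse \<tau>"
proof -
  show "\<sigma> \<noteq> 0" "\<tau> \<noteq> 0" using \<sigma> \<tau> by auto
  show "cnj \<sigma> = inverse \<sigma>" "cnj \<tau> = inverse \<tau>"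
    using \<sigma> \<tau> complex_norm_square[of \<sigma>] complex_norm_square[of \<tau>]
    by (metis inverse_unique mult.commute of_real_1 one_power2)+
qed

lemma cmod_phase [simp]: "cmod (phase \<sigma> \<tau> j) = 1"
  using \<sigma> \<tau> by (simp add: phase_def norm_mult norm_power_int)

lemma phase_Suc: "\<sigma> * phase \<sigma> \<tau> (Suc n, m) = phase \<sigma> \<tau> (n, m)"
  "cnj \<sigma> * phase \<sigma> \<tau> (n, m) = phase \<sigma> \<tau> (Suc n, m)"
  using unit_inverse by (simp_all add: phase_def power_int_diff power_int_minus field_simps power_int_add)

lemma phase_shift: "\<tau> * phase \<sigma> \<tau> (n, m) = phase \<sigma> \<tau> (n, m - 1)"
  "cnj \<tau> * phase \<sigma> \<tau> (n, m) = phase \<sigma> \<tau> (n, m + 1)"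
  using unit_inverse by (simp_all add: phase_def power_int_diff power_int_minus field_simps power_int_add)

text \<open>With \<open>p\<close> the weight, \<open>s\<close> the eigenvalue, \<open>j\<close> the
  source and \<open>k\<close> the target of a shift: inside the window the phases match and leave
  the weight defect \<open>p - 1\<close>, at the border a single term survives, and outside there is
  nothing.\<close>

lemma wave_error:
  assumes "cmod p \<le> 1" "cmod s = 1" "s * phase \<sigma> \<tau> k = phase \<sigma> \<tau> j"
  shows "cmod (p * wave \<sigma> \<tau> L j - s * wave \<sigma> \<tau> L k) \<le>
    (if j \<in> window L \<and> k \<in> window L then cmod (p - 1) / real L
     else if j \<in> window L \<or> k \<in> window L then 1 / real L else 0)"
proof -
  have "p * wave \<sigma> \<tau> L j - s * wave \<sigma> \<tau> L k = (p - 1) * phase \<sigma> \<tau> j / of_nat L" if "j \<in> window L" "k \<in> window L"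
    using that by (simp add: wave_def left_diff_distrib diff_divide_distrib flip: assms(3))
  then show ?thesis
    using assms(1,2) by (auto simp: wave_def norm_mult norm_divide divide_right_mono)
qed

lemma wave_up: "(\<lambda>n. norm2 (\<lambda>j. up (wave \<sigma> \<tau> (Suc n)) j - \<sigma> * wave \<sigma> \<tau> (Suc n) j)) \<longlonglongrightarrow> 0"
proof (rule small_off_edge[of "\<lambda>L j. up (wave \<sigma> \<tau> L) j - \<sigma> * wave \<sigma> \<tau> L j"])
  fix L :: nat and j :: "nat \<times> int" assume L: "0 < L"
  obtain n m where j: "j = (n, m)" by (cases j)
  show "cmod (up (wave \<sigma> \<tau> L) j - \<sigma> * wave \<sigma> \<tau> L j) \<le> (if j \<in> window L then cmod kappa ^ L / real L else 0) \<or>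
      j \<in> edge L \<and> cmod (up (wave \<sigma> \<tau> L) j - \<sigma> * wave \<sigma> \<tau> L j) \<le> 1 / real L"
  proof (cases n)
    case 0
    \<comment> \<open>Level 0 lies below the window because \<open>0 < L\<close>, so both terms
      vanish.\<close>
    then show ?thesis using L by (simp add: j wave_def window_def)
  next
    case (Suc k)
    have "cmod (of_real (wt k) - 1) / real L \<le> cmod kappa ^ L / real L" if "(k, m) \<in> window L"
      using that by (intro divide_right_mono order.trans[OF wt_close(1) kappa_power_mono]) (auto simp: window_def)
    then show ?thesis
      using wave_error[OF wt_close(2) \<sigma> phase_Suc(1), of k L k m] edge_Suc[of k m L]
      by (auto simp: j Suc split: if_splits)
  qed
qed

lemma wave_down: "(\<lambda>n. norm2 (\<lambda>j. down (wave \<sigma> \<tau> (Suc n)) j - cnj \<sigma> * wave \<sigma> \<tau> (Suc n) j)) \<longlonglongrightarrow> 0"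
proof (rule small_off_edge[of "\<lambda>L j. down (wave \<sigma> \<tau> L) j - cnj \<sigma> * wave \<sigma> \<tau> L j"])
  fix L :: nat and j :: "nat \<times> int" assume L: "0 < L"
  obtain n m where j: "j = (n, m)" by (cases j)
  have "cmod (of_real (wt n) - 1) / real L \<le> cmod kappa ^ L / real L" if "(n, m) \<in> window L"
    using that by (intro divide_right_mono order.trans[OF wt_close(1) kappa_power_mono]) (auto simp: window_def)
  then show "cmod (down (wave \<sigma> \<tau> L) j - cnj \<sigma> * wave \<sigma> \<tau> L j) \<le> (if j \<in> window L then cmod kappa ^ L / real L else 0) \<or>
      j \<in> edge L \<and> cmod (down (wave \<sigma> \<tau> L) j - cnj \<sigma> * wave \<sigma> \<tau> L j) \<le> 1 / real L"
    using wave_error[OF wt_close(2) _ phase_Suc(2), of n L n m] \<sigma> edge_Suc[of n m L]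
    by (auto simp: j split: if_splits)
qed

lemma wave_shift:
  "(\<lambda>n. norm2 (\<lambda>j. shift 1 (wave \<sigma> \<tau> (Suc n)) j - \<tau> * wave \<sigma> \<tau> (Suc n) j)) \<longlonglongrightarrow> 0"
  "(\<lambda>n. norm2 (\<lambda>j. shift (- 1) (wave \<sigma> \<tau> (Suc n)) j - cnj \<tau> * wave \<sigma> \<tau> (Suc n) j)) \<longlonglongrightarrow> 0"
proof -
  show "(\<lambda>n. norm2 (\<lambda>j. shift 1 (wave \<sigma> \<tau> (Suc n)) j - \<tau> * wave \<sigma> \<tau> (Suc n) j)) \<longlonglongrightarrow> 0"
  proof (rule small_off_edge[of "\<lambda>L j. shift 1 (wave \<sigma> \<tau> L) j - \<tau> * wave \<sigma> \<tau> L j"])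
    fix L :: nat and j :: "nat \<times> int" assume L: "0 < L"
    obtain n m where j: "j = (n, m)" by (cases j)
    show "cmod (shift 1 (wave \<sigma> \<tau> L) j - \<tau> * wave \<sigma> \<tau> L j) \<le> (if j \<in> window L then cmod kappa ^ L / real L else 0) \<or>
        j \<in> edge L \<and> cmod (shift 1 (wave \<sigma> \<tau> L) j - \<tau> * wave \<sigma> \<tau> L j) \<le> 1 / real L"
      using wave_error[OF _ \<tau> phase_shift(1), of 1 L n m] edge_plus_one[of n "m - 1" L]
      by (auto simp: j split: if_splits)
  qed
  show "(\<lambda>n. norm2 (\<lambda>j. shift (- 1) (wave \<sigma> \<tau> (Suc n)) j - cnj \<tau> * wave \<sigma> \<tau> (Suc n) j)) \<longlonglongrightarrow> 0"
  proof (rule small_off_edge[of "\<lambda>L j. shift (- 1) (wave \<sigma> \<tau> L) j - cnj \<tau> * wave \<sigma> \<tau> L j"])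
    fix L :: nat and j :: "nat \<times> int" assume L: "0 < L"
    obtain n m where j: "j = (n, m)" by (cases j)
    show "cmod (shift (- 1) (wave \<sigma> \<tau> L) j - cnj \<tau> * wave \<sigma> \<tau> L j) \<le> (if j \<in> window L then cmod kappa ^ L / real L else 0) \<or>
        j \<in> edge L \<and> cmod (shift (- 1) (wave \<sigma> \<tau> L) j - cnj \<tau> * wave \<sigma> \<tau> L j) \<le> 1 / real L"
      using wave_error[OF _ _ phase_shift(2), of 1 L n m] \<tau> edge_plus_one[of n m L]
      by (auto simp: j split: if_splits)
  qed
qed

text \<open>On the window the entries of \<open>d\<close> have modulus at most
  \<open>cmod kappa ^ L\<close>. Taking \<open>eig\<close> or its conjugate for \<open>d\<close>
  covers \<open>b\<close> and its adjoint, with approximate eigenvalue 0.\<close>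

lemma wave_diag:
  assumes "\<And>j. cmod (d j) = cmod (eig j)"
  shows "(\<lambda>n. norm2 (\<lambda>j. d j * wave \<sigma> \<tau> (Suc n) j)) \<longlonglongrightarrow> 0"
proof (rule small_off_edge[of "\<lambda>L j. d j * wave \<sigma> \<tau> L j"])
  fix L :: nat and j :: "nat \<times> int" assume L: "0 < L"
  obtain n m where j: "j = (n, m)" by (cases j)
  have "cmod vac * cmod kappa ^ n \<le> 1 * cmod kappa ^ L" if "L \<le> n"
    using vac kappa kappa_power_mono[OF that] by (intro mult_mono) auto
  then show "cmod (d j * wave \<sigma> \<tau> L j) \<le> (if j \<in> window L then cmod kappa ^ L / real L else 0) \<or>
      j \<in> edge L \<and> cmod (d j * wave \<sigma> \<tau> L j) \<le> 1 / real L"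
    by (auto simp: j wave_def window_def norm_mult norm_divide assms cmod_eig intro!: divide_right_mono)
qed

end
end


section \<open>Non-isomorphism\<close>

context Uq2_rep
begin

text \<open>Comparing the two sphere relations forces \<open>\<phi>\<close> to vanish at
  \<open>b\<close>, as \<open>cmod q \<noteq> 1\<close>; then its values at \<open>a\<close> and
  \<open>D\<close> have modulus 1, and the waves with matching eigenvalues feed
  \<open>character_le_opnorm\<close>.\<close>

lemma functional_le_opnorm:
  assumes add: "\<And>x y. \<phi> (x + y) = \<phi> x + \<phi> y" and mult: "\<And>x y. \<phi> (x * y) = \<phi> x * \<phi> y"
    and fconst: "\<And>c. \<phi> (fconst c) = c" and star: "\<And>x. \<phi> (fstar x) = cnj (\<phi> x)"
    and rel: "\<And>r. r \<in> Uq2_relators q \<Longrightarrow> \<phi> r = 0"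
  shows "cmod (\<phi> x) \<le> opnorm x"
proof -
  have diff: "\<phi> (x - y) = \<phi> x - \<phi> y" for x y
    using add[of "x - y" y] by simp
  have one: "\<phi> 1 = 1" using fconst[of 1] by simp
  let ?a = "\<phi> (fgen gen_a)" and ?b = "\<phi> (fgen gen_b)" and ?D = "\<phi> (fgen gen_D)"
  have norm: "z * cnj z = of_real ((cmod z)\<^sup>2)" "cnj z * z = of_real ((cmod z)\<^sup>2)" for z
    by (simp_all add: mult.commute flip: complex_norm_square)
  have rels: "\<forall>r\<in>Uq2_relators q. \<phi> r = 0" using rel by blast
  then have "?a * cnj ?a + ?b * cnj ?b = 1" "?D * cnj ?D = 1"
    "cnj ?a * ?a + of_real ((cmod q)\<^sup>2) * (cnj ?b * ?b) = 1"
    unfolding Uq2_relators_def Let_def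
    by (simp_all only: ball_simps mult.assoc diff add mult star fconst one) simp_all
  then have "complex_of_real ((cmod ?a)\<^sup>2 + (cmod ?b)\<^sup>2) = 1" "complex_of_real ((cmod ?D)\<^sup>2) = 1"
    "complex_of_real ((cmod ?a)\<^sup>2 + (cmod q)\<^sup>2 * (cmod ?b)\<^sup>2) = 1"
    by (simp_all only: norm of_real_add of_real_mult)
  then have sq: "(cmod ?a)\<^sup>2 + (cmod ?b)\<^sup>2 = 1" "(cmod ?D)\<^sup>2 = 1"
    "(cmod ?a)\<^sup>2 + (cmod q)\<^sup>2 * (cmod ?b)\<^sup>2 = 1"
    by (simp_all only: of_real_eq_1_iff)
  have 0: "((cmod q)\<^sup>2 - 1) * (cmod ?b)\<^sup>2 = 0"
    using sq(1,3) unfolding left_diff_distrib mult_1 by linarith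
  have cmod_1: "(cmod z)\<^sup>2 = 1 \<longleftrightarrow> cmod z = 1" for z
    using norm_ge_zero[of z] by (auto simp: power2_eq_1_iff simp del: norm_ge_zero)
  have "(cmod q)\<^sup>2 \<noteq> 1" using q_modulus by (simp add: cmod_1)
  with 0 have b: "?b = 0" by simp
  have a: "cmod ?a = 1" and D: "cmod ?D = 1"
    using sq b by (simp_all add: cmod_1)
  \<comment> \<open>In \<open>wave_up\<close> the eigenvalue \<open>\<sigma>\<close> belongs to
    \<open>up\<close>, which stands for \<open>a\<close> if \<open>cmod q < 1\<close> and for its
    adjoint otherwise.\<close>
  define \<sigma> where "\<sigma> = (if cmod q < 1 then ?a else cnj ?a)"
  have \<sigma>: "cmod \<sigma> = 1" using a by (simp add: \<sigma>_def)
  have adj: "\<phi> (Poly_Mapping.single (Word [Adj g]) 1) = cnj (\<phi> (fgen g))" for g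
    using star[of "fgen g"] by simp
  note w = wave_up[OF \<sigma> D] wave_down[OF \<sigma> D] wave_shift[OF \<sigma> D]
    wave_diag[OF \<sigma> D, of eig] wave_diag[OF \<sigma> D, of "\<lambda>j. cnj (eig j)"]
  show ?thesis
  proof (rule character_le_opnorm[OF add mult fconst, of "\<lambda>n. wave \<sigma> ?D (Suc n)"])
    show "wave \<sigma> ?D (Suc n) \<in> finsupp" "norm2 (wave \<sigma> ?D (Suc n)) = 1" for n
      using norm2_wave[OF \<sigma> D, of "Suc n"] by (simp_all add: wave_finsupp)
    show "(\<lambda>n. norm2 (\<lambda>j. gen_act l (wave \<sigma> ?D (Suc n)) j -
        \<phi> (Poly_Mapping.single (Word [l]) 1) * wave \<sigma> ?D (Suc n) j)) \<longlonglongrightarrow> 0" for l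
      using w b \<sigma>_def
      by (cases l rule: letter.exhaust; rename_tac g; case_tac g; cases "cmod q < 1") (simp_all add: adj)
  qed
qed

text \<open>A Cauchy sequence \<open>x\<close> for \<open>X\<close> converges to a scalar in
  \<open>opnorm\<close>, and a character respects both limits: it is bounded by the norm of the
  algebra and, on the free algebra, by \<open>opnorm\<close>.\<close>

lemma central_character_unique:
  assumes rho: "\<And>k :: nat. 0 < k \<Longrightarrow> rho ^ k \<noteq> 1"
    and X: "X \<in> carrier (C_Uq2 q)"
    and central: "\<And>Y. Y \<in> carrier (C_Uq2 q) \<Longrightarrow> X \<otimes>\<^bsub>C_Uq2 q\<^esub> Y = Y \<otimes>\<^bsub>C_Uq2 q\<^esub> X"
  obtains lam where "\<And>\<phi>. \<phi> \<in> star_hom (C_Uq2 q) complex_cstar \<Longrightarrow> \<phi> X = lam"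
proof -
  let ?R = "Uq2_relators q"
  let ?u = "universal_seminorm ?R"
  note bdd = Uq2_seminorms_bounded[OF q_nonzero]
  have A: "C_Uq2 q = cstar_completion ?u"
    by (simp add: C_Uq2_def universal_cstar_def)
  interpret u: cstar_seminorm ?u
    using universal_seminorm_in[OF bdd] by (simp add: relator_seminorms_def)
  interpret A: unital_cstar_algebra "C_Uq2 q"
    by (rule C_Uq2_cstar_algebra[OF q_nonzero])
  \<comment> \<open>The representation kills the relators, so \<open>opnorm\<close> is among the
    seminorms whose supremum is the universal one.\<close>
  have le: "opnorm y \<le> ?u y" for y
    by (intro universal_seminorm_upper[OF bdd] opnorm_relator_seminorm act_relator)
  obtain x where x: "x \<in> cauchy_seqs ?u" "X = u.cls x"
    using X unfolding A by (rule u.carrierE)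
  have x_opnorm: "x \<in> cauchy_seqs opnorm"
    unfolding cauchy_seqs_def
  proof clarify
    fix e :: real assume "0 < e"
    from u.cauchyD[OF x(1) this] obtain N where "\<forall>m\<ge>N. \<forall>n\<ge>N. ?u (x m - x n) < e" by blast
    then show "\<exists>N. \<forall>m\<ge>N. \<forall>n\<ge>N. opnorm (x m - x n) < e"
      by (intro exI[of _ N]) (simp add: le_less_trans[OF le])
  qed
  have comm: "(\<lambda>n. opnorm (x n * fgen g - fgen g * x n)) \<longlonglongrightarrow> 0" for g
  proof -
    have "u.cls (\<lambda>n. x n * fgen g) = u.cls (\<lambda>n. fgen g * x n)"
      using central[of "u.cls (\<lambda>n. fgen g)"] x by (simp add: A u.cls_mult)
    then have lim: "(\<lambda>n. ?u (x n * fgen g - fgen g * x n)) \<longlonglongrightarrow> 0"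
      using x(1) by (subst (asm) u.cls_eq_iff) auto
    show ?thesis
      by (rule real_tendsto_sandwich[OF _ _ tendsto_const lim]) (simp_all add: le opnorm_nonneg)
  qed
  obtain lam where "\<And>j k. (\<lambda>n. act (x n) (basis j) k) \<longlonglongrightarrow> lam * basis j k"
    using commutant_scalar[OF rho x_opnorm comm] by blast
  then have lam: "(\<lambda>n. opnorm (x n - fconst lam)) \<longlonglongrightarrow> 0"
    by (rule opnorm_tendsto_scalar[OF x_opnorm])
  have dist: "(\<lambda>n. cnorm (C_Uq2 q) (X \<ominus>\<^bsub>C_Uq2 q\<^esub> u.cls (\<lambda>_. x n))) \<longlonglongrightarrow> 0"
  proof (rule LIMSEQ_I)
    fix e :: real assume "0 < e"
    then obtain N where N: "\<forall>m\<ge>N. \<forall>n\<ge>N. ?u (x m - x n) < e / 2"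
      using u.cauchyD[OF x(1), of "e / 2"] by auto
    have "cnorm (C_Uq2 q) (X \<ominus>\<^bsub>C_Uq2 q\<^esub> u.cls (\<lambda>_. x n)) \<le> e / 2" if "n \<ge> N" for n
      unfolding A x(2) by (rule u.dist_le[OF x(1), of _ N]) (use N that in \<open>auto simp: less_imp_le\<close>)
    moreover have "0 \<le> cnorm (C_Uq2 q) (X \<ominus>\<^bsub>C_Uq2 q\<^esub> u.cls (\<lambda>_. x n))" for n
      using X by (intro A.cnorm_nonneg A.minus_closed) (simp_all add: A)
    ultimately show "\<exists>no. \<forall>n\<ge>no. norm (cnorm (C_Uq2 q) (X \<ominus>\<^bsub>C_Uq2 q\<^esub> u.cls (\<lambda>_. x n)) - 0) < e"
      using \<open>0 < e\<close> by (intro exI[of _ N] allI impI) (simp add: le_less_trans[of _ "e / 2"])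
  qed
  have "\<phi> X = lam" if \<phi>: "\<phi> \<in> star_hom (C_Uq2 q) complex_cstar" for \<phi>
  proof -
    note hom = A.character_simps[OF \<phi>, unfolded A]
    let ?\<phi> = "\<lambda>y. \<phi> (u.cls (\<lambda>_. y))"
    have \<phi>_add: "?\<phi> (y + z) = ?\<phi> y + ?\<phi> z" for y z
      using hom(2)[of "u.cls (\<lambda>_. y)" "u.cls (\<lambda>_. z)"] by (simp add: u.cls_add)
    have \<phi>_mult: "?\<phi> (y * z) = ?\<phi> y * ?\<phi> z" for y z
      using hom(3)[of "u.cls (\<lambda>_. y)" "u.cls (\<lambda>_. z)"] by (simp add: u.cls_mult)
    have \<phi>_fconst: "?\<phi> (fconst c) = c" for c
      using hom(4)[of "u.cls (\<lambda>_. 1)" c] hom(1) by (simp add: u.cls_smult u.cls_one)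
    have \<phi>_star: "?\<phi> (fstar y) = cnj (?\<phi> y)" for y
      using hom(5)[of "u.cls (\<lambda>_. y)"] by (simp add: u.cls_star)
    have \<phi>_zero: "?\<phi> 0 = 0" using \<phi>_fconst[of 0] by simp
    have \<phi>_rel: "?\<phi> r = 0" if "r \<in> ?R" for r
    proof -
      have "?u r = 0" using that universal_seminorm_in[OF bdd] by (simp add: relator_seminorms_def)
      then have "u.cls (\<lambda>_. r) = u.cls (\<lambda>_. 0)" by (subst u.cls_eq_iff) auto
      then show ?thesis using \<phi>_zero by simp
    qed
    have \<phi>_diff: "?\<phi> (y - z) = ?\<phi> y - ?\<phi> z" for y z
      using \<phi>_add[of "y - z" z] by simp
    \<comment> \<open>Split at the value of \<open>\<phi>\<close> on the constant class of
      \<open>x n\<close>: contractivity bounds the first part, \<open>functional_le_opnorm\<close>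
      the second.\<close>
    have "cmod (\<phi> X - lam) \<le> cnorm (C_Uq2 q) (X \<ominus>\<^bsub>C_Uq2 q\<^esub> u.cls (\<lambda>_. x n)) + opnorm (x n - fconst lam)" for n
    proof -
      have cl: "u.cls (\<lambda>_. x n) \<in> carrier (C_Uq2 q)" by (simp add: A)
      have eq: "X \<ominus>\<^bsub>C_Uq2 q\<^esub> u.cls (\<lambda>_. x n) \<oplus>\<^bsub>C_Uq2 q\<^esub> u.cls (\<lambda>_. x n) = X"
        using X cl by (simp add: a_minus_def A.a_assoc A.l_neg)
      have "\<phi> X - ?\<phi> (x n) = \<phi> (X \<ominus>\<^bsub>C_Uq2 q\<^esub> u.cls (\<lambda>_. x n))"
        using A.character_simps(2)[OF \<phi> A.minus_closed[OF X cl] cl] unfolding eq by simp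
      then have "cmod (\<phi> X - ?\<phi> (x n)) \<le> cnorm (C_Uq2 q) (X \<ominus>\<^bsub>C_Uq2 q\<^esub> u.cls (\<lambda>_. x n))"
        using A.character_le_cnorm[OF \<phi> A.minus_closed[OF X cl]] by simp
      moreover have "cmod (?\<phi> (x n) - lam) \<le> opnorm (x n - fconst lam)"
        using functional_le_opnorm[of ?\<phi>, OF \<phi>_add \<phi>_mult \<phi>_fconst \<phi>_star \<phi>_rel, of "x n - fconst lam"]
        by (simp only: \<phi>_diff \<phi>_fconst)
      ultimately show ?thesis
        using norm_triangle_ineq[of "\<phi> X - ?\<phi> (x n)" "?\<phi> (x n) - lam"] by simp
    qed
    then have "cmod (\<phi> X - lam) \<le> 0 + 0"
      by (intro LIMSEQ_le_const[OF tendsto_add[OF dist lam]]) blast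
    then show ?thesis by simp
  qed
  then show ?thesis by (rule that)
qed

end

section \<open>Transport along an isomorphism and the contradiction\<close>

lemma star_hom_comp:
  assumes "f \<in> star_hom A B" "g \<in> star_hom B C"
  shows "g \<circ> f \<in> star_hom A C"
  using assms unfolding star_hom_def by (auto intro: ring_hom_trans simp: ring_hom_closed)

theorem theorem3p1:
  fixes q :: complex and q' \<theta> :: real
  assumes "q \<notin> \<real>"
    and "cmod q \<noteq> 1"
    and "\<theta> = Arg q / pi"
    and "\<theta> \<notin> \<rat>"
    and "q' \<noteq> 0"
  shows "\<not> star_isomorphic (C_Uq2 q) (C_Uq2 (complex_of_real q'))"
proof
  let ?A = "C_Uq2 q" and ?B = "C_Uq2 (complex_of_real q')"
  let ?g = "universal_gen (Uq2_relators (complex_of_real q'))"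
  assume "star_isomorphic ?A ?B"
  then obtain h where h: "h \<in> star_hom ?A ?B" and bij: "bij_betw h (carrier ?A) (carrier ?B)"
    by (auto simp: star_isomorphic_def)
  have q0: "q \<noteq> 0" using assms(1) by auto
  have q'0: "complex_of_real q' \<noteq> 0" using assms(5) by simp
  interpret Uq2_rep q using q0 assms(2) by unfold_locales
  interpret A: unital_cstar_algebra ?A by (rule C_Uq2_cstar_algebra[OF q0])
  \<comment> \<open>As \<open>rho = cis (2 * Arg q)\<close>, the equation \<open>rho ^ k = 1\<close>
    makes \<open>k * (2 * Arg q)\<close> an integer multiple \<open>n\<close> of
    \<open>2 * pi\<close>, that is \<open>\<theta> = n / k\<close>.\<close>
  have rho: "rho ^ k \<noteq> 1" if "0 < k" for k :: nat
  proof
    assume eq: "rho ^ k = 1"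
    have "q = of_real (cmod q) * cis (Arg q)"
      using rcis_cmod_Arg[of q] by (simp add: rcis_def)
    then have "q\<^sup>2 = (of_real (cmod q) * cis (Arg q))\<^sup>2" by simp
    also have "\<dots> = of_real ((cmod q)\<^sup>2) * cis (2 * Arg q)"
      using Complex.DeMoivre[of "Arg q" 2] by (simp add: power_mult_distrib)
    finally have "rho = cis (2 * Arg q)"
      using q0 by (simp add: rho_def)
    then have "cis (real k * (2 * Arg q)) = 1" using eq by (simp add: Complex.DeMoivre)
    then have "cos (real k * (2 * Arg q)) = 1" by (simp add: complex_eq_iff)
    then obtain n :: int where "real k * (2 * Arg q) = of_int n * 2 * pi"
      by (auto simp: cos_one_2pi_int)
    then have "\<theta> = of_int n / of_nat k" using that by (simp add: assms(3) field_simps)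
    then show False using assms(4) by simp
  qed
  have D: "?g gen_D \<in> carrier ?B"
    using C_Uq2_triple[OF q'0] by (simp add: Uq2_triple_def)
  then have "?g gen_D \<in> h ` carrier ?A"
    using bij_betw_imp_surj_on[OF bij] by simp
  then obtain z where z: "h z = ?g gen_D" "z \<in> carrier ?A"
    by (elim imageE) simp
  have ring: "h \<in> ring_hom ?A ?B" using h by (simp add: star_hom_def)
  \<comment> \<open>Both products have the same image, since \<open>D\<close> is central in the
    target, and \<open>h\<close> is injective.\<close>
  have central: "z \<otimes>\<^bsub>?A\<^esub> y = y \<otimes>\<^bsub>?A\<^esub> z" if y: "y \<in> carrier ?A" for y
  proof -
    have "h (z \<otimes>\<^bsub>?A\<^esub> y) = h (y \<otimes>\<^bsub>?A\<^esub> z)"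
      using gen_D_central[OF assms(5) ring_hom_closed[OF ring y]] z y
      by (simp add: ring_hom_mult[OF ring])
    then show ?thesis
      by (rule inj_onD[OF bij_betw_imp_inj_on[OF bij]]) (use z(2) y in auto)
  qed
  obtain lam where lam: "\<And>\<phi>. \<phi> \<in> star_hom ?A complex_cstar \<Longrightarrow> \<phi> z = lam"
    using central_character_unique[OF rho z(2) central] by blast
  \<comment> \<open>Each such \<open>d\<close> is the value at \<open>D\<close> of a character of
    the target; composed with \<open>h\<close> it becomes a value at \<open>z\<close>.\<close>
  have "d = lam" if "cmod d = 1" for d
  proof -
    have dd: "d * cnj d = 1"
      using that by (metis complex_norm_square of_real_1 one_power2)
    then have "cnj d * d = 1" by (simp add: mult.commute)
    with dd have "Uq2_triple (complex_of_real q') complex_cstar 1 0 d"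
      by (simp add: Uq2_triple_def)
    then obtain \<psi> where \<psi>: "\<psi> \<in> star_hom ?B complex_cstar" "\<psi> (?g gen_D) = d"
      using C_Uq2_universal[OF q'0 unital_cstar_algebra_complex] by blast
    then show ?thesis
      using lam[OF star_hom_comp[OF h \<psi>(1)]] z(1) by simp
  qed
  \<comment> \<open>Two different points of the unit circle suffice.\<close>
  from this[of 1] this[of "- 1"] show False by simp
qed

end
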